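(* Let $0<\delta\le 1$, let $g:\mathbb R\to\mathbb R$ be a $1$-periodic continuous function with Fourier coefficients $C_k$ ($k\in\mathbb Z$), where $C_0=0$, and let $$G_\delta(x)=\sum_{n=1}^{\infty}\frac{g(n^2x)}{n^{1+\delta}}.$$ Suppose that $\sum_{k=1}^{\infty}|C_k|\,k^{\frac{\epsilon+\delta}{2}}<\infty$ for some $\epsilon>0$, and that there exist positive integers $a_0$ and $q_0$ with $\gcd(a_0,q_0)=1$ and a positive square-free integer $d_0$ such that $$S_{d_0}(a_0;q_0)=\sum_{\substack{k=m^2d_0\\ m\in\mathbb N,\ m\ge 1}}C_k\,k^{\delta/2}\,G(ka_0;q_0)\neq 0.$$ Then the lower box dimension of the graph of $G_\delta$ satisfies $$\underline{\dim}_{\mathrm B}(\mathrm{graph}(G_\delta))\ge \frac74-\frac{\delta}{2}.$$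
   Context: Write $e(x):=e^{2\pi i x}$. The Fourier expansion of $g$ is $g(x)=\sum_{k\in\mathbb Z}C_k e(kx)$, with $C_{-k}=\overline{C_k}$ since $g$ is real; throughout, $C_0=0$. For integers $t$ and $q\ge1$, $G(t;q):=\frac1q\sum_{n=1}^{q}e\left(\frac{tn^2}{q}\right)$ is the quadratic Gauss mean (not to be confused with the function $G_\delta$). The graph of $G_\delta$ is $\{(x,G_\delta(x)):x\in[0,1]\}\subset\mathbb R^2$. The lower box dimension is $\underline{\dim}_{\mathrm B}(E)=\liminf_{N\to\infty}\frac{\log A_N(E)}{\log N}$, where $A_N(E)$ is the minimum number of boxes of side $1/N$ needed to cover $E$. *)

theory Defs
  imports "HOL-Analysis.Analysis" "HOL-Computational_Algebra.Squarefree"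
begin

definition e :: "real \<Rightarrow> complex" where
  "e x = exp (2 * of_real pi * \<i> * of_real x)"

definition fourier_coeff :: "(real \<Rightarrow> real) \<Rightarrow> int \<Rightarrow> complex" where
  "fourier_coeff g k = integral {0..1} (\<lambda>x. of_real (g x) * e (- (of_int k * x)))"

definition gauss_mean :: "int \<Rightarrow> nat \<Rightarrow> complex" where
  "gauss_mean t q = (1 / of_nat q) * (\<Sum>n=1..q. e (of_int t * (real n)\<^sup>2 / real q))"

(* The sum over n \<ge> 1 is shifted to start at 0.  It converges absolutely for delta > 0 and
   bounded g. *)
definition G_delta :: "real \<Rightarrow> (real \<Rightarrow> real) \<Rightarrow> real \<Rightarrow> real" where
  "G_delta \<delta> g x = (\<Sum>n. g ((real (Suc n))\<^sup>2 * x) / real (Suc n) powr (1 + \<delta>))"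

(* An unordered sum; it equals 0 if the family is not summable.  Since the Gauss means have modulus
   at most 1, the family is absolutely summable whenever the sum of |C_k| k^(delta/2) is finite. *)
definition S_sum :: "real \<Rightarrow> (real \<Rightarrow> real) \<Rightarrow> nat \<Rightarrow> nat \<Rightarrow> nat \<Rightarrow> complex" where
  "S_sum \<delta> g d a q =
     (\<Sum>\<^sub>\<infinity>k\<in>{m\<^sup>2 * d | m. m \<ge> 1}.
        fourier_coeff g (int k) * of_real (real k powr (\<delta> / 2)) * gauss_mean (int k * int a) q)"

definition graph_on_unit :: "(real \<Rightarrow> real) \<Rightarrow> (real \<times> real) set" where
  "graph_on_unit f = (\<lambda>x. (x, f x)) ` {0..1}"

(* Boxes are closed, axis-parallel and arbitrarily placed (not restricted to a grid).  Meaningful for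
   bounded E and N \<ge> 1, where finite covers exist; the infimum of the empty set of naturals is 0. *)
definition box_count :: "(real \<times> real) set \<Rightarrow> nat \<Rightarrow> nat" where
  "box_count E N =
     Inf {card P | P. finite P \<and> E \<subseteq> (\<Union>p\<in>P. cbox p (p + (1 / real N, 1 / real N)))}"

(* The limit inferior is taken in the extended reals, so that it always exists. *)
definition lower_box_dim :: "(real \<times> real) set \<Rightarrow> ereal" where
  "lower_box_dim E = liminf (\<lambda>N. ereal (ln (real (box_count E N)) / ln (real N)))"

end

theory Submission
  imports Defs "HOL-Computational_Algebra.Nth_Powers" "HOL-Real_Asymp.Real_Asymp"
begin

text \<open>
  Put \<open>h = 1/N\<close> and \<open>D x = G (x + h) - G x\<close>. A cover of the graph by boxes of side \<open>h\<close> contains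
  at least a constant times \<open>N \<Sum> \<bar>D x\<^sub>i\<bar>\<close> boxes whenever the \<open>x\<^sub>i\<close> are \<open>h\<close>-separated modulo 1.
  The points used are \<open>a\<^sub>0/q\<^sub>0 + b/M + r/p\<close> with \<open>M\<close> fixed, \<open>p \<le> \<surd>N\<close> prime and \<open>0 < r < p\<close>;
  for fixed \<open>b\<close> they are \<open>h\<close>-separated.

  For each prime \<open>p\<close>, \<open>\<Sum> \<bar>D x\<^sub>i\<bar>\<close> is bounded below by testing \<open>D\<close> against Gauss sums
  of modulus \<open>\<surd>p\<close> in \<open>r\<close> and a bounded weight in \<open>b\<close>.
  This functional multiplies the frequency \<open>l = k n\<^sup>2\<close> of \<open>G\<close> by \<open>e (l a\<^sub>0/q\<^sub>0) (e (l h) - 1)\<close>, by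
  the number of roots of \<open>d\<^sub>0 m\<^sup>2 \<equiv> l\<close> modulo \<open>p\<close> minus 1, and by the indicator of
  \<open>l \<in> d\<^sub>0 \<int>\<^sup>2\<close> modulo \<open>M\<close>. The last two factors equal 1 for nearly all \<open>n\<close> if \<open>k = d\<^sub>0 m\<^sup>2\<close>, whereas
  for every other \<open>k\<close> in a prescribed finite set, negative ones included, the indicator vanishes
  unless \<open>n\<close> is a multiple of a large number; \<open>M\<close> is found by comparing the parity of prime
  valuations, and by working modulo 4 when \<open>k = - d\<^sub>0 m\<^sup>2\<close>. All multipliers are bounded by 1, so the
  remaining \<open>k\<close> contribute at most the tail of \<open>\<Sum> \<bar>C\<^sub>k\<bar> k powr (\<delta>/2)\<close>. For
  \<open>k = d\<^sub>0 m\<^sup>2\<close> the sum over \<open>n\<close> is asymptotic to \<open>k powr (\<delta>/2) G (k a\<^sub>0; q\<^sub>0)\<close> times a factor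
  independent of \<open>k\<close> of order \<open>h powr (\<delta>/2)\<close>, so the functional has size
  \<open>p h powr (\<delta>/2) \<bar>S\<bar>\<close>. Dividing by \<open>\<surd>p\<close> and
  summing over the \<open>N powr (1/2 - o(1))\<close> primes \<open>p \<le> \<surd>N\<close> yields \<open>N powr (7/4 - \<delta>/2 - o(1))\<close> boxes.
\<close>

section \<open>Exponentials, Gauss sums and finite Fourier analysis\<close>

lemma e_add: "e (x + y) = e x * e y"
  by (simp add: e_def distrib_left exp_add)

lemma e_0 [simp]: "e 0 = 1"
  by (simp add: e_def)

lemma e_minus: "e (- x) = cnj (e x)"
  by (simp add: e_def exp_cnj)

lemma norm_e [simp]: "cmod (e x) = 1"
  by (simp add: e_def)

lemma e_cis: "e x = cis (2 * pi * x)"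
  by (simp add: e_def cis_conv_exp mult_ac)

lemma e_of_int [simp]: "e (of_int k) = 1"
  unfolding e_cis by (metis Ints_of_int cis_multiple_2pi mult.assoc)

lemma e_add_int [simp]: "e (x + of_int k) = e x"
  by (simp add: e_add)

lemma e_mult_nat: "e (of_nat n * x) = e x ^ n"
  by (induction n) (simp_all add: e_add distrib_right)

lemma e_eq_1_iff: "e x = 1 \<longleftrightarrow> x \<in> \<int>"
proof
  assume "e x = 1"
  then obtain n :: int where "2 * pi * x = of_int (2 * n) * pi"
    unfolding e_def exp_eq_1 by auto
  then have "x = of_int n" by simp
  then show "x \<in> \<int>" by simp
next
  assume "x \<in> \<int>"
  then show "e x = 1" by (auto elim!: Ints_cases)
qed

lemma norm_e_minus_1_le: "cmod (e x - 1) \<le> 2 * pi * \<bar>x\<bar>"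
proof -
  have "cmod (e x - 1) = 2 * \<bar>sin (2 * pi * x / 2)\<bar>"
    unfolding dist_exp_i_1[symmetric] by (simp add: e_def mult_ac)
  also have "\<dots> \<le> 2 * \<bar>2 * pi * x / 2\<bar>"
    by (intro mult_left_mono abs_sin_x_le_abs_x) simp
  finally show ?thesis by (simp add: abs_mult)
qed

lemma norm_e_minus_1_le2: "cmod (e x - 1) \<le> 2"
  using norm_triangle_ineq4[of "e x" 1] by simp

lemma e_sum_orthogonality:
  fixes M :: nat and l :: int
  assumes "M > 0"
  shows "(\<Sum>b<M. e (real b * of_int l / real M)) = (if int M dvd l then of_nat M else 0)"
proof -
  let ?z = "e (of_int l / real M)"
  have z: "(\<Sum>b<M. e (real b * of_int l / real M)) = (\<Sum>b<M. ?z ^ b)"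
    by (intro sum.cong refl) (simp add: e_mult_nat[symmetric])
  have "?z ^ M = 1"
    using assms by (simp add: e_mult_nat[symmetric])
  moreover have "?z = 1 \<longleftrightarrow> int M dvd l"
  proof
    assume "?z = 1"
    then obtain j :: int where "of_int l / real M = of_int j"
      by (auto simp: e_eq_1_iff elim!: Ints_cases)
    then have "real_of_int l = of_int (j * int M)"
      using assms by (simp add: field_simps)
    then have "l = j * int M" by linarith
    then show "int M dvd l" by simp
  next
    assume "int M dvd l"
    then obtain j where "l = int M * j" by (elim dvdE)
    then show "?z = 1" using assms by simp
  qed
  ultimately show ?thesis
    unfolding z by (auto simp: geometric_sum)
qed

lemma sum_shift_periodic:
  fixes f :: "nat \<Rightarrow> complex"
  assumes "\<And>n. f (n + p) = f n"
  shows "(\<Sum>m<p. f (m + u)) = (\<Sum>m<p. f m)"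
proof (induction u)
  case (Suc u)
  have "(\<Sum>m<p. f (m + Suc u)) = (\<Sum>m<p. f (Suc m + u))" by simp
  also have "\<dots> = (\<Sum>m<Suc p. f (m + u)) - f (0 + u)"
    by (subst sum.lessThan_Suc_shift) simp
  also have "\<dots> = (\<Sum>m<p. f (m + u))" using assms[of u] by (simp add: add.commute)
  finally show ?case using Suc by simp
qed simp

text \<open>Expanding the square and shifting one variable cancels the quadratic terms; the linear
  phase that remains is summed by orthogonality. Hypothesis \<open>cop\<close> expresses that 2 t is
  invertible modulo p, in the form that leaves only the diagonal \<open>u = 0\<close>.\<close>

lemma gauss_sum_norm_sq:
  fixes p :: nat and t :: int
  assumes p: "p > 0" and cop: "\<And>u. u < p \<Longrightarrow> int p dvd 2 * t * int u \<Longrightarrow> u = 0"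
  shows "cmod (\<Sum>m<p. e (of_int t * (real m)\<^sup>2 / real p)) = sqrt (real p)"
proof -
  let ?f = "\<lambda>m. e (of_int t * (real m)\<^sup>2 / real p)"
  have per: "?f (m + p) = ?f m" for m
  proof -
    have "of_int t * (real (m + p))\<^sup>2 / real p = of_int t * (real m)\<^sup>2 / real p + of_int (t * (2 * int m + int p))"
      using p by (simp add: field_simps power2_eq_square)
    then show ?thesis by (simp only: e_add_int)
  qed
  have "complex_of_real ((cmod (\<Sum>m<p. ?f m))\<^sup>2) = (\<Sum>m<p. ?f m) * cnj (\<Sum>m<p. ?f m)"
    by (simp only: complex_norm_square[symmetric] of_real_power)
  also have "\<dots> = (\<Sum>m<p. (\<Sum>u<p. ?f u) * cnj (?f m))"
    by (simp add: sum_distrib_left)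
  also have "\<dots> = (\<Sum>m<p. (\<Sum>u<p. ?f (u + m)) * cnj (?f m))"
    by (subst sum_shift_periodic[of ?f p, OF per]) simp
  also have "\<dots> = (\<Sum>m<p. \<Sum>u<p. ?f (u + m) * cnj (?f m))"
    by (simp add: sum_distrib_right)
  also have "\<dots> = (\<Sum>u<p. \<Sum>m<p. ?f (u + m) * cnj (?f m))"
    by (rule sum.swap)
  also have "\<dots> = (\<Sum>u<p. ?f u * (\<Sum>m<p. e (real m * of_int (2 * t * int u) / real p)))"
    unfolding sum_distrib_left e_minus[symmetric] e_add[symmetric]
    by (intro sum.cong refl arg_cong[of _ _ e]) (use p in \<open>simp add: field_simps power2_eq_square\<close>)
  also have "\<dots> = (\<Sum>u<p. ?f u * (if int p dvd 2 * t * int u then of_nat p else 0))"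
    by (simp only: e_sum_orthogonality[OF p])
  also have "\<dots> = (\<Sum>u<p. if u = 0 then of_nat p else 0)"
    using cop by (intro sum.cong refl) auto
  also have "\<dots> = of_nat p" using p by simp
  finally have "(cmod (\<Sum>m<p. ?f m))\<^sup>2 = real p"
    by (metis of_real_eq_iff of_real_of_nat_eq)
  then show ?thesis by (metis norm_ge_zero real_sqrt_unique)
qed

text \<open>For an odd prime p not dividing d, \<open>qcount d p l - 1\<close> is the Legendre
  symbol of d l modulo p. Counting roots gives it a direct Fourier expansion.\<close>

definition qcount :: "nat \<Rightarrow> nat \<Rightarrow> int \<Rightarrow> nat" where
  "qcount d p l = card {m. m < p \<and> int p dvd l - int d * (int m)\<^sup>2}"

lemma qcount_roots:
  assumes p: "prime p" and d: "\<not> p dvd d"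
    and m: "int p dvd l - int d * (int m)\<^sup>2" and n: "int p dvd l - int d * (int n)\<^sup>2"
    and "m < p" "n < p"
  shows "n = m \<or> n = p - m"
proof -
  have pi: "prime (int p)" using p by simp
  have "int p dvd (l - int d * (int m)\<^sup>2) - (l - int d * (int n)\<^sup>2)"
    using m n by (rule dvd_diff)
  also have "\<dots> = int d * ((int n - int m) * (int n + int m))"
    by (simp add: algebra_simps power2_eq_square)
  finally have "int p dvd (int n - int m) \<or> int p dvd (int n + int m)"
    using d pi by (simp add: prime_dvd_mult_iff)
  then show ?thesis
  proof
    assume "int p dvd (int n - int m)"
    moreover have "\<bar>int n - int m\<bar> < int p" using assms by linarith
    ultimately have "int n - int m = 0" using dvd_imp_le_int[of "int n - int m" "int p"] by force
    then show ?thesis by simp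
  next
    assume "int p dvd (int n + int m)"
    then obtain k where k: "n + m = p * k" by (metis int_dvd_int_iff dvdE of_nat_add)
    have "p * k < p * 2" using assms k by linarith
    then have "k = 0 \<or> k = 1" by auto
    then show ?thesis using k by auto
  qed
qed

lemma qcount_le_2:
  assumes "prime p" "\<not> p dvd d"
  shows "qcount d p l \<le> 2"
proof (cases "{m. m < p \<and> int p dvd l - int d * (int m)\<^sup>2} = {}")
  case False
  then obtain m where m: "m < p" "int p dvd l - int d * (int m)\<^sup>2" by auto
  have "{n. n < p \<and> int p dvd l - int d * (int n)\<^sup>2} \<subseteq> {m, p - m}"
    using qcount_roots[OF assms m(2) _ m(1)] by auto
  then have "qcount d p l \<le> card {m, p - m}"
    unfolding qcount_def by (intro card_mono) auto
  then show ?thesis by (simp add: card_insert_if split: if_splits)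
qed (simp only: qcount_def card.empty)

lemma qcount_square:
  assumes p: "prime p" and d: "\<not> p dvd d" and "p \<noteq> 2" and z: "\<not> int p dvd z"
  shows "qcount d p (int d * z\<^sup>2) = 2"
proof -
  define m where "m = nat (z mod int p)"
  have p0: "p > 0" using p prime_gt_0_nat by blast
  have im: "int m = z mod int p" using p0 by (simp add: m_def)
  have mp: "m < p" using p0 by (simp add: m_def nat_less_iff)
  have m0: "m \<noteq> 0" using z im by (metis dvd_eq_mod_eq_0 of_nat_0)
  have dz: "int p dvd z - int m" by (simp add: im)
  have 1: "int p dvd int d * z\<^sup>2 - int d * (int m)\<^sup>2"
  proof -
    have "int d * z\<^sup>2 - int d * (int m)\<^sup>2 = (z - int m) * (int d * (z + int m))"
      by (simp add: algebra_simps power2_eq_square)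
    then show ?thesis using dz by simp
  qed
  have 2: "int p dvd int d * z\<^sup>2 - int d * (int (p - m))\<^sup>2"
  proof -
    have "int d * z\<^sup>2 - int d * (int (p - m))\<^sup>2 = (int d * z\<^sup>2 - int d * (int m)\<^sup>2) + int p * (int d * (2 * int m - int p))"
      using mp by (simp add: algebra_simps power2_eq_square of_nat_diff)
    then show ?thesis using 1 by (metis dvd_add dvd_triv_left)
  qed
  have ne: "m \<noteq> p - m"
  proof
    assume "m = p - m"
    then have "p = 2 * m" using mp by simp
    then have "even p" by simp
    then show False using p \<open>p \<noteq> 2\<close> primes_dvd_imp_eq two_is_prime_nat by blast
  qed
  have "{n. n < p \<and> int p dvd int d * z\<^sup>2 - int d * (int n)\<^sup>2} = {m, p - m}"
    using qcount_roots[OF p d 1 _ mp] 1 2 mp m0 by auto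
  then show ?thesis using ne by (simp add: qcount_def)
qed

text \<open>Orthogonality over all a counts the roots; the omitted term a = 0 equals p and accounts
  for the - 1. It is left out because the inner sum over m is a Gauss sum of modulus sqrt p (for odd
  p not dividing d) only if p does not divide a.\<close>

lemma qcount_fourier:
  assumes p: "prime p"
  shows "(\<Sum>a=1..<p. (\<Sum>m<p. e (- (of_int (int a * int d) * (real m)\<^sup>2 / real p))) * e (of_int l * (real a / real p)))
       = of_nat p * (of_nat (qcount d p l) - 1)"
proof -
  have p0: "p > 0" using p prime_gt_0_nat by blast
  let ?h = "\<lambda>a. (\<Sum>m<p. e (real a * of_int (l - int d * (int m)\<^sup>2) / real p))"
  have "(\<Sum>a=1..<p. (\<Sum>m<p. e (- (of_int (int a * int d) * (real m)\<^sup>2 / real p))) * e (of_int l * (real a / real p)))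
    = (\<Sum>a=1..<p. ?h a)"
    unfolding sum_distrib_right e_add[symmetric]
    by (intro sum.cong refl arg_cong[of _ _ e]) (use p0 in \<open>simp add: field_simps\<close>)
  also have "\<dots> = (\<Sum>a<p. ?h a) - ?h 0"
    using p0 by (simp add: lessThan_atLeast0 sum.atLeast_Suc_lessThan[of 0 p])
  also have "(\<Sum>a<p. ?h a) = (\<Sum>m<p. \<Sum>a<p. e (real a * of_int (l - int d * (int m)\<^sup>2) / real p))"
    by (rule sum.swap)
  also have "\<dots> = (\<Sum>m<p. if int p dvd l - int d * (int m)\<^sup>2 then of_nat p else 0)"
    by (simp only: e_sum_orthogonality[OF p0])
  also have "\<dots> = of_nat p * of_nat (qcount d p l)"
    by (simp add: qcount_def sum.If_cases Int_def lessThan_def mult.commute)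
  also have "?h 0 = of_nat p" by simp
  finally show ?thesis by (simp add: algebra_simps)
qed

text \<open>Fourier inversion on the integers modulo M. The bound on the coefficients is independent
  of M; they will serve as weights for the shifts b / M.\<close>

lemma indicator_fourier:
  fixes M :: nat and A :: "int set"
  assumes M: "M > 0" and per: "\<And>l j. l \<in> A \<longleftrightarrow> l + int M * j \<in> A"
  obtains c :: "nat \<Rightarrow> complex" where "\<And>b. cmod (c b) \<le> 1"
    "\<And>l. (\<Sum>b<M. c b * e (of_int l * (real b / real M))) = (if l \<in> A then 1 else 0)"
proof
  define c where "c b = (1 / of_nat M) * (\<Sum>r | r < M \<and> int r \<in> A. e (- (real b * real r / real M)))" for b
  show "cmod (c b) \<le> 1" for b
  proof -
    have "cmod (\<Sum>r | r < M \<and> int r \<in> A. e (- (real b * real r / real M))) \<le> (\<Sum>r | r < M \<and> int r \<in> A. 1)"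
      by (intro sum_norm_le) simp
    also have "\<dots> \<le> real (card {..<M})"
      by (simp, intro card_mono[of "{..<M}", simplified]) auto
    finally show ?thesis using M by (simp add: c_def norm_mult norm_divide field_simps)
  qed
  show "(\<Sum>b<M. c b * e (of_int l * (real b / real M))) = (if l \<in> A then 1 else 0)" for l
  proof -
    have "(\<Sum>b<M. c b * e (of_int l * (real b / real M)))
      = (1 / of_nat M) * (\<Sum>b<M. \<Sum>r | r < M \<and> int r \<in> A. e (real b * of_int (l - int r) / real M))"
      unfolding c_def sum_distrib_right sum_distrib_left mult.assoc e_add[symmetric]
      by (intro sum.cong refl arg_cong2[of _ _ _ _ "(*)"] arg_cong[of _ _ e]) (use M in \<open>simp add: field_simps\<close>)
    also have "(\<Sum>b<M. \<Sum>r | r < M \<and> int r \<in> A. e (real b * of_int (l - int r) / real M))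
       = (\<Sum>r | r < M \<and> int r \<in> A. \<Sum>b<M. e (real b * of_int (l - int r) / real M))"
      by (rule sum.swap)
    also have "\<dots> = (\<Sum>r | r < M \<and> int r \<in> A. if int M dvd l - int r then of_nat M else 0)"
      by (simp only: e_sum_orthogonality[OF M])
    also have "\<dots> = (\<Sum>r | r < M \<and> int r \<in> A. if r = nat (l mod int M) then of_nat M else 0)"
    proof (intro sum.cong refl)
      fix r assume "r \<in> {r. r < M \<and> int r \<in> A}"
      then have "int M dvd l - int r \<longleftrightarrow> int r = l mod int M"
        by (metis (mono_tags, lifting) mem_Collect_eq mod_eq_dvd_iff mod_less of_nat_mod)
      also have "\<dots> \<longleftrightarrow> r = nat (l mod int M)" using M by auto
      finally show "(if int M dvd l - int r then of_nat M else 0 :: complex) = (if r = nat (l mod int M) then of_nat M else 0)"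
        by simp
    qed
    also have "\<dots> = (if l \<in> A then of_nat M else 0)"
    proof -
      have "l mod int M \<in> A \<longleftrightarrow> l \<in> A"
        using per[of "l mod int M" "l div int M"] by simp
      then show ?thesis using M by (auto simp: sum.delta' nat_less_iff)
    qed
    finally show ?thesis using M by auto
  qed
qed

section \<open>Separating square classes by congruences\<close>

text \<open>Squares are 0 or 1 modulo 4, so 4 divides a sum of two squares only if both are even;
  halving both variables lowers the exponent.\<close>

lemma power2_dvd_of_sum_squares:
  fixes z s :: int
  assumes "4 ^ i dvd z\<^sup>2 + s\<^sup>2"
  shows "2 ^ i dvd z"
  using assms
proof (induction i arbitrary: z s)
  case (Suc i)
  have 4: "4 dvd z\<^sup>2 + s\<^sup>2"
    using Suc.prems by (metis dvd_mult_left power_Suc)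
  have ev: "even z \<and> even s"
  proof -
    have sq1: "x\<^sup>2 mod 4 = 1" if "odd x" for x :: int
    proof -
      from \<open>odd x\<close> obtain b where "x = 2 * b + 1" by (elim oddE)
      then have "x\<^sup>2 = 1 + 4 * (b * b + b)" by (simp add: power2_eq_square algebra_simps)
      then show ?thesis by presburger
    qed
    have sq0: "x\<^sup>2 mod 4 = 0" if "even x" for x :: int
      using that by (auto elim!: evenE simp: power2_eq_square)
    have "(z\<^sup>2 mod 4 + s\<^sup>2 mod 4) mod 4 = 0"
      using 4 by (simp add: mod_add_eq dvd_eq_mod_eq_0)
    then show ?thesis using sq1[of z] sq1[of s] sq0[of z] sq0[of s] by (cases "even z"; cases "even s") auto
  qed
  then obtain z' s' where zs: "z = 2 * z'" "s = 2 * s'" by (auto elim!: evenE)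
  have "4 * 4 ^ i dvd 4 * (z'\<^sup>2 + s'\<^sup>2)"
    using Suc.prems by (simp add: zs power2_eq_square algebra_simps)
  then have "2 ^ i dvd z'" by (intro Suc.IH[of z' s']) (simp only: dvd_mult_cancel_left, simp)
  then show ?case by (simp add: zs)
qed simp

text \<open>If l^j did not divide n, the valuation of k n^2 at l would lie below the exponent of the
  modulus, so d s^2 would have the same valuation. But these two valuations have different
  parities.\<close>

lemma dvd_of_multiplicity_parity:
  fixes k :: int and d j n :: nat
  assumes l: "prime l" and par: "even (multiplicity (int l) k) \<noteq> even (multiplicity (int l) (int d))"
    and k: "k \<noteq> 0" and d: "d > 0"
    and dv: "int l ^ (2 * j + multiplicity (int l) k) dvd k * (int n)\<^sup>2 - int d * s\<^sup>2"
  shows "l ^ j dvd n"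
proof (rule ccontr)
  assume nd: "\<not> l ^ j dvd n"
  define v where "v = multiplicity (int l)"
  define J where "J = 2 * j + v k"
  have pl: "prime_elem (int l)" using l by simp
  have n0: "n \<noteq> 0" using nd by (auto intro: ccontr)
  have "\<not> int l ^ j dvd int n" using nd by (metis int_dvd_int_iff of_nat_power)
  then have vn: "v (int n) < j" unfolding v_def
    by (meson leI multiplicity_dvd')
  define a where "a = k * (int n)\<^sup>2"
  define b where "b = int d * s\<^sup>2"
  have a0: "a \<noteq> 0" using k n0 by (simp add: a_def)
  have va: "v a = v k + 2 * v (int n)" unfolding v_def a_def
    using k n0 pl by (simp add: prime_elem_multiplicity_mult_distrib prime_elem_multiplicity_power_distrib)
  have J: "v a < J" using va vn by (simp add: J_def)
  have dJ: "int l ^ J dvd a - b" using dv by (simp add: J_def v_def a_def b_def)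
  have unit: "\<not> is_unit (int l)" using pl prime_elem_not_unit by blast
  have nda: "\<not> int l ^ Suc (v a) dvd a" unfolding v_def
    using a0 unit by (subst power_dvd_iff_le_multiplicity) auto
  have "int l ^ Suc (v a) dvd a - b"
    using dJ J by (meson Suc_leI dvd_trans le_imp_power_dvd)
  then have ndb: "\<not> int l ^ Suc (v a) dvd b" 
    using nda dvd_add[of "int l ^ Suc (v a)" "a - b" b] by auto
  have "int l ^ v a dvd a - b" using dJ J by (meson less_imp_le dvd_trans le_imp_power_dvd)
  moreover have "int l ^ v a dvd a" by (simp add: v_def multiplicity_dvd)
  ultimately have "int l ^ v a dvd a - (a - b)" using dvd_diff by blast
  then have "int l ^ v a dvd b" by simp
  then have vb: "v b = v a" using ndb unfolding v_def by (intro multiplicity_eqI)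
  have "b \<noteq> 0" using ndb by auto
  then have "s \<noteq> 0" by (auto simp: b_def)
  then have "v b = v (int d) + 2 * v s" unfolding v_def b_def
    using d pl by (simp add: prime_elem_multiplicity_mult_distrib prime_elem_multiplicity_power_distrib)
  then show False using vb va par by (metis even_add even_mult_iff even_numeral v_def)
qed

lemma multiplicity_int_nat_abs:
  fixes k :: int
  assumes "prime p" "k \<noteq> 0"
  shows "multiplicity (int p) k = multiplicity p (nat \<bar>k\<bar>)"
proof (rule multiplicity_eqI)
  have eq: "int p ^ i dvd k \<longleftrightarrow> p ^ i dvd nat \<bar>k\<bar>" for i
  proof -
    have "p ^ i dvd nat \<bar>k\<bar> \<longleftrightarrow> int (p ^ i) dvd int (nat \<bar>k\<bar>)" by (simp only: int_dvd_int_iff)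
    then show ?thesis by simp
  qed
  show "int p ^ multiplicity p (nat \<bar>k\<bar>) dvd k"
    unfolding eq by (rule multiplicity_dvd)
  show "\<not> int p ^ Suc (multiplicity p (nat \<bar>k\<bar>)) dvd k"
    unfolding eq using assms
    by (subst power_dvd_iff_le_multiplicity) auto
qed

lemma squarefree_dvd_power2:
  fixes d z :: nat
  assumes d: "squarefree d" and dz: "d dvd z\<^sup>2" and z: "z \<noteq> 0"
  shows "d dvd z"
proof (rule multiplicity_le_imp_dvd)
  have d0: "d \<noteq> 0" using d not_squarefree_0 by metis
  then show "d \<noteq> 0" .
  show "multiplicity p d \<le> multiplicity p z" if p: "prime p" for p
  proof (cases "p dvd d")
    case True
    then have "p dvd z" using dz p by (meson dvd_trans prime_dvd_power)
    then have "multiplicity p z \<ge> 1" using p z 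
      by (metis One_nat_def Suc_leI prime_multiplicity_gt_zero_iff prime_imp_prime_elem)
    moreover have "multiplicity p d \<le> 1" using d d0 p by (simp add: squarefree_factorial_semiring'')
    ultimately show ?thesis by simp
  qed (simp add: not_dvd_imp_multiplicity_0)
qed

text \<open>All valuations of |k| d are even, so |k| d is a square z^2; the squarefree d then
  divides z, and m = z / d.\<close>

lemma squarefree_same_parity_imp:
  fixes k :: int and d :: nat
  assumes k: "k \<noteq> 0" and d: "d > 0" "squarefree d"
    and par: "\<And>l. prime l \<Longrightarrow> even (multiplicity (int l) k) = even (multiplicity (int l) (int d))"
  obtains m where "nat \<bar>k\<bar> = d * m\<^sup>2"
proof -
  have "is_nth_power 2 (nat \<bar>k\<bar> * d)"
  proof -
    have "2 dvd multiplicity p (nat \<bar>k\<bar> * d)" if "prime p" for p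
    proof -
      have "multiplicity p (nat \<bar>k\<bar>) = multiplicity (int p) k"
        using that k by (rule multiplicity_int_nat_abs[symmetric])
      moreover have "multiplicity p d = multiplicity (int p) (int d)"
        using that d multiplicity_int_nat_abs[of p "int d"] by simp
      ultimately show ?thesis using par[OF that] that k d
        by (simp add: prime_elem_multiplicity_mult_distrib)
    qed
    then show ?thesis using k d
      by (subst is_nth_power_conv_multiplicity_nat) auto
  qed
  then obtain z where z: "nat \<bar>k\<bar> * d = z\<^sup>2" by (auto elim: is_nth_powerE)
  then have "d dvd z\<^sup>2" by (metis dvd_triv_right)
  moreover have "z\<^sup>2 > 0" unfolding z[symmetric] using k d(1) by simp
  ultimately have "d dvd z" using squarefree_dvd_power2[OF d(2), of z] by simp
  then obtain m where "z = d * m" by (elim dvdE)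
  then have "nat \<bar>k\<bar> = d * m\<^sup>2" using z d by (simp add: power2_eq_square)
  then show thesis by (rule that)
qed

text \<open>If the valuations of k and d differ in parity at some prime l, a power of l is a
  suitable modulus. Otherwise |k| is d times a square, hence k = - d m^2, and the congruence becomes
  one for the sum of squares (m n)^2 + s^2 modulo 4^i.\<close>

lemma nonsquare_class_separation:
  fixes k :: int and d R\<^sub>0 :: nat
  assumes k: "k \<noteq> 0" and d: "d > 0" "squarefree d" and ns: "\<nexists>m. k = int d * (int m)\<^sup>2"
  obtains M R :: nat where "M > 0" "R \<ge> R\<^sub>0" "R > 0"
    "\<And>n s. int M dvd k * (int n)\<^sup>2 - int d * s\<^sup>2 \<Longrightarrow> R dvd n"
proof (cases "\<forall>l. prime l \<longrightarrow> even (multiplicity (int l) k) = even (multiplicity (int l) (int d))")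
  case False
  then obtain l where l: "prime l" "even (multiplicity (int l) k) \<noteq> even (multiplicity (int l) (int d))"
    by blast
  have l2: "l \<ge> 2" using l(1) prime_ge_2_nat by blast
  show thesis
  proof (rule that[of "l ^ (2 * R\<^sub>0 + multiplicity (int l) k)" "l ^ R\<^sub>0"])
    have "R\<^sub>0 \<le> 2 ^ R\<^sub>0" by simp
    also have "\<dots> \<le> l ^ R\<^sub>0" using l2 by (rule power_mono) simp
    finally show "R\<^sub>0 \<le> l ^ R\<^sub>0" .
    show "l ^ R\<^sub>0 dvd n" if "int (l ^ (2 * R\<^sub>0 + multiplicity (int l) k)) dvd k * (int n)\<^sup>2 - int d * s\<^sup>2" for n s
      using dvd_of_multiplicity_parity[OF l k d(1)] that by simp
  qed (use l2 in auto)
next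
  case True
  then obtain m where m: "nat \<bar>k\<bar> = d * m\<^sup>2"
    using squarefree_same_parity_imp[OF k d] by blast
  then have "\<bar>k\<bar> = int d * (int m)\<^sup>2" by (metis abs_ge_zero nat_0_le of_nat_mult of_nat_power)
  then have km: "k = - int d * (int m)\<^sup>2" using ns by (auto simp: abs_if split: if_splits)
  have m0: "m > 0" using km k by (auto intro: ccontr)
  \<comment> \<open>The congruence will give 2^i dvd m n. Removing from 2^i its common factor with m
    leaves R, which is prime to the cofactor of m, so R dvd n. The choice of i yields
    \<open>R\<^sub>0 * m \<le> 2 ^ i\<close>, and therefore R is at least
    \<open>R\<^sub>0\<close>.\<close>
  define i where "i = R\<^sub>0 + m"
  define R where "R = 2 ^ i div gcd (2 ^ i) m"
  have Rg: "R * gcd (2 ^ i) m = 2 ^ i" by (simp add: R_def)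
  have "R\<^sub>0 * m \<le> 2 ^ R\<^sub>0 * 2 ^ m" by (intro mult_mono) auto
  also have "\<dots> = R * gcd (2 ^ i) m" by (simp only: Rg) (simp add: i_def power_add)
  also have "\<dots> \<le> R * m" using m0 by (intro mult_left_mono) (auto intro: dvd_imp_le)
  finally have RR: "R\<^sub>0 \<le> R" using m0 by simp
  have R0: "R > 0" using Rg by (metis gr0I mult_is_0 power_not_zero zero_neq_numeral)
  show thesis
  proof (rule that[of "d * 4 ^ i" R])
    fix n s assume "int (d * 4 ^ i) dvd k * (int n)\<^sup>2 - int d * s\<^sup>2"
    moreover have "k * (int n)\<^sup>2 - int d * s\<^sup>2 = int d * - ((int (m * n))\<^sup>2 + s\<^sup>2)"
      by (simp add: km algebra_simps power2_eq_square)
    ultimately have "int d * 4 ^ i dvd int d * - ((int (m * n))\<^sup>2 + s\<^sup>2)"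
      by simp
    then have "4 ^ i dvd (int (m * n))\<^sup>2 + s\<^sup>2"
      using d by (simp only: dvd_mult_cancel_left dvd_minus_iff) simp
    then have "2 ^ i dvd int (m * n)" by (rule power2_dvd_of_sum_squares)
    then have "2 ^ i dvd m * n" by (metis int_dvd_int_iff of_nat_numeral of_nat_power)
    moreover have "gcd (2 ^ i) m * R = 2 ^ i" "gcd (2 ^ i) m * ((m div gcd (2 ^ i) m) * n) = m * n"
      using Rg by (simp_all add: mult.commute mult.assoc[symmetric])
    ultimately have "gcd (2 ^ i) m * R dvd gcd (2 ^ i) m * ((m div gcd (2 ^ i) m) * n)"
      by metis
    then have "R dvd (m div gcd (2 ^ i) m) * n"
      using m0 dvd_times_left_cancel_iff[of "gcd (2 ^ i) m" R] by simp
    moreover have "coprime R (m div gcd (2 ^ i) m)"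
      unfolding R_def using m0 by (intro div_gcd_coprime) auto
    ultimately show "R dvd n" by (simp add: coprime_dvd_mult_right_iff)
  qed (use d RR R0 in auto)
qed

section \<open>A lower bound for the number of primes\<close>

text \<open>Induction along the Leibniz harmonic triangle, whose entries are \<open>1 / ((n + 1) (n choose m))\<close>.\<close>

lemma Lcm_leibniz:
  fixes L :: nat
  assumes "m \<le> n" "\<And>i. 1 \<le> i \<Longrightarrow> i \<le> Suc n \<Longrightarrow> i dvd L"
  shows "real L / (real (Suc n) * real (n choose m)) \<in> \<int>"
  using assms
proof (induction m arbitrary: n)
  case 0
  then have "Suc n dvd L" by simp
  then show ?case by (auto elim!: dvdE simp del: of_nat_Suc mult_Suc simp flip: One_nat_def)
next
  case (Suc m)
  then obtain n' where n: "n = Suc n'" by (metis Suc_le_D)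
  have mn: "m \<le> n'" using Suc.prems n by simp
  have c: "real (n' choose m) > 0" using mn by (simp add: zero_less_binomial_iff)
  have c1: "real (Suc n' choose Suc m) = real (Suc n') * real (n' choose m) / real (Suc m)"
  proof -
    have "real (Suc m) * real (Suc n' choose Suc m) = real (Suc n') * real (n' choose m)"
      using arg_cong[OF binomial_absorption[of m "Suc n'"], of real] by (simp only: of_nat_mult diff_Suc_1)
    then show ?thesis by (simp add: field_simps del: of_nat_Suc binomial_Suc_Suc)
  qed
  have c2: "real (Suc n' choose m) = real (Suc n') * real (n' choose m) / real (Suc n' - m)"
  proof -
    have "real (Suc n' - m) * real (Suc n' choose m) = real (Suc n') * real (n' choose m)"
      using arg_cong[OF binomial_absorb_comp[of "Suc n'" m], of real] by (simp only: of_nat_mult diff_Suc_1)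
    moreover have "real (Suc n' - m) \<noteq> 0" using mn by simp
    ultimately show ?thesis by (simp add: field_simps del: of_nat_Suc)
  qed
  have eq: "real L / (real (Suc n) * real (n choose Suc m)) =
    real L / (real (Suc n') * real (n' choose m)) - real L / (real (Suc n) * real (n choose m))"
    unfolding n c1 c2 using c mn by (simp add: of_nat_diff divide_simps) (simp add: algebra_simps)
  show ?case unfolding eq
    by (intro Ints_diff Suc.IH) (use Suc.prems n in auto)
qed

text \<open>By the middle entry of the Leibniz triangle, n + 1 times the central binomial
  coefficient divides the lcm, and this product dominates the row sum 2^n.\<close>

lemma Lcm_ge_power2: "2 ^ n \<le> Lcm {1..Suc n}"
proof -
  let ?L = "Lcm {1..Suc n}"
  have L0: "?L > 0" by (auto simp: Lcm_0_iff_nat intro!: gr0I)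
  have c: "real (n choose (n div 2)) > 0" by (simp add: zero_less_binomial_iff)
  have "real ?L / (real (Suc n) * real (n choose (n div 2))) \<in> \<int>"
    by (intro Lcm_leibniz) auto
  then obtain z :: int where z: "real ?L / (real (Suc n) * real (n choose (n div 2))) = of_int z"
    by (auto elim: Ints_cases)
  moreover have "real ?L / (real (Suc n) * real (n choose (n div 2))) > 0"
    using L0 c by simp
  ultimately have "z \<ge> 1" by simp
  then have "1 \<le> real ?L / (real (Suc n) * real (n choose (n div 2)))" using z by simp
  then have "real (Suc n) * real (n choose (n div 2)) \<le> real ?L"
    using c by (subst (asm) le_divide_eq_1_pos) (auto simp del: of_nat_Suc)
  then have le: "Suc n * (n choose (n div 2)) \<le> ?L"
    by (metis of_nat_le_iff of_nat_mult)
  have "(2::nat) ^ n = (\<Sum>k\<le>n. n choose k)" by (simp add: choose_row_sum)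
  also have "\<dots> \<le> (\<Sum>k\<le>n. n choose (n div 2))"
    by (intro sum_mono binomial_maximum)
  also have "\<dots> \<le> ?L" using le by simp
  finally show ?thesis .
qed

lemma prime_power_dvd_Lcm:
  fixes p :: nat
  assumes p: "prime p" and a: "a > 0" and dv: "p ^ a dvd Lcm {1..n}"
  shows "p ^ a \<le> n"
  using dv
proof (induction n)
  case 0
  then show ?case using p a by (simp add: prime_nat_iff)
next
  case (Suc n)
  have "p ^ a dvd lcm (Suc n) (Lcm {1..n})"
    using Suc.prems by (simp add: atLeastAtMostSuc_conv)
  moreover have "Lcm {1..n} \<noteq> 0" by (simp add: Lcm_0_iff_nat)
  ultimately have "a \<le> max (multiplicity p (Suc n)) (multiplicity p (Lcm {1..n}))"
    using p by (subst (asm) power_dvd_iff_le_multiplicity) (auto simp: multiplicity_lcm lcm_eq_0_iff)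
  then have "p ^ a dvd Suc n \<or> p ^ a dvd Lcm {1..n}"
    by (meson le_max_iff_disj multiplicity_dvd')
  then show ?case using Suc.IH by (auto dest: dvd_imp_le)
qed

text \<open>Every prime power in the factorization of the lcm is at most n, and there is at most one
  for each prime up to n.\<close>

lemma Lcm_le_power_card_primes: "Lcm {1..n::nat} \<le> n ^ card {p. prime p \<and> p \<le> n}"
proof (cases "n = 0")
  case False
  let ?L = "Lcm {1..n}"
  have L0: "?L \<noteq> 0" by (simp add: Lcm_0_iff_nat)
  have le: "p ^ multiplicity p ?L \<le> n" if "p \<in> prime_factors ?L" for p
    using that by (intro prime_power_dvd_Lcm) (auto simp: prime_factors_multiplicity multiplicity_dvd)
  have sub: "prime_factors ?L \<subseteq> {p. prime p \<and> p \<le> n}"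
  proof
    fix p assume p: "p \<in> prime_factors ?L"
    then have "p ^ 1 dvd ?L" by auto
    then show "p \<in> {p. prime p \<and> p \<le> n}" using p prime_power_dvd_Lcm[of p 1 n] by auto
  qed
  have "?L = (\<Prod>p\<in>prime_factors ?L. p ^ multiplicity p ?L)"
    using L0 by (metis gr0I prime_factorization_nat)
  also have "\<dots> \<le> (\<Prod>p\<in>prime_factors ?L. n)"
    by (intro prod_mono) (use le in auto)
  also have "\<dots> = n ^ card (prime_factors ?L)" by simp
  also have "\<dots> \<le> n ^ card {p. prime p \<and> p \<le> n}"
    using False sub by (intro power_increasing card_mono) auto
  finally show ?thesis .
next
  case True
  then have *: "{p. prime p \<and> p \<le> n} = {}" using prime_gt_0_nat by force
  show ?thesis unfolding * using True by simp
qed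

text \<open>A Chebyshev bound, obtained by taking logarithms in the two estimates for the
  lcm.\<close>

lemma card_primes_ge:
  assumes "n \<ge> 2"
  shows "real (n - 1) * ln 2 / ln (real n) \<le> real (card {p. prime p \<and> p \<le> n})"
proof -
  have "(2::nat) ^ (n - 1) \<le> n ^ card {p. prime p \<and> p \<le> n}"
    using Lcm_ge_power2[of "n - 1"] Lcm_le_power_card_primes[of n] assms by simp
  then have "(2::real) ^ (n - 1) \<le> real n ^ card {p. prime p \<and> p \<le> n}"
    by (metis of_nat_le_iff of_nat_numeral of_nat_power)
  then have "ln ((2::real) ^ (n - 1)) \<le> ln (real n ^ card {p. prime p \<and> p \<le> n})"
    using assms by (subst ln_le_cancel_iff) auto
  then show ?thesis using assms by (simp add: ln_realpow field_simps)
qed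

text \<open>At most y primes lie below y = n powr (1 - \<eta>), while eventually there are at least
  2 y primes up to n. So at least y of them exceed y, and each contributes at least sqrt y.\<close>

lemma sum_sqrt_primes_ge:
  fixes \<eta> :: real and P :: nat
  assumes "0 < \<eta>" "\<eta> < 1"
  shows "\<forall>\<^sub>F n in sequentially. real n powr ((1 - \<eta>) * (3 / 2)) \<le> (\<Sum>p | prime p \<and> P < p \<and> p \<le> n. sqrt (real p))"
proof -
  have "\<forall>\<^sub>F n::nat in sequentially. 2 * real n powr (1 - \<eta>) \<le> (real n - 1) * ln 2 / ln (real n)"
    using assms by real_asymp
  moreover have "\<forall>\<^sub>F n::nat in sequentially. real P < real n powr (1 - \<eta>)"
    using assms by real_asymp
  moreover have "\<forall>\<^sub>F n::nat in sequentially. n \<ge> 2" by (rule eventually_ge_at_top)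
  ultimately show ?thesis
  proof eventually_elim
    case (elim n)
    define y where "y = real n powr (1 - \<eta>)"
    define A where "A = {p. prime p \<and> p \<le> n \<and> y < real p}"
    have y0: "y \<ge> 0" by (simp add: y_def)
    have "2 * y \<le> real (card {p. prime p \<and> p \<le> n})"
      using card_primes_ge[of n] elim by (simp add: y_def of_nat_diff)
    also have "\<dots> \<le> real (card (A \<union> {1..nat \<lfloor>y\<rfloor>}))"
    proof -
      have "{p. prime p \<and> p \<le> n} \<subseteq> A \<union> {1..nat \<lfloor>y\<rfloor>}"
      proof
        fix p assume p: "p \<in> {p. prime p \<and> p \<le> n}"
        then have "p \<ge> 1" using prime_ge_1_nat by blast
        moreover have "p \<le> nat \<lfloor>y\<rfloor>" if "\<not> y < real p" using that by (intro le_nat_floor) simp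
        ultimately show "p \<in> A \<union> {1..nat \<lfloor>y\<rfloor>}" using p by (auto simp: A_def)
      qed
      then show ?thesis by (intro of_nat_mono card_mono) (auto simp: A_def)
    qed
    also have "\<dots> \<le> real (card A + card {1..nat \<lfloor>y\<rfloor>})"
      by (intro of_nat_mono card_Un_le)
    also have "\<dots> \<le> real (card A) + y" using y0 by simp
    finally have cA: "y \<le> real (card A)" by simp
    have "real n powr ((1 - \<eta>) * (3 / 2)) = y powr (1 + 1 / 2)"
      by (simp add: y_def powr_powr)
    also have "\<dots> = y * sqrt y"
      unfolding powr_add using y0 by (simp add: powr_half_sqrt)
    also have "\<dots> \<le> real (card A) * sqrt y" using cA y0 by (intro mult_right_mono) auto
    also have "\<dots> = (\<Sum>p\<in>A. sqrt y)" by simp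
    also have "\<dots> \<le> (\<Sum>p\<in>A. sqrt (real p))" by (intro sum_mono) (auto simp: A_def)
    also have "\<dots> \<le> (\<Sum>p | prime p \<and> P < p \<and> p \<le> n. sqrt (real p))"
      using elim by (intro sum_mono2) (auto simp: A_def y_def)
    finally show ?case .
  qed
qed

section \<open>The increments of the lacunary series\<close>

lemma powr_mvt:
  fixes x a :: real
  assumes "0 < x"
  obtains \<xi> where "x < \<xi>" "\<xi> < x + 1" "(x + 1) powr a - x powr a = a * \<xi> powr (a - 1)"
proof -
  have "\<exists>\<xi>. \<xi> > x \<and> \<xi> < x + 1 \<and> (x + 1) powr a - x powr a = (x + 1 - x) * (a * \<xi> powr (a - 1))"
    using assms by (intro MVT2) (auto intro!: derivative_eq_intros simp: powr_diff)
  then show thesis using that by auto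
qed

section \<open>The weights, their tails and the weighted increments of a single frequency\<close>

definition wt :: "real \<Rightarrow> nat \<Rightarrow> real" where
  "wt \<delta> n = real (Suc n) powr (- (1 + \<delta>))"

lemma wt_nonneg [simp]: "wt \<delta> n \<ge> 0" by (simp add: wt_def)

lemma wt_mult_square:
  "wt \<delta> n * (real (Suc n))\<^sup>2 = real (Suc n) powr (1 - \<delta>)"
proof -
  have "(real (Suc n))\<^sup>2 = real (Suc n) powr 2" by (simp add: powr_numeral)
  then show ?thesis unfolding wt_def by (simp only: powr_add[symmetric]) simp
qed

text \<open>By the mean value theorem the difference is \<delta> \<xi> powr (-\<delta> - 1) with
  \<xi> \<le> 2 (n + 1), and 2 powr (-\<delta> - 1) \<ge> 1/4 because \<delta> \<le> 1; this is the
  source of 4 / \<delta>.\<close>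

lemma wt_le_telescope:
  assumes "0 < \<delta>" "\<delta> \<le> 1"
  shows "wt \<delta> n \<le> 4 / \<delta> * (real (Suc n) powr - \<delta> - real (Suc (Suc n)) powr - \<delta>)"
proof -
  obtain \<xi> where \<xi>: "real (Suc n) < \<xi>" "\<xi> < real (Suc n) + 1"
    "(real (Suc n) + 1) powr - \<delta> - real (Suc n) powr - \<delta> = - \<delta> * \<xi> powr (- \<delta> - 1)"
    using powr_mvt[of "real (Suc n)" "- \<delta>"] by auto
  have "\<xi> \<le> 2 * real (Suc n)" using \<xi> by simp
  then have "(2 * real (Suc n)) powr (- \<delta> - 1) \<le> \<xi> powr (- \<delta> - 1)"
    using \<xi> assms by (intro powr_mono2') auto
  moreover have "(2 * real (Suc n)) powr (- \<delta> - 1) = 2 powr (- \<delta> - 1) * wt \<delta> n"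
    unfolding wt_def by (subst powr_mult) (simp_all add: minus_diff_commute)
  moreover have "(1 / 4) \<le> (2::real) powr (- \<delta> - 1)"
  proof -
    have "(1 / 4) = (2::real) powr (-2)" by (simp add: powr_minus powr_numeral)
    also have "\<dots> \<le> 2 powr (- \<delta> - 1)" using assms by (intro powr_mono) auto
    finally show ?thesis .
  qed
  then have "1 / 4 * wt \<delta> n \<le> 2 powr (- \<delta> - 1) * wt \<delta> n" by (intro mult_right_mono) auto
  ultimately have "\<delta> * (1 / 4 * wt \<delta> n) \<le> \<delta> * \<xi> powr (- \<delta> - 1)"
    using assms by (intro mult_left_mono) auto
  also have "\<dots> = real (Suc n) powr - \<delta> - real (Suc (Suc n)) powr - \<delta>"
    using \<xi>(3) by (simp add: add.commute)
  finally show ?thesis using assms by (simp add: field_simps)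
qed

lemma powr_telescope_sums:
  assumes "0 < (\<delta>::real)"
  shows "(\<lambda>n. real (Suc (n + m)) powr - \<delta> - real (Suc (Suc (n + m))) powr - \<delta>) sums (real (Suc m) powr - \<delta>)"
proof -
  have "(\<lambda>n. real (Suc n) powr - \<delta>) \<longlonglongrightarrow> 0"
    by (intro tendsto_neg_powr filterlim_compose[OF filterlim_real_sequentially filterlim_Suc])
      (use assms in simp)
  then have "(\<lambda>n. real (Suc (n + m)) powr - \<delta>) \<longlonglongrightarrow> 0"
    by (rule LIMSEQ_ignore_initial_segment)
  from telescope_sums'[OF this] show ?thesis by simp
qed

lemma summable_wt:
  assumes "0 < \<delta>" "\<delta> \<le> 1"
  shows "summable (wt \<delta>)"
proof (rule summable_comparison_test')
  show "summable (\<lambda>n. 4 / \<delta> * (real (Suc n) powr - \<delta> - real (Suc (Suc n)) powr - \<delta>))"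
    using powr_telescope_sums[OF assms(1), of 0] by (intro summable_mult) (auto simp: sums_iff)
  show "norm (wt \<delta> n) \<le> 4 / \<delta> * (real (Suc n) powr - \<delta> - real (Suc (Suc n)) powr - \<delta>)" for n
    using wt_le_telescope[OF assms, of n] by simp
qed

lemma wt_tail_le:
  assumes "0 < \<delta>" "\<delta> \<le> 1"
  shows "(\<Sum>n. wt \<delta> (n + m)) \<le> 4 / \<delta> * real (Suc m) powr - \<delta>"
proof -
  have s: "(\<lambda>n. 4 / \<delta> * (real (Suc (n + m)) powr - \<delta> - real (Suc (Suc (n + m))) powr - \<delta>)) sums (4 / \<delta> * real (Suc m) powr - \<delta>)"
    by (intro sums_mult powr_telescope_sums assms)
  have "(\<Sum>n. wt \<delta> (n + m)) \<le> (\<Sum>n. 4 / \<delta> * (real (Suc (n + m)) powr - \<delta> - real (Suc (Suc (n + m))) powr - \<delta>))"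
    by (rule suminf_le[OF _ summable_ignore_initial_segment[OF summable_wt[OF assms]] sums_summable[OF s]])
      (rule wt_le_telescope[OF assms])
  then show ?thesis unfolding sums_unique[OF s, symmetric] .
qed

lemma wt_tail_bounded_le:
  fixes f :: "nat \<Rightarrow> complex"
  assumes \<delta>: "0 < \<delta>" "\<delta> \<le> 1" and f: "\<And>n. cmod (f n) \<le> B * wt \<delta> n"
  shows "summable f" "cmod (\<Sum>n. f (n + m)) \<le> 4 / \<delta> * B * real (Suc m) powr - \<delta>"
proof -
  have s: "summable (\<lambda>n. B * wt \<delta> n)" by (intro summable_mult summable_wt \<delta>)
  show "summable f" using s f by (rule summable_comparison_test')
  have B: "B \<ge> 0" using order_trans[OF norm_ge_zero f[of 0]] by (simp add: wt_def)
  have "cmod (\<Sum>n. f (n + m)) \<le> (\<Sum>n. B * wt \<delta> (n + m))"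
    using f summable_ignore_initial_segment[OF s, of m]
    by (intro norm_suminf_le) auto
  also have "\<dots> = B * (\<Sum>n. wt \<delta> (n + m))"
    by (intro suminf_mult summable_ignore_initial_segment summable_wt \<delta>)
  also have "\<dots> \<le> B * (4 / \<delta> * real (Suc m) powr - \<delta>)"
    using B by (intro mult_left_mono wt_tail_le \<delta>)
  finally show "cmod (\<Sum>n. f (n + m)) \<le> 4 / \<delta> * B * real (Suc m) powr - \<delta>" by (simp add: mult_ac)
qed

text \<open>With y = k h and N = n + 1, this is the factor that the mode k of g picks up over a step
  h: e (k N^2 (x + h)) - e (k N^2 x) = (e (N^2 y) - 1) e (k N^2 x).\<close>

definition incr :: "real \<Rightarrow> real \<Rightarrow> nat \<Rightarrow> complex" where
  "incr \<delta> y n = of_real (wt \<delta> n) * (e ((real (Suc n))\<^sup>2 * y) - 1)"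

lemma norm_incr_le: "cmod (incr \<delta> y n) \<le> 2 * wt \<delta> n"
  using mult_left_mono[OF norm_e_minus_1_le2[of "(real (Suc n))\<^sup>2 * y"] wt_nonneg[of \<delta> n]]
  by (simp add: incr_def norm_mult)

lemma norm_incr_le2: "cmod (incr \<delta> y n) \<le> 2 * pi * \<bar>y\<bar> * real (Suc n) powr (1 - \<delta>)"
proof -
  have "cmod (incr \<delta> y n) \<le> wt \<delta> n * (2 * pi * \<bar>(real (Suc n))\<^sup>2 * y\<bar>)"
    using mult_left_mono[OF norm_e_minus_1_le[of "(real (Suc n))\<^sup>2 * y"] wt_nonneg[of \<delta> n]]
    by (simp add: incr_def norm_mult)
  also have "\<dots> = 2 * pi * \<bar>y\<bar> * (wt \<delta> n * (real (Suc n))\<^sup>2)" by (simp add: abs_mult)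
  finally show ?thesis unfolding wt_mult_square .
qed

lemma summable_norm_incr:
  assumes "0 < \<delta>" "\<delta> \<le> 1"
  shows "summable (\<lambda>n. cmod (incr \<delta> y n))"
proof (rule summable_comparison_test')
  show "summable (\<lambda>n. 2 * wt \<delta> n)" by (intro summable_mult summable_wt assms)
  show "norm (cmod (incr \<delta> y n)) \<le> 2 * wt \<delta> n" for n using norm_incr_le by simp
qed

text \<open>This is F y - F 0 for the Riemann-type series F y = \<Sum> N powr (-1 - \<delta>) e (N^2
  y) over N \<ge> 1.\<close>

definition Phi :: "real \<Rightarrow> real \<Rightarrow> complex" where
  "Phi \<delta> y = (\<Sum>n. incr \<delta> y n)"

text \<open>The bound linear in y is used up to n of size |y| powr (-1/2) and the trivial bound
  beyond; at this cut-off both parts have order |y| powr (\<delta>/2).\<close>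

lemma suminf_norm_incr_le:
  assumes \<delta>: "0 < \<delta>" "\<delta> \<le> 1"
  shows "(\<Sum>n. cmod (incr \<delta> y n)) \<le> (2 * pi + 8 / \<delta>) * \<bar>y\<bar> powr (\<delta> / 2)"
proof (cases "y = 0")
  case True
  then show ?thesis by (simp add: incr_def)
next
  case False
  define Y where "Y = \<bar>y\<bar> powr (- (1 / 2))"
  define M where "M = nat \<lfloor>Y\<rfloor>"
  have Y0: "Y > 0" using False by (simp add: Y_def)
  have MY: "real M \<le> Y" "Y \<le> real (Suc M)" using Y0 by (auto simp: M_def) linarith
  have Yp: "Y powr a = \<bar>y\<bar> powr (- (a / 2))" for a by (simp add: Y_def powr_powr)
  have "(\<Sum>n<M. cmod (incr \<delta> y n)) \<le> (\<Sum>n<M. 2 * pi * \<bar>y\<bar> * Y powr (1 - \<delta>))"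
  proof (intro sum_mono order_trans[OF norm_incr_le2] mult_left_mono powr_mono2)
    fix n assume "n \<in> {..<M}"
    then have "real (Suc n) \<le> real M" by simp
    then show "real (Suc n) \<le> Y" using MY by linarith
  qed (use \<delta> in auto)
  also have "\<dots> = 2 * pi * \<bar>y\<bar> * Y powr (1 - \<delta>) * real M" by simp
  also have "\<dots> \<le> 2 * pi * \<bar>y\<bar> * Y powr (1 - \<delta>) * Y"
    using MY by (intro mult_left_mono) auto
  also have "\<dots> = 2 * pi * (\<bar>y\<bar> powr 1 * (Y powr (1 - \<delta>) * Y powr 1))" using Y0 by simp
  also have "\<dots> = 2 * pi * \<bar>y\<bar> powr (\<delta> / 2)"
    unfolding powr_add[symmetric] Yp by (simp add: field_simps)
  finally have 1: "(\<Sum>n<M. cmod (incr \<delta> y n)) \<le> 2 * pi * \<bar>y\<bar> powr (\<delta> / 2)" .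
  have "(\<Sum>n. cmod (incr \<delta> y (n + M))) \<le> (\<Sum>n. 2 * wt \<delta> (n + M))"
    by (intro suminf_le norm_incr_le summable_mult summable_ignore_initial_segment[of _ M] summable_norm_incr summable_wt \<delta>)
  also have "\<dots> = 2 * (\<Sum>n. wt \<delta> (n + M))"
    by (intro suminf_mult summable_ignore_initial_segment summable_wt \<delta>)
  also have "\<dots> \<le> 2 * (4 / \<delta> * real (Suc M) powr - \<delta>)"
    by (intro mult_left_mono wt_tail_le \<delta>) auto
  also have "\<dots> \<le> 2 * (4 / \<delta> * Y powr - \<delta>)"
    using MY Y0 \<delta> by (intro mult_left_mono powr_mono2') auto
  also have "\<dots> = 8 / \<delta> * \<bar>y\<bar> powr (\<delta> / 2)" by (simp add: Yp)
  finally have 2: "(\<Sum>n. cmod (incr \<delta> y (n + M))) \<le> 8 / \<delta> * \<bar>y\<bar> powr (\<delta> / 2)" .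
  show ?thesis
    using suminf_split_initial_segment[OF summable_norm_incr[OF \<delta>, of y], of M] 1 2
    by (simp add: distrib_right)
qed

text \<open>Writing the multiples of R as R j replaces y by R^2 y, at the cost of R powr \<delta>,
  and produces a factor R powr (-1 - \<delta>). The net gain 1 / R makes sums supported on multiples
  of a large R negligible.\<close>

lemma suminf_multiples_norm_incr_le:
  assumes \<delta>: "0 < \<delta>" "\<delta> \<le> 1" and R: "R > 0"
  shows "summable (\<lambda>n. if R dvd Suc n then cmod (incr \<delta> y n) else 0)"
    "(\<Sum>n. if R dvd Suc n then cmod (incr \<delta> y n) else 0) \<le> (2 * pi + 8 / \<delta>) / real R * \<bar>y\<bar> powr (\<delta> / 2)"
proof -
  let ?f = "\<lambda>n. if R dvd Suc n then cmod (incr \<delta> y n) else 0"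
  \<comment> \<open>Indices start at 0, so \<open>h j\<close> is the index of the term with
    \<open>Suc n = R * Suc j\<close>.\<close>
  define h where "h j = R * Suc j - 1" for j
  have Sh: "Suc (h j) = R * Suc j" for j using R by (simp add: h_def)
  have mono: "strict_mono h"
  proof (rule strict_monoI_Suc)
    show "h n < h (Suc n)" for n using Sh[of n] Sh[of "Suc n"] R by simp
  qed
  have fh: "?f (h j) = real R powr (- (1 + \<delta>)) * cmod (incr \<delta> ((real R)\<^sup>2 * y) j)" for j
  proof -
    have "real (Suc (h j)) = real R * real (Suc j)" by (simp only: Sh of_nat_mult)
    then have "wt \<delta> (h j) = real R powr (- (1 + \<delta>)) * wt \<delta> j"
      "(real (Suc (h j)))\<^sup>2 * y = (real (Suc j))\<^sup>2 * ((real R)\<^sup>2 * y)"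
      by (simp_all only: wt_def) (simp_all add: powr_mult power_mult_distrib mult_ac)
    moreover have "R dvd Suc (h j)" by (simp only: Sh dvd_triv_left)
    ultimately show ?thesis by (simp only: incr_def norm_mult norm_of_real if_True) (simp add: abs_mult)
  qed
  have z: "?f n = 0" if "n \<notin> range h" for n
  proof -
    have "\<not> R dvd Suc n"
    proof
      assume "R dvd Suc n"
      then obtain j where j: "Suc n = R * j" by (elim dvdE)
      then obtain i where "j = Suc i" by (cases j) auto
      then have "n = h i" using j Sh[of i] by simp
      then show False using that by simp
    qed
    then show ?thesis by simp
  qed
  let ?s = "\<Sum>j. cmod (incr \<delta> ((real R)\<^sup>2 * y) j)"
  have "(\<lambda>j. ?f (h j)) sums (real R powr (- (1 + \<delta>)) * ?s)"
    unfolding fh by (intro sums_mult summable_sums summable_norm_incr \<delta>)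
  then have s: "?f sums (real R powr (- (1 + \<delta>)) * ?s)"
    using sums_mono_reindex[OF mono, of ?f] z by blast
  then show "summable ?f" by (simp add: sums_iff)
  have "suminf ?f = real R powr (- (1 + \<delta>)) * ?s" using s by (simp add: sums_iff)
  also have "\<dots> \<le> real R powr (- (1 + \<delta>)) * ((2 * pi + 8 / \<delta>) * \<bar>(real R)\<^sup>2 * y\<bar> powr (\<delta> / 2))"
    by (intro mult_left_mono suminf_norm_incr_le \<delta>) auto
  also have "\<bar>(real R)\<^sup>2 * y\<bar> powr (\<delta> / 2) = real R powr \<delta> * \<bar>y\<bar> powr (\<delta> / 2)"
  proof -
    have "\<bar>(real R)\<^sup>2 * y\<bar> = real R powr 2 * \<bar>y\<bar>" using R by (simp add: abs_mult powr_numeral)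
    then show ?thesis by (simp add: powr_mult powr_powr del: powr_numeral)
  qed
  also have "real R powr (- (1 + \<delta>)) * ((2 * pi + 8 / \<delta>) * (real R powr \<delta> * \<bar>y\<bar> powr (\<delta> / 2)))
     = (2 * pi + 8 / \<delta>) * (real R powr (- (1 + \<delta>)) * real R powr \<delta>) * \<bar>y\<bar> powr (\<delta> / 2)"
    by simp
  also have "real R powr (- (1 + \<delta>)) * real R powr \<delta> = 1 / real R"
    unfolding powr_add[symmetric] using R by (simp add: powr_minus field_simps)
  finally show "suminf ?f \<le> (2 * pi + 8 / \<delta>) / real R * \<bar>y\<bar> powr (\<delta> / 2)" by simp
qed

text \<open>The change of the phase contributes 6 \<pi> y, from 2 n + 3 \<le> 3 (n + 1), and the
  change of the weight contributes 4 \<pi> y, from 1 + \<delta> \<le> 2.\<close>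

lemma norm_incr_diff_le:
  assumes \<delta>: "0 < \<delta>" "\<delta> \<le> 1" and y: "y \<ge> 0"
  shows "cmod (incr \<delta> y (Suc n) - incr \<delta> y n) \<le> 10 * pi * y * real (Suc n) powr - \<delta>"
proof -
  define u where "u k = e ((real (Suc k))\<^sup>2 * y)" for k
  have split: "incr \<delta> y (Suc n) - incr \<delta> y n = of_real (wt \<delta> (Suc n)) * (u (Suc n) - u n)
     + of_real (wt \<delta> (Suc n) - wt \<delta> n) * (u n - 1)"
    by (simp add: incr_def u_def algebra_simps)
  have p1: "real (Suc n) powr - \<delta> = wt \<delta> n * real (Suc n)"
  proof -
    have "real (Suc n) powr - \<delta> = real (Suc n) powr (- (1 + \<delta>)) * real (Suc n) powr 1"
      unfolding powr_add[symmetric] by simp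
    then show ?thesis by (simp add: wt_def)
  qed
  have wm: "wt \<delta> (Suc n) \<le> wt \<delta> n" unfolding wt_def using \<delta> by (intro powr_mono2') auto
  have "u (Suc n) - u n = u n * (e (real (2 * n + 3) * y) - 1)"
  proof -
    have "(real (Suc (Suc n)))\<^sup>2 * y = (real (Suc n))\<^sup>2 * y + real (2 * n + 3) * y"
      by (simp add: power2_eq_square algebra_simps)
    then show ?thesis by (simp only: u_def e_add) (simp add: algebra_simps)
  qed
  then have "cmod (u (Suc n) - u n) \<le> 2 * pi * (real (2 * n + 3) * y)"
    using norm_e_minus_1_le[of "real (2 * n + 3) * y"] y by (simp add: norm_mult u_def)
  also have "\<dots> \<le> 2 * pi * ((3 * real (Suc n)) * y)"
    using y by (intro mult_left_mono mult_right_mono) auto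
  finally have "wt \<delta> (Suc n) * cmod (u (Suc n) - u n) \<le> wt \<delta> n * (2 * pi * ((3 * real (Suc n)) * y))"
    using wm by (intro mult_mono) auto
  also have "\<dots> = 6 * pi * y * real (Suc n) powr - \<delta>" unfolding p1 by simp
  finally have 1: "cmod (of_real (wt \<delta> (Suc n)) * (u (Suc n) - u n)) \<le> 6 * pi * y * real (Suc n) powr - \<delta>"
    by (simp add: norm_mult)
  obtain \<xi> where \<xi>: "real (Suc n) < \<xi>" "\<xi> < real (Suc n) + 1"
    "(real (Suc n) + 1) powr (- (1 + \<delta>)) - real (Suc n) powr (- (1 + \<delta>)) = - (1 + \<delta>) * \<xi> powr (- (1 + \<delta>) - 1)"
    using powr_mvt[of "real (Suc n)" "- (1 + \<delta>)"] by auto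
  have "\<bar>wt \<delta> (Suc n) - wt \<delta> n\<bar> = (1 + \<delta>) * \<xi> powr (- (1 + \<delta>) - 1)"
    using \<xi>(3) \<delta> by (simp add: wt_def add.commute abs_mult)
  also have "\<dots> \<le> 2 * real (Suc n) powr (- (1 + \<delta>) - 1)"
    using \<xi> \<delta> by (intro mult_mono powr_mono2') auto
  finally have "\<bar>wt \<delta> (Suc n) - wt \<delta> n\<bar> * cmod (u n - 1)
      \<le> 2 * real (Suc n) powr (- (1 + \<delta>) - 1) * (2 * pi * ((real (Suc n))\<^sup>2 * y))"
    using norm_e_minus_1_le[of "(real (Suc n))\<^sup>2 * y"] y
    by (intro mult_mono) (auto simp: u_def abs_mult simp del: of_nat_Suc)
  also have "\<dots> = 4 * pi * y * (real (Suc n) powr (- (1 + \<delta>) - 1) * real (Suc n) powr 2)"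
    by (simp add: powr_numeral)
  also have "\<dots> = 4 * pi * y * real (Suc n) powr - \<delta>"
    unfolding powr_add[symmetric] by simp
  finally have 2: "cmod (of_real (wt \<delta> (Suc n) - wt \<delta> n) * (u n - 1)) \<le> 4 * pi * y * real (Suc n) powr - \<delta>"
    by (simp only: norm_mult norm_of_real)
  show ?thesis unfolding split
    by (rule order_trans[OF norm_triangle_ineq]) (use 1 2 in simp)
qed

text \<open>By the mean value theorem each term after the first is at most the increment of 2 x powr
  (1 - s), since 2 (1 - s) \<ge> 1.\<close>

lemma sum_powr_le:
  fixes s :: real
  assumes "0 \<le> s" "s \<le> 1 / 2"
  shows "(\<Sum>n<M. real (Suc n) powr - s) \<le> 2 * real M powr (1 - s)"
proof (induction M)
  case (Suc M)
  have "real (Suc M) powr - s \<le> 2 * real (Suc M) powr (1 - s) - 2 * real M powr (1 - s)"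
  proof (cases "M = 0")
    case False
    then obtain \<xi> where \<xi>: "real M < \<xi>" "\<xi> < real M + 1"
      "(real M + 1) powr (1 - s) - real M powr (1 - s) = (1 - s) * \<xi> powr ((1 - s) - 1)"
      using powr_mvt[of "real M" "1 - s"] by auto
    have "1 * real (Suc M) powr - s \<le> (2 * (1 - s)) * \<xi> powr - s"
      using \<xi> assms by (intro mult_mono powr_mono2') auto
    also have "\<dots> = 2 * ((1 - s) * \<xi> powr ((1 - s) - 1))" by simp
    finally show ?thesis unfolding \<xi>(3)[symmetric] by (simp add: add.commute)
  qed simp
  then show ?case using Suc by simp
qed simp

section \<open>Summation by parts against periodic sequences of mean zero\<close>

lemma sum_abel:
  fixes a \<sigma> :: "nat \<Rightarrow> complex"
  shows "(\<Sum>n<M. \<sigma> n * a n) = (\<Sum>i<M. \<sigma> i) * a M - (\<Sum>n<M. (\<Sum>i\<le>n. \<sigma> i) * (a (Suc n) - a n))"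
proof (induction M)
  case (Suc M)
  show ?case
    by (simp only: sum.lessThan_Suc Suc lessThan_Suc_atMost[symmetric]) (simp add: algebra_simps)
qed simp

text \<open>Full periods contribute nothing, so fewer than q terms remain.\<close>

lemma periodic_partial_sums_bounded:
  fixes \<sigma> :: "nat \<Rightarrow> complex"
  assumes q: "q > 0" and per: "\<And>n. \<sigma> (n + q) = \<sigma> n" and z: "(\<Sum>n<q. \<sigma> n) = 0"
    and B: "\<And>n. cmod (\<sigma> n) \<le> B"
  shows "cmod (\<Sum>n<M. \<sigma> n) \<le> real q * B"
proof (induction M rule: less_induct)
  case (less M)
  have B0: "B \<ge> 0" using order_trans[OF norm_ge_zero B[of 0]] .
  show ?case
  proof (cases "M < q")
    case True
    have "cmod (\<Sum>n<M. \<sigma> n) \<le> (\<Sum>n<M. B)" by (intro sum_norm_le B)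
    also have "\<dots> \<le> real q * B" using True B0 by (simp add: mult_right_mono)
    finally show ?thesis .
  next
    case False
    then have "(\<Sum>n<M. \<sigma> n) = (\<Sum>n<(M - q) + q. \<sigma> n)" by simp
    also have "(\<Sum>n<K + q. \<sigma> n) = (\<Sum>n<K. \<sigma> n) + (\<Sum>n<q. \<sigma> (n + K))" for K
      by (induction q) (simp_all add: add_ac)
    also have "(\<Sum>n<q. \<sigma> (n + (M - q))) = 0"
      using sum_shift_periodic[of \<sigma> q, OF per] z by simp
    finally show ?thesis using less.IH[of "M - q"] q False by simp
  qed
qed

text \<open>
  Abel summation handles the terms up to \<open>n \<approx> y powr (- 3/4)\<close> and the trivial bound the rest;
  this cut-off makes both parts \<open>O(y powr (5\<delta>/8))\<close>, hence \<open>o(y powr (\<delta>/2))\<close>.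
\<close>

lemma periodic_mean_incr:
  fixes \<rho> :: "nat \<Rightarrow> complex"
  assumes \<delta>: "0 < \<delta>" "\<delta> \<le> 1" and q: "q > 0" and per: "\<And>n. \<rho> (n + q) = \<rho> n"
    and \<rho>: "\<And>n. cmod (\<rho> n) \<le> 1"
  obtains C where "C > 0"
    "\<And>y. 0 < y \<Longrightarrow> y \<le> 1 \<Longrightarrow>
      cmod ((\<Sum>n. \<rho> (Suc n) * incr \<delta> y n) - (\<Sum>n=1..q. \<rho> n) / of_nat q * Phi \<delta> y) \<le> C * y powr (5 * \<delta> / 8)"
proof -
  define \<mu> where "\<mu> = (\<Sum>n=1..q. \<rho> n) / of_nat q"
  define \<sigma> where "\<sigma> n = \<rho> (Suc n) - \<mu>" for n
  define C where "C = 4 * real q + 40 * pi * real q + 16 / \<delta>"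
  have C0: "C > 0" using \<delta> q by (auto simp: C_def intro!: add_pos_pos)
  have "cmod (\<Sum>n=1..q. \<rho> n) \<le> (\<Sum>n=1..q. 1)" by (intro sum_norm_le \<rho>)
  then have \<mu>: "cmod \<mu> \<le> 1" using q by (simp add: \<mu>_def norm_divide)
  have \<sigma>: "cmod (\<sigma> n) \<le> 2" for n
    unfolding \<sigma>_def using norm_triangle_ineq4[of "\<rho> (Suc n)" \<mu>] \<rho>[of "Suc n"] \<mu> by linarith
  have \<sigma>per: "\<sigma> (n + q) = \<sigma> n" for n using per[of "Suc n"] by (simp add: \<sigma>_def)
  have "(\<Sum>n<q. \<rho> (Suc n)) = (\<Sum>n=1..q. \<rho> n)"
    by (rule sum.reindex_bij_witness[of _ "\<lambda>n. n - 1" Suc]) auto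
  then have \<sigma>0: "(\<Sum>n<q. \<sigma> n) = 0" using q by (simp add: \<sigma>_def sum_subtractf \<mu>_def)
  have part: "cmod (\<Sum>n<M. \<sigma> n) \<le> 2 * real q" for M
    using periodic_partial_sums_bounded[OF q \<sigma>per \<sigma>0 \<sigma>, of M] by simp
  show thesis
  proof (rule that[OF C0])
    fix y :: real assume y: "0 < y" "y \<le> 1"
    define M where "M = nat \<lfloor>y powr (- (3 / 4))\<rfloor>"
    have My: "real M \<le> y powr (- (3 / 4))" "y powr (- (3 / 4)) \<le> real (Suc M)"
      by (auto simp: M_def) linarith
    have Md: "real (Suc M) powr - \<delta> \<le> y powr (5 * \<delta> / 8)"
    proof -
      have "real (Suc M) powr - \<delta> \<le> (y powr (- (3 / 4))) powr - \<delta>"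
        using My y \<delta> by (intro powr_mono2') auto
      also have "\<dots> = y powr (3 / 4 * \<delta>)" by (simp add: powr_powr)
      also have "\<dots> \<le> y powr (5 * \<delta> / 8)" using y \<delta> by (intro powr_mono') auto
      finally show ?thesis .
    qed
    have b1: "cmod (\<sigma> n * incr \<delta> y n) \<le> 4 * wt \<delta> n" for n
      using mult_mono[OF \<sigma>[of n] norm_incr_le[of \<delta> y n]] by (simp add: norm_mult)
    have "cmod (\<Sum>n. \<sigma> (n + M) * incr \<delta> y (n + M)) \<le> 4 / \<delta> * 4 * real (Suc M) powr - \<delta>"
      by (rule wt_tail_bounded_le(2)[OF \<delta> b1])
    also have "\<dots> \<le> 16 / \<delta> * y powr (5 * \<delta> / 8)"
      using mult_left_mono[OF Md, of "16 / \<delta>"] \<delta> by simp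
    finally have tail: "cmod (\<Sum>n. \<sigma> (n + M) * incr \<delta> y (n + M)) \<le> 16 / \<delta> * y powr (5 * \<delta> / 8)" .
    have "cmod (\<Sum>n<M. \<sigma> n * incr \<delta> y n) \<le> cmod ((\<Sum>i<M. \<sigma> i) * incr \<delta> y M)
        + cmod (\<Sum>n<M. (\<Sum>i\<le>n. \<sigma> i) * (incr \<delta> y (Suc n) - incr \<delta> y n))"
      by (subst sum_abel) (rule norm_triangle_ineq4)
    also have "cmod ((\<Sum>i<M. \<sigma> i) * incr \<delta> y M) \<le> 2 * real q * (2 * real (Suc M) powr - \<delta>)"
    proof -
      have "wt \<delta> M \<le> real (Suc M) powr - \<delta>" unfolding wt_def by (intro powr_mono) auto
      then show ?thesis unfolding norm_mult
        by (intro mult_mono part order_trans[OF norm_incr_le]) auto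
    qed
    also have "\<dots> \<le> 4 * real q * y powr (5 * \<delta> / 8)"
      using mult_left_mono[OF Md, of "4 * real q"] by simp
    also have "cmod (\<Sum>n<M. (\<Sum>i\<le>n. \<sigma> i) * (incr \<delta> y (Suc n) - incr \<delta> y n))
      \<le> (\<Sum>n<M. 2 * real q * (10 * pi * y * real (Suc n) powr - (\<delta> / 2)))"
    proof (intro sum_norm_le)
      fix n
      have "cmod (incr \<delta> y (Suc n) - incr \<delta> y n) \<le> 10 * pi * y * real (Suc n) powr - \<delta>"
        using y by (intro norm_incr_diff_le \<delta>) auto
      \<comment> \<open>The exponent \<delta> is weakened to \<delta> / 2, which is at most 1/2 as
        \<open>sum_powr_le\<close> demands.\<close>
      also have "\<dots> \<le> 10 * pi * y * real (Suc n) powr - (\<delta> / 2)"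
        using y \<delta> by (intro mult_left_mono powr_mono) auto
      finally show "cmod ((\<Sum>i\<le>n. \<sigma> i) * (incr \<delta> y (Suc n) - incr \<delta> y n))
         \<le> 2 * real q * (10 * pi * y * real (Suc n) powr - (\<delta> / 2))"
        unfolding norm_mult using part[of "Suc n"] 
        by (intro mult_mono) (auto simp: lessThan_Suc_atMost)
    qed
    also have "\<dots> = 20 * pi * real q * y * (\<Sum>n<M. real (Suc n) powr - (\<delta> / 2))"
      by (simp add: sum_distrib_left mult_ac)
    also have "\<dots> \<le> 20 * pi * real q * y * (2 * real M powr (1 - \<delta> / 2))"
      using y \<delta> by (intro mult_left_mono sum_powr_le) auto
    also have "\<dots> \<le> 20 * pi * real q * y * (2 * (y powr (- (3 / 4))) powr (1 - \<delta> / 2))"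
      using y \<delta> My by (intro mult_left_mono powr_mono2) auto
    also have "\<dots> = 40 * pi * real q * (y powr 1 * (y powr (- (3 / 4))) powr (1 - \<delta> / 2))"
      using y by simp
    also have "y powr 1 * (y powr (- (3 / 4))) powr (1 - \<delta> / 2) = y powr (1 / 4 + 3 * \<delta> / 8)"
      unfolding powr_powr powr_add[symmetric] by (simp add: field_simps)
    \<comment> \<open>For y \<le> 1 the smaller exponent gives the larger power, and 1/4 + 3
      \<delta> / 8 \<ge> 5 \<delta> / 8 amounts to \<delta> \<le> 1.\<close>
    also have "40 * pi * real q * y powr (1 / 4 + 3 * \<delta> / 8) \<le> 40 * pi * real q * y powr (5 * \<delta> / 8)"
      using y \<delta> by (intro mult_left_mono powr_mono') auto
    finally have head: "cmod (\<Sum>n<M. \<sigma> n * incr \<delta> y n)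
       \<le> 4 * real q * y powr (5 * \<delta> / 8) + 40 * pi * real q * y powr (5 * \<delta> / 8)" by simp
    have sm: "summable (\<lambda>n. \<sigma> n * incr \<delta> y n)" by (rule wt_tail_bounded_le(1)[OF \<delta> b1])
    have si: "summable (incr \<delta> y)" by (rule wt_tail_bounded_le(1)[OF \<delta> norm_incr_le])
    have "cmod (\<rho> (Suc n) * incr \<delta> y n) \<le> 2 * wt \<delta> n" for n
      using mult_mono[OF \<rho>[of "Suc n"] norm_incr_le[of \<delta> y n]] by (simp add: norm_mult)
    from wt_tail_bounded_le(1)[OF \<delta> this]
    have sr: "summable (\<lambda>n. \<rho> (Suc n) * incr \<delta> y n)" .
    have "(\<Sum>n. \<rho> (Suc n) * incr \<delta> y n) - \<mu> * Phi \<delta> y = (\<Sum>n. \<rho> (Suc n) * incr \<delta> y n - \<mu> * incr \<delta> y n)"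
      unfolding Phi_def using sr si
      by (simp add: suminf_mult[OF si, symmetric] suminf_diff summable_mult)
    also have "\<dots> = (\<Sum>n. \<sigma> n * incr \<delta> y n)" by (simp add: \<sigma>_def algebra_simps)
    also have "\<dots> = (\<Sum>n. \<sigma> (n + M) * incr \<delta> y (n + M)) + (\<Sum>n<M. \<sigma> n * incr \<delta> y n)"
      by (rule suminf_split_initial_segment[OF sm])
    finally have "cmod ((\<Sum>n. \<rho> (Suc n) * incr \<delta> y n) - \<mu> * Phi \<delta> y) \<le>
       cmod (\<Sum>n. \<sigma> (n + M) * incr \<delta> y (n + M)) + cmod (\<Sum>n<M. \<sigma> n * incr \<delta> y n)"
      by (simp add: norm_triangle_ineq)
    then show "cmod ((\<Sum>n. \<rho> (Suc n) * incr \<delta> y n) - (\<Sum>n=1..q. \<rho> n) / of_nat q * Phi \<delta> y) \<le> C * y powr (5 * \<delta> / 8)"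
      using head tail unfolding \<mu>_def[symmetric] by (simp add: C_def algebra_simps)
  qed
qed

text \<open>The real parts of all terms have the same sign, so it suffices to keep the \<open>n\<close> with \<open>1/4 \<le> n\<^sup>2 y \<le> 16/25\<close>.\<close>

lemma norm_Phi_ge:
  assumes \<delta>: "0 < \<delta>" "\<delta> \<le> 1" and y: "0 < y" "y \<le> 1 / 16"
  shows "cmod (Phi \<delta> y) \<ge> 1 / 20 * y powr (\<delta> / 2)"
proof -
  define Y where "Y = y powr (- (1 / 2))"
  have Y0: "Y > 0" using y by (simp add: Y_def)
  have Y2: "Y\<^sup>2 * y = 1"
  proof -
    have "Y\<^sup>2 * y = Y powr 2 * y powr 1" using Y0 y by (simp add: powr_numeral)
    also have "\<dots> = 1" unfolding Y_def powr_powr powr_add[symmetric] using y by simp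
    finally show ?thesis .
  qed
  have Y4: "Y \<ge> 4"
  proof (rule ccontr)
    assume "\<not> Y \<ge> 4"
    then have "Y\<^sup>2 < 4\<^sup>2" using Y0 by (intro power_strict_mono) auto
    then have "Y\<^sup>2 * y < 16 * y" using y by simp
    then show False using y Y2 by simp
  qed
  define A where "A = {n. Y / 2 \<le> real (Suc n) \<and> real (Suc n) \<le> 4 * Y / 5}"
  have Asub: "A \<subseteq> {..nat \<lceil>Y\<rceil>}" unfolding A_def by (auto, linarith)
  then have finA: "finite A" using finite_subset by blast
  have "{nat \<lceil>Y / 2\<rceil> - 1..<nat \<lfloor>4 * Y / 5\<rfloor>} \<subseteq> A"
    unfolding A_def using Y4 by (auto, linarith+)
  then have "nat \<lfloor>4 * Y / 5\<rfloor> - (nat \<lceil>Y / 2\<rceil> - 1) \<le> card A"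
    using card_mono[OF finA, of "{nat \<lceil>Y / 2\<rceil> - 1..<nat \<lfloor>4 * Y / 5\<rfloor>}"] by simp
  \<comment> \<open>The interval has length 3 Y / 10, and rounding loses at most 1 \<le> Y / 4
    points, which leaves Y / 20.\<close>
  then have cA: "Y / 20 \<le> real (card A)" using Y4 by linarith
  have re: "- Re (incr \<delta> y n) = wt \<delta> n * (1 - cos (2 * pi * ((real (Suc n))\<^sup>2 * y)))" for n
    by (simp add: incr_def e_cis algebra_simps)
  have nonneg: "- Re (incr \<delta> y n) \<ge> 0" for n unfolding re by simp
  have si: "summable (incr \<delta> y)" by (rule wt_tail_bounded_le(1)[OF \<delta> norm_incr_le])
  have sr: "summable (\<lambda>n. - Re (incr \<delta> y n))" by (intro summable_minus summable_Re si)
  have big: "- Re (incr \<delta> y n) \<ge> Y powr (- (1 + \<delta>))" if "n \<in> A" for n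
  proof -
    have n: "Y / 2 \<le> real (Suc n)" "real (Suc n) \<le> 4 * Y / 5" using that by (auto simp: A_def)
    have "(Y / 2)\<^sup>2 * y \<le> (real (Suc n))\<^sup>2 * y" using n Y0 y by (intro mult_right_mono power_mono) auto
    moreover have "(Y / 2)\<^sup>2 * y = 1 / 4" using Y2 by (simp add: power_divide)
    ultimately have l: "1 / 4 \<le> (real (Suc n))\<^sup>2 * y" by simp
    have "(real (Suc n))\<^sup>2 * y \<le> (4 * Y / 5)\<^sup>2 * y" using n y by (intro mult_right_mono power_mono) auto
    moreover have "(4 * Y / 5)\<^sup>2 * y = 16 / 25" using Y2 by (simp add: power_divide power_mult_distrib)
    ultimately have r: "(real (Suc n))\<^sup>2 * y \<le> 16 / 25" by simp
    let ?t = "2 * pi * ((real (Suc n))\<^sup>2 * y)"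
    have "2 * pi * (1 / 4) \<le> ?t" using l by (intro mult_left_mono) auto
    moreover have "?t \<le> 2 * pi * (3 / 4)" using r by (intro mult_left_mono) auto
    ultimately have "\<bar>?t - pi\<bar> \<le> pi / 2" by (simp only: abs_le_iff) linarith
    then have "cos (?t - pi) \<ge> 0" by (intro cos_ge_zero) linarith+
    then have "cos ?t \<le> 0" by (simp add: cos_diff)
    then have "wt \<delta> n * 1 \<le> - Re (incr \<delta> y n)" unfolding re by (intro mult_left_mono) auto
    moreover have "Y powr (- (1 + \<delta>)) \<le> wt \<delta> n" unfolding wt_def
      using n Y0 \<delta> by (intro powr_mono2') auto
    ultimately show ?thesis by simp
  qed
  have "1 / 20 * y powr (\<delta> / 2) = Y / 20 * Y powr (- (1 + \<delta>))"
  proof -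
    have "Y * Y powr (- (1 + \<delta>)) = Y powr 1 * Y powr (- (1 + \<delta>))" using Y0 by simp
    also have "\<dots> = y powr (\<delta> / 2)" unfolding powr_add[symmetric] by (simp add: Y_def powr_powr)
    finally show ?thesis by simp
  qed
  also have "\<dots> \<le> real (card A) * Y powr (- (1 + \<delta>))" using cA by (intro mult_right_mono) auto
  also have "\<dots> = (\<Sum>n\<in>A. Y powr (- (1 + \<delta>)))" by simp
  also have "\<dots> \<le> (\<Sum>n\<in>A. - Re (incr \<delta> y n))" by (intro sum_mono big)
  also have "\<dots> \<le> (\<Sum>n. - Re (incr \<delta> y n))"
    by (intro sum_le_suminf sr finA) (use nonneg in auto)
  also have "\<dots> = - Re (Phi \<delta> y)" unfolding Phi_def
    by (simp add: suminf_minus[OF summable_Re[OF si]] Re_suminf[OF si])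
  also have "\<dots> \<le> cmod (Phi \<delta> y)" using abs_Re_le_cmod[of "Phi \<delta> y"] by simp
  finally show ?thesis .
qed

section \<open>Fourier series of continuous periodic functions\<close>

lemma periodic_add_of_int:
  fixes f :: "real \<Rightarrow> 'a"
  assumes "\<And>x. f (x + 1) = f x"
  shows "f (x + of_int k) = f x"
proof -
  have nat: "f (x + real n) = f x" for x n
  proof (induction n arbitrary: x)
    case (Suc n)
    have "f (x + real (Suc n)) = f ((x + real n) + 1)" by (simp add: add_ac)
    then show ?case using Suc assms by simp
  qed simp
  show ?thesis
  proof (cases "k \<ge> 0")
    case True
    then show ?thesis using nat[of x "nat k"] by simp
  next
    case False
    then show ?thesis using nat[of "x + of_int k" "nat (- k)"] by simp
  qed
qed

lemma integral_periodic_shift: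
  fixes f :: "real \<Rightarrow> complex"
  assumes cont: "continuous_on UNIV f" and per: "\<And>x. f (x + 1) = f x"
  shows "integral {0..1} (\<lambda>x. f (x + c)) = integral {0..1} f"
proof -
  define r where "r = frac c"
  have r: "0 \<le> r" "r < 1" by (auto simp: r_def frac_lt_1)
  have int: "f integrable_on {a..b}" for a b
    by (intro integrable_continuous_real continuous_on_subset[OF cont]) auto
  have sh: "integral {a..b} (\<lambda>x. f (x + d)) = integral {a + d..b + d} f" for a b d
    using integral_shift_Icc_real[of a b f d] by (simp add: o_def add.commute)
  have "integral {0..1} (\<lambda>x. f (x + c)) = integral {0..1} (\<lambda>x. f (x + r))"
  proof (rule arg_cong[of _ _ "integral {0..1}"], rule ext)
    fix x
    have "x + c = (x + r) + of_int \<lfloor>c\<rfloor>" by (simp add: r_def frac_def)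
    then show "f (x + c) = f (x + r)" by (simp only: periodic_add_of_int[of f, OF per])
  qed
  also have "\<dots> = integral {r..1 + r} f" unfolding sh by simp
  also have "\<dots> = integral {r..1} f + integral {1..1 + r} f"
    using r int by (intro Henstock_Kurzweil_Integration.integral_combine[symmetric]) auto
  also have "integral {1..1 + r} f = integral {0..r} (\<lambda>x. f (x + 1))"
    unfolding sh by (simp add: add.commute)
  also have "\<dots> = integral {0..r} f" by (simp only: per)
  also have "integral {r..1} f + integral {0..r} f = integral {0..1} f"
    using Henstock_Kurzweil_Integration.integral_combine[of 0 r 1 f] r int by (simp add: add.commute)
  finally show ?thesis .
qed

lemma continuous_on_e [continuous_intros]:
  "continuous_on S f \<Longrightarrow> continuous_on S (\<lambda>x. e (f x))"
  unfolding e_def by (intro continuous_intros)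

lemma e_periodic [simp]: "e (of_int k * (x + 1)) = e (of_int k * x)"
  by (simp add: distrib_left)

lemma integral_e: "integral {0..1} (\<lambda>x. e (of_int k * x)) = (if k = 0 then 1 else 0)"
proof (cases "k = 0")
  case False
  define c where "c = 2 * of_real pi * \<i> * (of_int k :: complex)"
  have c0: "c \<noteq> 0" using False by (simp add: c_def)
  have e: "e (of_int k * x) = exp (c * of_real x)" for x by (simp add: e_def c_def mult_ac)
  have "((\<lambda>x. e (of_int k * x)) has_integral (exp (c * of_real 1) / c - exp (c * of_real 0) / c)) {0..1}"
  proof (rule fundamental_theorem_of_calculus)
    fix x :: real
    have "((\<lambda>z. exp (c * z) / c) has_field_derivative exp (c * of_real x)) (at (of_real x))"
      using c0 by (auto intro!: derivative_eq_intros)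
    then have "((\<lambda>x. exp (c * of_real x) / c) has_vector_derivative exp (c * of_real x)) (at x within {0..1})"
      by (rule has_vector_derivative_real_field)
    then show "((\<lambda>x. exp (c * of_real x) / c) has_vector_derivative e (of_int k * x)) (at x within {0..1})"
      unfolding e .
  qed simp
  moreover have "exp (c * of_real 1) = 1" using e[of 1] by simp
  ultimately show ?thesis using False by (simp add: integral_unique)
qed simp

lemma of_real_cos_eq_e: "complex_of_real (cos (2 * pi * x)) = (e (of_int 1 * x) + e (of_int (- 1) * x)) / 2"
  by (simp add: e_cis complex_eq_iff)

text \<open>A factor cos (2 \<pi> x) averages the frequencies k + 1 and k - 1, so the induction has
  to cover all k at once.\<close>

lemma integral_trig_poly_eq_0:
  fixes F :: "real \<Rightarrow> complex"
  assumes cont: "continuous_on UNIV F" and z: "\<And>k. integral {0..1} (\<lambda>x. F x * e (of_int k * x)) = 0"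
  shows "integral {0..1} (\<lambda>x. F x * of_real (cos (2 * pi * x)) ^ i * e (of_int k * x)) = 0"
proof (induction i arbitrary: k)
  case 0
  then show ?case using z by simp
next
  case (Suc i)
  let ?h = "\<lambda>k x. F x * of_real (cos (2 * pi * x)) ^ i * e (of_int k * x)"
  have int: "?h k integrable_on {0..1}" for k
    by (intro integrable_continuous_real continuous_intros continuous_on_subset[OF cont]) auto
  have "(\<lambda>x. F x * of_real (cos (2 * pi * x)) ^ Suc i * e (of_int k * x)) = (\<lambda>x. (?h (k + 1) x + ?h (k - 1) x) / 2)"
  proof
    fix x
    have "e (of_int (k + 1) * x) = e (of_int k * x) * e (of_int 1 * x)"
      "e (of_int (k - 1) * x) = e (of_int k * x) * e (of_int (- 1) * x)"
      unfolding e_add[symmetric] by (simp_all add: algebra_simps)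
    then show "F x * of_real (cos (2 * pi * x)) ^ Suc i * e (of_int k * x) = (?h (k + 1) x + ?h (k - 1) x) / 2"
      by (simp only: of_real_cos_eq_e power_Suc) (simp add: field_simps)
  qed
  then show ?case
    by (simp only: integral_divide Henstock_Kurzweil_Integration.integral_add[OF int int] Suc) simp
qed

text \<open>
  \<open>F x = f (x + c) + f (c - x)\<close> is even, hence a continuous function of \<open>cos (2 \<pi> x)\<close>, which
  polynomials approximate uniformly; so \<open>F\<close> is orthogonal to itself.
\<close>

lemma fourier_zero_imp_zero:
  fixes f :: "real \<Rightarrow> real"
  assumes cont: "continuous_on UNIV f" and per: "\<And>x. f (x + 1) = f x"
    and z: "\<And>k. integral {0..1} (\<lambda>x. of_real (f x) * e (of_int k * x)) = 0"
  shows "f c = 0"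
proof -
  define F where "F x = f (x + c) + f (c - x)" for x
  have cf: "continuous_on S (\<lambda>x. f (h x))" if "continuous_on S h" for h and S :: "real set"
    by (rule continuous_on_compose2[OF cont that]) auto
  have contF: "continuous_on S F" for S
    unfolding F_def by (intro continuous_intros cf)
  have zF: "integral {0..1} (\<lambda>x. complex_of_real (F x) * e (of_int k * x)) = 0" for k
  proof -
    have plus: "integral {0..1} (\<lambda>x. complex_of_real (f (x + c)) * e (of_int k * x)) = 0" for k
    proof -
      have eq: "(\<lambda>x. complex_of_real (f (x + c)) * e (of_int k * x))
        = (\<lambda>x. (\<lambda>t. complex_of_real (f t) * e (of_int k * t)) (x + c) * e (- (of_int k * c)))"
      proof
        fix x
        have "e (of_int k * (x + c)) * e (- (of_int k * c)) = e (of_int k * x)"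
          unfolding e_add[symmetric] by (simp add: algebra_simps)
        then show "complex_of_real (f (x + c)) * e (of_int k * x)
          = complex_of_real (f (x + c)) * e (of_int k * (x + c)) * e (- (of_int k * c))"
          by (simp only: mult.assoc)
      qed
      have "integral {0..1} (\<lambda>x. complex_of_real (f (x + c)) * e (of_int k * x))
        = integral {0..1} (\<lambda>x. (\<lambda>t. complex_of_real (f t) * e (of_int k * t)) (x + c)) * e (- (of_int k * c))"
        unfolding eq by (rule integral_mult_left)
      also have "integral {0..1} (\<lambda>x. (\<lambda>t. complex_of_real (f t) * e (of_int k * t)) (x + c)) = integral {0..1} (\<lambda>t. complex_of_real (f t) * e (of_int k * t))"
        by (intro integral_periodic_shift continuous_intros cont) (simp add: per)
      also have "\<dots> = 0" by (rule z)
      finally show ?thesis by simp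
    qed
    \<comment> \<open>The frequency is negated so that \<open>h (- x)\<close> is the integrand with
      f (c - x) and frequency k; reflection and periodicity then reduce its integral to
      \<open>plus\<close>.\<close>
    define h where "h x = complex_of_real (f (x + c)) * e (of_int (- k) * x)" for x
    have ch: "continuous_on S h" for S unfolding h_def by (intro continuous_intros cf)
    have "integral {0..1} (\<lambda>x. h (- x)) = integral {-1..0} h"
      using Henstock_Kurzweil_Integration.integral_reflect_real[of 0 "-1" h] by simp
    also have "\<dots> = integral {0..1} (\<lambda>x. h (x + (- 1)))"
      using integral_shift_Icc_real[of 0 1 h "-1"] by (simp add: o_def)
    also have "\<dots> = integral {0..1} h"
    proof (rule integral_periodic_shift[OF ch])
      fix x show "h (x + 1) = h x" using per[of "x + c"] by (simp only: h_def e_periodic) (simp add: add_ac)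
    qed
    also have "\<dots> = 0" unfolding h_def by (rule plus)
    finally have minus: "integral {0..1} (\<lambda>x. complex_of_real (f (c - x)) * e (of_int k * x)) = 0"
      by (simp add: h_def)
    have "integral {0..1} (\<lambda>x. complex_of_real (f (x + c)) * e (of_int k * x) + complex_of_real (f (c - x)) * e (of_int k * x)) = 0"
      by (subst Henstock_Kurzweil_Integration.integral_add)
        (auto simp: plus minus intro!: integrable_continuous_real continuous_intros cf)
    then show ?thesis by (simp add: F_def distrib_right)
  qed
  have zP: "integral {0..1} (\<lambda>x. F x * cos (2 * pi * x) ^ i) = 0" for i
  proof -
    have "complex_of_real (integral {0..1} (\<lambda>x. F x * cos (2 * pi * x) ^ i))
      = integral {0..1} (\<lambda>x. complex_of_real (F x * cos (2 * pi * x) ^ i))"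
      by (intro integral_unique[symmetric] has_integral_of_real integrable_integral
          integrable_continuous_real continuous_intros contF)
    also have "\<dots> = 0"
      using integral_trig_poly_eq_0[of "\<lambda>x. complex_of_real (F x)" i 0] zF contF
      by (simp add: continuous_on_of_real)
    finally show ?thesis by simp
  qed
  have zpoly: "integral {0..1} (\<lambda>x. F x * P (cos (2 * pi * x))) = 0" if P: "real_polynomial_function P" for P
  proof -
    obtain a :: "nat \<Rightarrow> real" and n where "P = (\<lambda>x. \<Sum>i\<le>n. a i * x ^ i)"
      using P by (auto simp: real_polynomial_function_iff_sum)
    then have eq: "(\<lambda>x. F x * P (cos (2 * pi * x))) = (\<lambda>x. \<Sum>i\<le>n. a i * (F x * cos (2 * pi * x) ^ i))"
      by (simp add: sum_distrib_left mult_ac)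
    have "integral {0..1} (\<lambda>x. F x * P (cos (2 * pi * x))) = (\<Sum>i\<le>n. integral {0..1} (\<lambda>x. a i * (F x * cos (2 * pi * x) ^ i)))"
      unfolding eq by (intro integral_sum integrable_continuous_real continuous_intros contF) auto
    also have "\<dots> = 0" by (simp add: zP)
    finally show ?thesis .
  qed
  define Q where "Q u = F (arccos u / (2 * pi))" for u
  have contQ: "continuous_on {-1..1} Q" unfolding Q_def
    by (rule continuous_on_compose2[OF contF[of UNIV]])
      (auto intro!: continuous_intros continuous_on_arccos')
  have FQ: "F x = Q (cos (2 * pi * x))" if "x \<in> {0..1}" for x
  proof (cases "x \<le> 1 / 2")
    case True
    then show ?thesis using that by (simp add: Q_def arccos_cos)
  next
    case False
    have "cos (2 * pi * x) = cos (2 * pi * (1 - x))"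
      by (simp add: right_diff_distrib cos_diff)
    moreover have "arccos (cos (2 * pi * (1 - x))) = 2 * pi * (1 - x)"
      using that False by (intro arccos_cos) auto
    ultimately have "Q (cos (2 * pi * x)) = F (1 - x)" by (simp add: Q_def)
    also have "\<dots> = F x"
      using per[of "c - x"] per[of "x + c - 1"] by (simp add: F_def algebra_simps)
    finally show ?thesis by simp
  qed
  have "compact (F ` {0..1})" by (intro compact_continuous_image contF) auto
  then obtain B where B: "B > 0" "\<And>x. x \<in> {0..1} \<Longrightarrow> \<bar>F x\<bar> \<le> B"
    by (auto dest!: compact_imp_bounded simp: bounded_pos)
  \<comment> \<open>Subtracting F times a polynomial P in the cosine does not change the integral of
    F^2, and the new integrand F (Q - P) is at most B \<eta> once P is within \<eta> of Q.\<close>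
  have small: "integral {0..1} (\<lambda>x. (F x)\<^sup>2) \<le> B * \<eta>" if \<eta>: "\<eta> > 0" for \<eta>
  proof -
    obtain P where P: "real_polynomial_function P" "\<And>u. u \<in> {-1..1} \<Longrightarrow> \<bar>Q u - P u\<bar> < \<eta>"
      using Stone_Weierstrass_real_polynomial_function[OF _ contQ \<eta>] by auto
    have contP: "continuous_on S (\<lambda>x. P (cos (2 * pi * x)))" for S :: "real set"
    proof (rule continuous_on_compose2[of UNIV P])
      show "continuous_on UNIV P"
        using P(1) by (simp add: continuous_on_polymonial_function real_polynomial_function_eq)
    qed (auto intro!: continuous_intros)
    have "integral {0..1} (\<lambda>x. (F x)\<^sup>2) = integral {0..1} (\<lambda>x. (F x)\<^sup>2) - integral {0..1} (\<lambda>x. F x * P (cos (2 * pi * x)))"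
      by (simp add: zpoly[OF P(1)])
    also have "\<dots> = integral {0..1} (\<lambda>x. (F x)\<^sup>2 - F x * P (cos (2 * pi * x)))"
      by (intro Henstock_Kurzweil_Integration.integral_diff[symmetric] integrable_continuous_real continuous_intros contF contP)
    also have "\<dots> \<le> integral {0..1} (\<lambda>x::real. B * \<eta>)"
    proof (rule Henstock_Kurzweil_Integration.integral_le)
      fix x :: real assume x: "x \<in> {0..1}"
      have "(F x)\<^sup>2 - F x * P (cos (2 * pi * x)) = F x * (Q (cos (2 * pi * x)) - P (cos (2 * pi * x)))"
        by (simp only: power2_eq_square FQ[OF x, symmetric] right_diff_distrib)
      also have "\<dots> \<le> \<bar>F x\<bar> * \<bar>Q (cos (2 * pi * x)) - P (cos (2 * pi * x))\<bar>"
        by (metis abs_ge_self abs_mult)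
      also have "\<dots> \<le> B * \<eta>"
        using B x P(2)[of "cos (2 * pi * x)"] by (intro mult_mono) auto
      finally show "(F x)\<^sup>2 - F x * P (cos (2 * pi * x)) \<le> B * \<eta>" .
    qed (auto intro!: integrable_continuous_real continuous_intros contF contP)
    finally show ?thesis by simp
  qed
  have ge: "integral {0..1} (\<lambda>x. (F x)\<^sup>2) \<ge> 0"
    by (intro Henstock_Kurzweil_Integration.integral_nonneg integrable_continuous_real continuous_intros contF) auto
  have "integral {0..1} (\<lambda>x. (F x)\<^sup>2) \<le> 0"
  proof (rule field_le_epsilon)
    fix \<epsilon> :: real assume "\<epsilon> > 0"
    then show "integral {0..1} (\<lambda>x. (F x)\<^sup>2) \<le> 0 + \<epsilon>"
      using small[of "\<epsilon> / B"] B by simp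
  qed
  then have "integral {0..1} (\<lambda>x. (F x)\<^sup>2) = 0" using ge by simp
  moreover have "continuous_on {0..1} (\<lambda>x. (F x)\<^sup>2)" by (intro continuous_intros contF)
  ultimately have "\<forall>x\<in>{0..1}. (F x)\<^sup>2 = 0"
    using integral_eq_0_iff[of 0 1 "\<lambda>x. (F x)\<^sup>2"] by auto
  then have "(F 0)\<^sup>2 = 0" by simp
  then show ?thesis by (simp add: F_def)
qed

lemma fourier_coeff_uminus: "fourier_coeff g (- k) = cnj (fourier_coeff g k)"
proof -
  have "cnj (fourier_coeff g k) = integral {0..1} (\<lambda>x. cnj (of_real (g x) * e (- (of_int k * x))))"
    unfolding fourier_coeff_def by (rule Henstock_Kurzweil_Integration.integral_cnj)
  also have "\<dots> = fourier_coeff g (- k)"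
    by (simp add: fourier_coeff_def e_minus)
  finally show ?thesis by simp
qed

text \<open>The series converges uniformly to a continuous periodic s with the same coefficients as
  g, so \<open>fourier_zero_imp_zero\<close> applies to g - s. The frequencies k and - k are paired
  to keep every term real.\<close>

lemma fourier_series:
  fixes g :: "real \<Rightarrow> real"
  assumes cont: "continuous_on UNIV g" and per: "\<And>x. g (x + 1) = g x"
    and z: "fourier_coeff g 0 = 0"
    and sm: "summable (\<lambda>n. cmod (fourier_coeff g (int (Suc n))))"
  shows "(\<lambda>n. 2 * Re (fourier_coeff g (int (Suc n)) * e (real (Suc n) * x))) sums g x"
proof -
  define c where "c n = fourier_coeff g (int (Suc n))" for n
  define t where "t n x = 2 * Re (c n * e (real (Suc n) * x))" for n x
  define s where "s x = (\<Sum>n. t n x)" for x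
  have tb: "\<bar>t n x\<bar> \<le> 2 * cmod (c n)" for n x
    using abs_Re_le_cmod[of "c n * e (real (Suc n) * x)"] by (simp add: t_def norm_mult)
  have sm2: "summable (\<lambda>n. 2 * cmod (c n))" using sm by (intro summable_mult) (simp add: c_def)
  have ts: "summable (\<lambda>n. t n x)" for x
    by (rule summable_comparison_test'[OF sm2, of 0]) (use tb in simp)
  have ul: "uniform_limit UNIV (\<lambda>n x. \<Sum>i<n. t i x) s sequentially"
    unfolding s_def by (rule Weierstrass_m_test[OF _ sm2]) (use tb in simp)
  have ct: "continuous_on S (t n)" for n S
    unfolding t_def by (intro continuous_intros)
  have cs: "continuous_on UNIV s"
    by (rule uniform_limit_theorem[OF _ ul]) (auto intro!: always_eventually continuous_on_sum ct)
  have pt: "t n (x + 1) = t n x" for n x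
    using e_periodic[of "int (Suc n)" x] by (simp add: t_def)
  have ps: "s (x + 1) = s x" for x unfolding s_def pt ..
  have coef: "integral {0..1} (\<lambda>x. complex_of_real (t n x) * e (of_int k * x))
     = (if k = - int (Suc n) then c n else 0) + (if k = int (Suc n) then cnj (c n) else 0)" for n k
  proof -
    have eq: "(\<lambda>x. complex_of_real (t n x) * e (of_int k * x))
      = (\<lambda>x. c n * e (of_int (int (Suc n) + k) * x) + cnj (c n) * e (of_int (k - int (Suc n)) * x))"
    proof
      fix x
      have "complex_of_real (t n x) = c n * e (real (Suc n) * x) + cnj (c n * e (real (Suc n) * x))"
        by (simp only: t_def complex_add_cnj)
      also have "\<dots> = c n * e (real (Suc n) * x) + cnj (c n) * e (- (real (Suc n) * x))"
        by (simp add: e_minus)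
      finally have tx: "complex_of_real (t n x) = c n * e (real (Suc n) * x) + cnj (c n) * e (- (real (Suc n) * x))" .
      have "e (of_int (int (Suc n) + k) * x) = e (real (Suc n) * x) * e (of_int k * x)"
        "e (of_int (k - int (Suc n)) * x) = e (- (real (Suc n) * x)) * e (of_int k * x)"
        unfolding e_add[symmetric] by (simp_all add: algebra_simps)
      then show "complex_of_real (t n x) * e (of_int k * x) = c n * e (of_int (int (Suc n) + k) * x) + cnj (c n) * e (of_int (k - int (Suc n)) * x)"
        by (simp only: tx distrib_right mult.assoc)
    qed
    have "integral {0..1} (\<lambda>x. complex_of_real (t n x) * e (of_int k * x)) = c n * integral {0..1} (\<lambda>x. e (of_int (int (Suc n) + k) * x))
       + cnj (c n) * integral {0..1} (\<lambda>x. e (of_int (k - int (Suc n)) * x))"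
      unfolding eq by (subst Henstock_Kurzweil_Integration.integral_add)
        (auto simp: integral_mult_right simp del: of_nat_Suc intro!: integrable_continuous_real continuous_intros)
    also have "\<dots> = (if k = - int (Suc n) then c n else 0) + (if k = int (Suc n) then cnj (c n) else 0)"
      unfolding integral_e by auto
    finally show ?thesis .
  qed
  have gk: "integral {0..1} (\<lambda>x. complex_of_real (g x) * e (of_int k * x)) = fourier_coeff g (- k)" for k
    by (simp add: fourier_coeff_def)
  have sk: "integral {0..1} (\<lambda>x. complex_of_real (s x) * e (of_int k * x)) = fourier_coeff g (- k)" for k
  proof -
    have ul2: "uniform_limit {0..1} (\<lambda>n x. complex_of_real (\<Sum>i<n. t i x) * e (of_int k * x))
        (\<lambda>x. complex_of_real (s x) * e (of_int k * x)) sequentially"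
    proof (rule uniform_limitI)
      fix \<epsilon> :: real assume "\<epsilon> > 0"
      from uniform_limitD[OF ul this]
      show "\<forall>\<^sub>F n in sequentially. \<forall>x\<in>{0..1}. dist (complex_of_real (\<Sum>i<n. t i x) * e (of_int k * x)) (complex_of_real (s x) * e (of_int k * x)) < \<epsilon>"
        by eventually_elim
          (simp only: dist_norm left_diff_distrib[symmetric] norm_mult norm_e of_real_diff[symmetric] norm_of_real, simp)
    qed
    have co: "continuous_on {0..1} (\<lambda>x. complex_of_real (\<Sum>i<n. t i x) * e (of_int k * x))" for n
      by (intro continuous_intros ct)
    obtain I J where IJ: "\<And>n. ((\<lambda>x. complex_of_real (\<Sum>i<n. t i x) * e (of_int k * x)) has_integral I n) {0..1}"
      "((\<lambda>x. complex_of_real (s x) * e (of_int k * x)) has_integral J) {0..1}" "I \<longlonglongrightarrow> J"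
      using uniform_limit_integral[OF ul2] co by auto
    have In: "I n = (\<Sum>i<n. (if k = - int (Suc i) then c i else 0) + (if k = int (Suc i) then cnj (c i) else 0))" for n
    proof -
      have "I n = integral {0..1} (\<lambda>x. complex_of_real (\<Sum>i<n. t i x) * e (of_int k * x))"
        using IJ(1)[of n] by (simp add: integral_unique)
      also have "\<dots> = integral {0..1} (\<lambda>x. \<Sum>i<n. complex_of_real (t i x) * e (of_int k * x))"
        by (simp add: sum_distrib_right)
      also have "\<dots> = (\<Sum>i<n. integral {0..1} (\<lambda>x. complex_of_real (t i x) * e (of_int k * x)))"
        by (intro integral_sum integrable_continuous_real continuous_intros ct) auto
      finally show ?thesis unfolding coef .
    qed
    \<comment> \<open>The coefficient of the n-th partial sum is constant once n > |k|, so its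
      limit, which uniform convergence identifies with the coefficient of s, is this value.\<close>
    have "I n = fourier_coeff g (- k)" if n: "n > nat \<bar>k\<bar>" for n
    proof -
      consider "k = 0" | "k > 0" | "k < 0" by linarith
      then show ?thesis
      proof cases
        case 1
        then show ?thesis unfolding In using z by (auto intro!: sum.neutral)
      next
        case 2
        have "I n = (\<Sum>i<n. if i = nat k - 1 then cnj (c i) else 0)"
          unfolding In using 2 by (intro sum.cong) auto
        also have "\<dots> = cnj (c (nat k - 1))" using n 2 by (simp add: sum.delta')
        also have "\<dots> = fourier_coeff g (- k)" using 2 by (simp add: c_def fourier_coeff_uminus)
        finally show ?thesis .
      next
        case 3
        have "I n = (\<Sum>i<n. if i = nat (- k) - 1 then c i else 0)"
          unfolding In using 3 by (intro sum.cong) auto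
        also have "\<dots> = c (nat (- k) - 1)" using n 3 by (simp add: sum.delta')
        also have "\<dots> = fourier_coeff g (- k)" using 3 by (simp add: c_def)
        finally show ?thesis .
      qed
    qed
    then have "\<forall>\<^sub>F n in sequentially. I n = fourier_coeff g (- k)"
      by (rule eventually_mono[OF eventually_gt_at_top])
    then have "I \<longlonglongrightarrow> fourier_coeff g (- k)" by (rule tendsto_eventually)
    then have "J = fourier_coeff g (- k)" using IJ(3) LIMSEQ_unique by blast
    then show ?thesis using IJ(2) by (simp add: integral_unique)
  qed
  have "g x - s x = 0"
  proof (rule fourier_zero_imp_zero[of "\<lambda>x. g x - s x"])
    show "continuous_on UNIV (\<lambda>x. g x - s x)" by (intro continuous_intros cont cs)
    show "g (x + 1) - s (x + 1) = g x - s x" for x by (simp only: per ps)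
    have io: "(\<lambda>x. complex_of_real (h x) * e (of_int k * x)) integrable_on {0..1}" if "continuous_on UNIV h" for h k
      by (intro integrable_continuous_real continuous_intros continuous_on_subset[OF that]) auto
    show "integral {0..1} (\<lambda>x. complex_of_real (g x - s x) * e (of_int k * x)) = 0" for k
      using Henstock_Kurzweil_Integration.integral_diff[OF io[OF cont] io[OF cs], of k k]
      by (simp add: left_diff_distrib gk sk)
  qed
  moreover have "(\<lambda>n. t n x) sums s x" unfolding s_def by (intro summable_sums ts)
  ultimately show ?thesis by (simp add: t_def c_def)
qed

section \<open>Counting boxes\<close>

lemma interval_cover_le:
  fixes t :: "'a \<Rightarrow> real"
  assumes "finite S" "a \<le> b" "h \<ge> 0" and cov: "{a..b} \<subseteq> (\<Union>s\<in>S. {t s..t s + h})"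
  shows "b - a \<le> real (card S) * h"
proof -
  have "b - a = measure lborel {a..b}" using assms by simp
  also have "\<dots> \<le> measure lborel (\<Union>s\<in>S. {t s..t s + h})"
    using assms by (intro measure_mono_fmeasurable cov fmeasurable.finite_UN) (auto simp: fmeasurable_def)
  also have "\<dots> \<le> (\<Sum>s\<in>S. measure lborel {t s..t s + h})"
    using assms by (intro measure_UNION_le) auto
  also have "\<dots> = real (card S) * h" using assms by simp
  finally show ?thesis .
qed

text \<open>Separation makes i \<mapsto> \<open>\<lfloor>(x i - a) / h\<rfloor>\<close> injective on
  this set, and its only values are 0, 1 and 2.\<close>

lemma card_separated_le_3:
  fixes x :: "'a \<Rightarrow> real"
  assumes h: "h > 0" and sep: "\<And>i j. i \<in> I \<Longrightarrow> j \<in> I \<Longrightarrow> i \<noteq> j \<Longrightarrow> h \<le> \<bar>x i - x j\<bar>"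
  shows "card {i \<in> I. a \<le> x i \<and> x i \<le> a + 2 * h} \<le> 3"
proof -
  let ?f = "\<lambda>i. \<lfloor>(x i - a) / h\<rfloor>"
  have "inj_on ?f {i \<in> I. a \<le> x i \<and> x i \<le> a + 2 * h}"
  proof (rule inj_onI, rule ccontr)
    fix i j assume ij: "i \<in> {i \<in> I. a \<le> x i \<and> x i \<le> a + 2 * h}" "j \<in> {i \<in> I. a \<le> x i \<and> x i \<le> a + 2 * h}"
      "?f i = ?f j" "i \<noteq> j"
    then have "\<bar>(x i - a) / h - (x j - a) / h\<bar> < 1" by linarith
    moreover have "(x i - a) / h - (x j - a) / h = (x i - x j) / h" by (simp add: diff_divide_distrib)
    ultimately have "\<bar>x i - x j\<bar> < h" using h by (simp add: abs_divide)
    then show False using sep[of i j] ij by auto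
  qed
  then have "card {i \<in> I. a \<le> x i \<and> x i \<le> a + 2 * h} = card (?f ` {i \<in> I. a \<le> x i \<and> x i \<le> a + 2 * h})"
    by (simp add: card_image)
  also have "\<dots> \<le> card {0..2::int}"
  proof (intro card_mono)
    show "?f ` {i \<in> I. a \<le> x i \<and> x i \<le> a + 2 * h} \<subseteq> {0..2}"
    proof
      fix z assume "z \<in> ?f ` {i \<in> I. a \<le> x i \<and> x i \<le> a + 2 * h}"
      then obtain i where i: "z = ?f i" "a \<le> x i" "x i \<le> a + 2 * h" by auto
      have "0 \<le> (x i - a) / h" "(x i - a) / h \<le> 2" using i h by (auto simp: field_simps)
      then have "0 \<le> ?f i" "?f i \<le> 2" by linarith+
      then show "z \<in> {0..2}" using i by simp
    qed
  qed simp
  finally show ?thesis by simp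
qed

lemma mem_square_iff:
  fixes p :: "real \<times> real"
  shows "(u, v) \<in> cbox p (p + (h, h)) \<longleftrightarrow> fst p \<le> u \<and> u \<le> fst p + h \<and> snd p \<le> v \<and> v \<le> snd p + h"
  by (cases p) (auto simp: cbox_Pair_eq)

text \<open>
  Since the \<open>x i + h\<close> may exceed 1, the cover is first extended to the graph over \<open>[0, 2]\<close> by a
  translate; this costs a factor 2. The other factor 3 is the number of points near one box.
\<close>

lemma card_box_cover_ge:
  fixes f :: "real \<Rightarrow> real" and x :: "'a \<Rightarrow> real" and N :: nat
  defines "h \<equiv> 1 / real N"
  assumes cont: "continuous_on UNIV f" and per: "\<And>t. f (t + 1) = f t" and N: "N > 0"
    and I: "finite I" and x01: "\<And>i. i \<in> I \<Longrightarrow> 0 \<le> x i \<and> x i < 1"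
    and sep: "\<And>i j. i \<in> I \<Longrightarrow> j \<in> I \<Longrightarrow> i \<noteq> j \<Longrightarrow> h \<le> \<bar>x i - x j\<bar>"
    and P: "finite P" and cov: "graph_on_unit f \<subseteq> (\<Union>p\<in>P. cbox p (p + (h, h)))"
  shows "real N * (\<Sum>i\<in>I. \<bar>f (x i + h) - f (x i)\<bar>) \<le> 6 * real (card P)"
proof -
  have h: "0 < h" "h \<le> 1" using N by (auto simp: h_def)
  define P' where "P' = P \<union> (+) (1, 0) ` P"
  have P': "finite P'" using P by (simp add: P'_def)
  have cP': "card P' \<le> 2 * card P"
    unfolding P'_def using card_Un_le[of P "(+) (1, 0) ` P"] card_image_le[OF P, of "(+) (1, 0)"] by linarith
  have cov': "\<exists>p\<in>P'. (t, f t) \<in> cbox p (p + (h, h))" if t: "0 \<le> t" "t \<le> 2" for t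
  proof (cases "t \<le> 1")
    case True
    then have "(t, f t) \<in> graph_on_unit f" using t by (auto simp: graph_on_unit_def)
    then show ?thesis using cov by (auto simp: P'_def)
  next
    case False
    then have "(t - 1, f (t - 1)) \<in> graph_on_unit f" using t by (auto simp: graph_on_unit_def)
    then obtain p where p: "p \<in> P" "(t - 1, f (t - 1)) \<in> cbox p (p + (h, h))" using cov by blast
    have "f (t - 1) = f t" using per[of "t - 1"] by simp
    then have "(t, f t) \<in> cbox ((1, 0) + p) ((1, 0) + p + (h, h))"
      using p(2) unfolding mem_square_iff by auto
    moreover have "(1, 0) + p \<in> P'" using p(1) by (auto simp: P'_def)
    ultimately show ?thesis by blast
  qed
  \<comment> \<open>These are the boxes whose base meets [x i, x i + h]. By the intermediate value
    theorem their heights cover all values between f (x i) and f (x i + h), which bounds their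
    number from below.\<close>
  define Q where "Q i = {p \<in> P'. x i \<le> fst p + h \<and> fst p \<le> x i + h}" for i
  have step: "\<bar>f (x i + h) - f (x i)\<bar> \<le> real (card (Q i)) * h" if i: "i \<in> I" for i
  proof -
    define a where "a = min (f (x i)) (f (x i + h))"
    define b where "b = max (f (x i)) (f (x i + h))"
    have "{a..b} \<subseteq> (\<Union>p\<in>Q i. {snd p..snd p + h})"
    proof
      fix v assume v: "v \<in> {a..b}"
      have "\<exists>t\<ge>x i. t \<le> x i + h \<and> f t = v"
      proof (cases "f (x i) \<le> f (x i + h)")
        case True
        then show ?thesis using v h
          by (intro IVT') (auto simp: a_def b_def intro: continuous_on_subset[OF cont])
      next
        case False
        then show ?thesis using v h
          by (intro IVT2') (auto simp: a_def b_def intro: continuous_on_subset[OF cont])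
      qed
      then obtain t where t: "x i \<le> t" "t \<le> x i + h" "f t = v" by auto
      then obtain p where p: "p \<in> P'" "(t, f t) \<in> cbox p (p + (h, h))"
        using cov'[of t] x01[OF i] h by auto
      then have "p \<in> Q i" "v \<in> {snd p..snd p + h}"
        using t unfolding mem_square_iff Q_def by auto
      then show "v \<in> (\<Union>p\<in>Q i. {snd p..snd p + h})" by blast
    qed
    then have "b - a \<le> real (card (Q i)) * h"
      using h P' by (intro interval_cover_le) (auto simp: a_def b_def Q_def)
    then show ?thesis by (simp add: a_def b_def min_def max_def split: if_splits)
  qed
  have three: "card {i \<in> I. x i \<le> fst p + h \<and> fst p \<le> x i + h} \<le> 3" for p :: "real \<times> real"
  proof -
    have "{i \<in> I. x i \<le> fst p + h \<and> fst p \<le> x i + h} = {i \<in> I. (fst p - h) \<le> x i \<and> x i \<le> (fst p - h) + 2 * h}"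
      by auto
    then show ?thesis using card_separated_le_3[OF h(1) sep, where a = "fst p - h"] by simp
  qed
  \<comment> \<open>The pairs of a point and a nearby box are counted a second time, now box by
    box.\<close>
  have "(\<Sum>i\<in>I. card (Q i)) = card (SIGMA i:I. Q i)"
    using I P' by (subst card_SigmaI) (auto simp: Q_def)
  also have "\<dots> = card (SIGMA p:P'. {i \<in> I. x i \<le> fst p + h \<and> fst p \<le> x i + h})"
    by (rule bij_betw_same_card[of prod.swap]) (auto simp: bij_betw_def inj_on_def Q_def image_iff)
  also have "\<dots> = (\<Sum>p\<in>P'. card {i \<in> I. x i \<le> fst p + h \<and> fst p \<le> x i + h})"
    using I P' by (subst card_SigmaI) auto
  also have "\<dots> \<le> (\<Sum>p\<in>P'. 3)" by (intro sum_mono three)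
  also have "\<dots> \<le> 6 * card P" using cP' by simp
  finally have "real (\<Sum>i\<in>I. card (Q i)) \<le> real (6 * card P)" by (simp only: of_nat_le_iff)
  then have cardQ: "(\<Sum>i\<in>I. real (card (Q i))) \<le> 6 * real (card P)" by simp
  have "real N * (\<Sum>i\<in>I. \<bar>f (x i + h) - f (x i)\<bar>) \<le> real N * (\<Sum>i\<in>I. real (card (Q i)) * h)"
    by (intro mult_left_mono sum_mono step) auto
  also have "\<dots> = (\<Sum>i\<in>I. real (card (Q i)))"
    using N by (simp add: h_def sum_divide_distrib[symmetric])
  finally show ?thesis using cardQ by simp
qed

text \<open>Compactness supplies a finite cover, so the infimum in \<open>box_count\<close> is
  attained by an actual cover and is not the default value 0 of the empty set.\<close>

lemma box_count_ge:
  fixes f :: "real \<Rightarrow> real" and x :: "'a \<Rightarrow> real" and N :: nat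
  assumes cont: "continuous_on UNIV f" and per: "\<And>t. f (t + 1) = f t" and N: "N > 0"
    and I: "finite I" and x01: "\<And>i. i \<in> I \<Longrightarrow> 0 \<le> x i \<and> x i < 1"
    and sep: "\<And>i j. i \<in> I \<Longrightarrow> j \<in> I \<Longrightarrow> i \<noteq> j \<Longrightarrow> 1 / real N \<le> \<bar>x i - x j\<bar>"
  shows "real N * (\<Sum>i\<in>I. \<bar>f (x i + 1 / real N) - f (x i)\<bar>) \<le> 6 * real (box_count (graph_on_unit f) N)"
proof -
  let ?h = "1 / real N"
  let ?K = "{card P | P. finite P \<and> graph_on_unit f \<subseteq> (\<Union>p\<in>P. cbox p (p + (?h, ?h)))}"
  have h: "?h > 0" using N by simp
  have comp: "compact (graph_on_unit f)" unfolding graph_on_unit_def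
    by (intro compact_continuous_image continuous_intros continuous_on_subset[OF cont]) auto
  have cov: "graph_on_unit f \<subseteq> (\<Union>z\<in>graph_on_unit f. box (z - (?h / 2, ?h / 2)) (z + (?h / 2, ?h / 2)))"
  proof
    fix z assume "z \<in> graph_on_unit f"
    moreover have "z \<in> box (z - (?h / 2, ?h / 2)) (z + (?h / 2, ?h / 2))"
      using h by (cases z) (auto simp: mem_box Basis_prod_def)
    ultimately show "z \<in> (\<Union>z\<in>graph_on_unit f. box (z - (?h / 2, ?h / 2)) (z + (?h / 2, ?h / 2)))" by blast
  qed
  obtain D where D: "D \<subseteq> graph_on_unit f" "finite D"
    "graph_on_unit f \<subseteq> (\<Union>z\<in>D. box (z - (?h / 2, ?h / 2)) (z + (?h / 2, ?h / 2)))"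
    using compactE_image[OF comp open_box cov] by blast
  have "box (z - (?h / 2, ?h / 2)) (z + (?h / 2, ?h / 2)) \<subseteq> cbox (z - (?h / 2, ?h / 2)) (z - (?h / 2, ?h / 2) + (?h, ?h))" for z
    by (cases z) (auto simp: mem_box Basis_prod_def)
  then have "graph_on_unit f \<subseteq> (\<Union>p\<in>(\<lambda>z. z - (?h / 2, ?h / 2)) ` D. cbox p (p + (?h, ?h)))"
    using D(3) by (simp only: image_image UN_simps) blast
  then have "?K \<noteq> {}" using D(2) by blast
  then have "box_count (graph_on_unit f) N \<in> ?K"
    unfolding box_count_def by (rule Inf_nat_def1)
  then obtain P where "finite P" "graph_on_unit f \<subseteq> (\<Union>p\<in>P. cbox p (p + (?h, ?h)))"
    "box_count (graph_on_unit f) N = card P" by blast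
  then show ?thesis using card_box_cover_ge[OF cont per N I x01 sep, where P = P] by simp
qed

section \<open>The difference functional\<close>

text \<open>What remains after the first J values of j is at most \<open>suminf u\<close> times the
  tail of v from J on, which tends to 0.\<close>

lemma suminf_swap_dominated:
  fixes a :: "nat \<Rightarrow> nat \<Rightarrow> complex" and u v :: "nat \<Rightarrow> real"
  assumes u: "summable u" and v: "summable v" and b: "\<And>n j. cmod (a n j) \<le> u n * v j"
    and u0: "\<And>n. u n \<ge> 0"
  shows "(\<lambda>j. \<Sum>n. a n j) sums (\<Sum>n. \<Sum>j. a n j)"
proof -
  have sn: "summable (\<lambda>j. cmod (a n j))" for n
    by (rule summable_comparison_test'[OF summable_mult[OF v, of "u n"]]) (use b in simp)
  have sj: "summable (\<lambda>n. a n j)" for j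
    by (rule summable_comparison_test'[OF summable_mult2[OF u, of "v j"]]) (use b in simp)
  define r where "r J = (\<Sum>j. v (j + J))" for J
  have tail: "cmod (\<Sum>j. a n (j + J)) \<le> u n * r J" for n J
  proof -
    have "cmod (\<Sum>j. a n (j + J)) \<le> (\<Sum>j. u n * v (j + J))"
      by (intro norm_suminf_le b summable_mult summable_ignore_initial_segment v)
    also have "\<dots> = u n * r J" unfolding r_def
      by (intro suminf_mult summable_ignore_initial_segment v)
    finally show ?thesis .
  qed
  have st: "summable (\<lambda>n. \<Sum>j. a n (j + J))" for J
    by (rule summable_comparison_test'[OF summable_mult2[OF u, of "r J"]]) (use tail in simp)
  have diff: "(\<Sum>n. \<Sum>j. a n j) - (\<Sum>j<J. \<Sum>n. a n j) = (\<Sum>n. \<Sum>j. a n (j + J))" for J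
  proof -
    have "(\<Sum>n. \<Sum>j. a n j) - (\<Sum>j<J. \<Sum>n. a n j) = (\<Sum>n. \<Sum>j. a n j) - (\<Sum>n. \<Sum>j<J. a n j)"
      by (simp add: suminf_sum sj)
    also have "\<dots> = (\<Sum>n. (\<Sum>j. a n j) - (\<Sum>j<J. a n j))"
      using st[of 0] by (intro suminf_diff summable_sum sj) simp
    also have "\<dots> = (\<Sum>n. \<Sum>j. a n (j + J))"
      by (simp only: suminf_split_initial_segment[OF summable_norm_cancel[OF sn], of _ J] add_diff_cancel)
    finally show ?thesis .
  qed
  have r0: "r \<longlonglongrightarrow> 0"
  proof -
    have "r = (\<lambda>J. suminf v - (\<Sum>j<J. v j))"
      unfolding r_def by (intro ext suminf_minus_initial_segment v)
    moreover have "(\<lambda>J. suminf v - (\<Sum>j<J. v j)) \<longlonglongrightarrow> suminf v - suminf v"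
      by (intro tendsto_intros summable_LIMSEQ v)
    ultimately show ?thesis by simp
  qed
  have "(\<lambda>J. (\<Sum>n. \<Sum>j. a n j) - (\<Sum>j<J. \<Sum>n. a n j)) \<longlonglongrightarrow> 0"
  proof (rule Lim_null_comparison)
    show "\<forall>\<^sub>F J in sequentially. cmod ((\<Sum>n. \<Sum>j. a n j) - (\<Sum>j<J. \<Sum>n. a n j)) \<le> suminf u * r J"
    proof (intro always_eventually allI)
      fix J
      have "cmod (\<Sum>n. \<Sum>j. a n (j + J)) \<le> (\<Sum>n. u n * r J)"
        by (intro norm_suminf_le tail summable_mult2 u)
      also have "\<dots> = suminf u * r J" by (rule suminf_mult2[OF u, symmetric])
      finally show "cmod ((\<Sum>n. \<Sum>j. a n j) - (\<Sum>j<J. \<Sum>n. a n j)) \<le> suminf u * r J" unfolding diff .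
    qed
    show "(\<lambda>J. suminf u * r J) \<longlonglongrightarrow> 0"
      using tendsto_mult_left[OF r0, of "suminf u"] by simp
  qed
  then have "(\<lambda>J. (\<Sum>n. \<Sum>j. a n j) - ((\<Sum>n. \<Sum>j. a n j) - (\<Sum>j<J. \<Sum>n. a n j))) \<longlonglongrightarrow> (\<Sum>n. \<Sum>j. a n j) - 0"
    by (intro tendsto_intros)
  then show ?thesis by (simp add: sums_def)
qed

text \<open>
  The contribution of the Fourier mode \<open>k\<close> of \<open>g\<close> to a linear functional of the increment of the
  series over \<open>h\<close>, where \<open>\<Lambda> l\<close> is the value of the functional at \<open>x \<mapsto> e (l x)\<close>.
\<close>

definition lac :: "real \<Rightarrow> (int \<Rightarrow> complex) \<Rightarrow> real \<Rightarrow> int \<Rightarrow> complex" where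
  "lac \<delta> \<Lambda> h k = (\<Sum>n. incr \<delta> (of_int k * h) n * \<Lambda> (k * (int (Suc n))\<^sup>2))"

text \<open>The coefficient \<open>C j\<close> belongs to the frequency j + 1; negative frequencies
  enter through conjugates because g is real.\<close>

locale lacunary_series =
  fixes \<delta> :: real and g :: "real \<Rightarrow> real" and C :: "nat \<Rightarrow> complex"
  assumes \<delta>: "0 < \<delta>" "\<delta> \<le> 1"
    and cont: "continuous_on UNIV g" and per: "\<And>x. g (x + 1) = g x"
    and zero: "fourier_coeff g 0 = 0"
  defines "C \<equiv> \<lambda>j. fourier_coeff g (int (Suc j))"
  assumes summ: "summable (\<lambda>j. cmod (C j) * real (Suc j) powr (\<delta> / 2))"
begin

abbreviation "G \<equiv> G_delta \<delta> g"

lemma summable_norm_C: "summable (\<lambda>j. cmod (C j))"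
proof (rule summable_comparison_test'[OF summ, of 0])
  fix j
  have "cmod (C j) * 1 \<le> cmod (C j) * real (Suc j) powr (\<delta> / 2)"
    using \<delta> by (intro mult_left_mono ge_one_powr_ge_zero) auto
  then show "norm (cmod (C j)) \<le> cmod (C j) * real (Suc j) powr (\<delta> / 2)" by simp
qed

lemma g_sums: "(\<lambda>j. C j * e (real (Suc j) * x) + cnj (C j) * e (- (real (Suc j) * x))) sums complex_of_real (g x)"
proof -
  have "(\<lambda>j. complex_of_real (2 * Re (C j * e (real (Suc j) * x)))) sums complex_of_real (g x)"
    using fourier_series[OF cont per zero summable_norm_C[unfolded C_def], of x]
    by (intro sums_of_real) (simp only: C_def)
  moreover have "complex_of_real (2 * Re (C j * e (real (Suc j) * x)))
     = C j * e (real (Suc j) * x) + cnj (C j) * e (- (real (Suc j) * x))" for j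
    by (simp only: complex_add_cnj[symmetric] complex_cnj_mult e_minus)
  ultimately show ?thesis by (simp only:)
qed

lemma g_bounded: obtains B where "\<And>x. \<bar>g x\<bar> \<le> B"
proof -
  have "compact (g ` {0..1})" by (intro compact_continuous_image continuous_on_subset[OF cont]) auto
  then have "bounded (g ` {0..1})" by (rule compact_imp_bounded)
  then obtain B where "\<forall>y\<in>g ` {0..1}. norm y \<le> B" unfolding bounded_iff by blast
  then have B: "\<bar>g x\<bar> \<le> B" if "x \<in> {0..1}" for x using that by simp
  have "\<bar>g x\<bar> \<le> B" for x
  proof -
    have "g x = g (frac x + of_int \<lfloor>x\<rfloor>)" by (simp add: frac_def)
    also have "\<dots> = g (frac x)" by (rule periodic_add_of_int[of g, OF per])
    finally show ?thesis using B[of "frac x"] by (simp add: frac_lt_1 less_imp_le)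
  qed
  then show thesis by (rule that)
qed

lemma G_sums: "(\<lambda>n. wt \<delta> n * g ((real (Suc n))\<^sup>2 * x)) sums G x"
proof -
  obtain B where B: "\<And>x. \<bar>g x\<bar> \<le> B" using g_bounded by blast
  have eq: "g ((real (Suc n))\<^sup>2 * x) / real (Suc n) powr (1 + \<delta>) = wt \<delta> n * g ((real (Suc n))\<^sup>2 * x)" for n
    unfolding wt_def powr_minus by (simp only: divide_inverse mult.commute)
  have "summable (\<lambda>n. wt \<delta> n * g ((real (Suc n))\<^sup>2 * x))"
    by (rule summable_comparison_test'[OF summable_mult2[OF summable_wt[OF \<delta>], of B], of 0])
      (use B in \<open>simp add: abs_mult mult_left_mono\<close>)
  then show ?thesis unfolding G_delta_def eq by (rule summable_sums)
qed

lemma continuous_G: "continuous_on UNIV G"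
proof -
  obtain B where B: "\<And>x. \<bar>g x\<bar> \<le> B" using g_bounded by blast
  have ul: "uniform_limit UNIV (\<lambda>N x. \<Sum>n<N. wt \<delta> n * g ((real (Suc n))\<^sup>2 * x)) (\<lambda>x. \<Sum>n. wt \<delta> n * g ((real (Suc n))\<^sup>2 * x)) sequentially"
    by (rule Weierstrass_m_test[OF _ summable_mult2[OF summable_wt[OF \<delta>], of B]])
      (use B in \<open>simp add: abs_mult mult_left_mono\<close>)
  have "G = (\<lambda>x. \<Sum>n. wt \<delta> n * g ((real (Suc n))\<^sup>2 * x))"
    using G_sums by (auto simp: sums_iff)
  moreover have "continuous_on UNIV (\<lambda>x. \<Sum>n. wt \<delta> n * g ((real (Suc n))\<^sup>2 * x))"
    by (rule uniform_limit_theorem[OF _ ul])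
      (auto intro!: always_eventually continuous_intros continuous_on_compose2[OF cont])
  ultimately show ?thesis by simp
qed

lemma periodic_G: "G (x + 1) = G x"
proof -
  have "g ((real (Suc n))\<^sup>2 * (x + 1)) = g ((real (Suc n))\<^sup>2 * x)" for n
  proof -
    have "(real (Suc n))\<^sup>2 * (x + 1) = (real (Suc n))\<^sup>2 * x + of_int (int (Suc n)^2)"
      by (simp add: distrib_left)
    then show ?thesis by (simp only: periodic_add_of_int[of g, OF per])
  qed
  then show ?thesis by (simp only: G_delta_def)
qed

text \<open>Inserting the Fourier series of g into each term of G gives a double series over n and
  the frequencies k, in which the functional enters only through \<Lambda> (k N^2) with N = n + 1.
  Domination by \<open>wt \<delta> n * (4 * B * cmod (C j))\<close> permits summing over n first,
  which groups the terms by k.\<close>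

lemma functional_expansion:
  fixes \<omega> :: "'a \<Rightarrow> complex" and x :: "'a \<Rightarrow> real" and \<Lambda> :: "int \<Rightarrow> complex"
  assumes S: "finite S" and \<Lambda>: "\<And>l. (\<Sum>s\<in>S. \<omega> s * e (of_int l * x s)) = \<Lambda> l"
  shows "(\<lambda>j. C j * lac \<delta> \<Lambda> h (int (Suc j)) + cnj (C j) * lac \<delta> \<Lambda> h (- int (Suc j))) sums
    (\<Sum>s\<in>S. \<omega> s * of_real (G (x s + h) - G (x s)))"
proof -
  define B where "B = (\<Sum>s\<in>S. cmod (\<omega> s))"
  have \<Lambda>b: "cmod (\<Lambda> l) \<le> B" for l
    unfolding \<Lambda>[symmetric] B_def by (intro sum_norm_le) (simp add: norm_mult)
  have B0: "B \<ge> 0" unfolding B_def by (intro sum_nonneg) auto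
  define a where "a n j = C j * (incr \<delta> (real (Suc j) * h) n * \<Lambda> (int (Suc j) * (int (Suc n))\<^sup>2))
    + cnj (C j) * (incr \<delta> (- real (Suc j) * h) n * \<Lambda> (- int (Suc j) * (int (Suc n))\<^sup>2))" for n j
  have inb: "cmod (incr \<delta> y n * \<Lambda> l) \<le> 2 * B * wt \<delta> n" for y n l
    using mult_mono[OF norm_incr_le[of \<delta> y n] \<Lambda>b[of l]] B0 by (simp add: norm_mult mult_ac)
  have ab: "cmod (a n j) \<le> wt \<delta> n * (4 * B * cmod (C j))" for n j
  proof -
    have "cmod (a n j) \<le> cmod (C j) * (2 * B * wt \<delta> n) + cmod (C j) * (2 * B * wt \<delta> n)"
      unfolding a_def by (rule norm_triangle_le, rule add_mono)
        (auto simp only: norm_mult[of "C j"] norm_mult[of "cnj (C j)"] complex_mod_cnj intro!: mult_left_mono inb norm_ge_zero)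
    then show ?thesis by (simp add: mult_ac)
  qed
  have key: "(\<lambda>j. a n j) sums (\<Sum>s\<in>S. \<omega> s * of_real (wt \<delta> n * g ((real (Suc n))\<^sup>2 * (x s + h)) - wt \<delta> n * g ((real (Suc n))\<^sup>2 * x s)))" for n
  proof -
    let ?N = "(real (Suc n))\<^sup>2"
    let ?t = "\<lambda>j y. C j * e (real (Suc j) * y) + cnj (C j) * e (- (real (Suc j) * y))"
    have "(\<lambda>j. \<Sum>s\<in>S. \<omega> s * (of_real (wt \<delta> n) * (?t j (?N * (x s + h)) - ?t j (?N * x s)))) sums
      (\<Sum>s\<in>S. \<omega> s * (of_real (wt \<delta> n) * (of_real (g (?N * (x s + h))) - of_real (g (?N * x s)))))"
      by (intro sums_sum sums_mult sums_diff g_sums)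
    moreover have "(\<Sum>s\<in>S. \<omega> s * (of_real (wt \<delta> n) * (?t j (?N * (x s + h)) - ?t j (?N * x s)))) = a n j" for j
    proof -
      have shift: "e (of_int k * (?N * (y + h))) - e (of_int k * (?N * y)) = (e (?N * (of_int k * h)) - 1) * e (of_int (k * (int (Suc n))\<^sup>2) * y)" for k y
      proof -
        have "of_int k * (?N * (y + h)) = ?N * (of_int k * h) + of_int (k * (int (Suc n))\<^sup>2) * y"
          "of_int k * (?N * y) = of_int (k * (int (Suc n))\<^sup>2) * y"
          by (simp_all add: algebra_simps)
        then show ?thesis by (simp only: e_add) (simp add: algebra_simps)
      qed
      have sp: "of_real (wt \<delta> n) * (e (real (Suc j) * (?N * (y + h))) - e (real (Suc j) * (?N * y)))
          = incr \<delta> (real (Suc j) * h) n * e (of_int (int (Suc j) * (int (Suc n))\<^sup>2) * y)" for y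
        using shift[of "int (Suc j)" y] by (simp only: incr_def of_int_of_nat_eq mult.assoc)
      have sm: "of_real (wt \<delta> n) * (e (- (real (Suc j) * (?N * (y + h)))) - e (- (real (Suc j) * (?N * y))))
          = incr \<delta> (- real (Suc j) * h) n * e (of_int (- int (Suc j) * (int (Suc n))\<^sup>2) * y)" for y
        using shift[of "- int (Suc j)" y] by (simp only: incr_def of_int_of_nat_eq of_int_minus mult_minus_left mult.assoc)
      have "\<omega> s * (of_real (wt \<delta> n) * (?t j (?N * (x s + h)) - ?t j (?N * x s)))
        = C j * (incr \<delta> (real (Suc j) * h) n * (\<omega> s * e (of_int (int (Suc j) * (int (Suc n))\<^sup>2) * x s)))
        + cnj (C j) * (incr \<delta> (- real (Suc j) * h) n * (\<omega> s * e (of_int (- int (Suc j) * (int (Suc n))\<^sup>2) * x s)))" for s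
      proof -
        have "\<omega> s * (of_real (wt \<delta> n) * (?t j (?N * (x s + h)) - ?t j (?N * x s)))
          = C j * (\<omega> s * (of_real (wt \<delta> n) * (e (real (Suc j) * (?N * (x s + h))) - e (real (Suc j) * (?N * x s)))))
          + cnj (C j) * (\<omega> s * (of_real (wt \<delta> n) * (e (- (real (Suc j) * (?N * (x s + h)))) - e (- (real (Suc j) * (?N * x s))))))"
          by (simp add: algebra_simps)
        then show ?thesis unfolding sp sm by (simp only: mult.left_commute)
      qed
      then show ?thesis
        by (simp only: sum.distrib sum_distrib_left[symmetric] \<Lambda> a_def)
    qed
    ultimately show ?thesis by (simp add: right_diff_distrib)
  qed
  have "(\<lambda>j. \<Sum>n. a n j) sums (\<Sum>n. \<Sum>j. a n j)"
    by (rule suminf_swap_dominated[OF summable_wt[OF \<delta>] summable_mult[OF summable_norm_C, of "4 * B"] ab]) simp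
  moreover have "(\<Sum>n. \<Sum>j. a n j) = (\<Sum>s\<in>S. \<omega> s * of_real (G (x s + h) - G (x s)))"
  proof -
    have "(\<lambda>n. \<Sum>s\<in>S. \<omega> s * of_real (wt \<delta> n * g ((real (Suc n))\<^sup>2 * (x s + h)) - wt \<delta> n * g ((real (Suc n))\<^sup>2 * x s)))
      sums (\<Sum>s\<in>S. \<omega> s * of_real (G (x s + h) - G (x s)))"
      by (intro sums_sum sums_mult sums_of_real sums_diff G_sums)
    then show ?thesis using key by (simp add: sums_iff)
  qed
  moreover have "(\<Sum>n. a n j) = C j * lac \<delta> \<Lambda> h (int (Suc j)) + cnj (C j) * lac \<delta> \<Lambda> h (- int (Suc j))" for j
  proof -
    have s: "summable (\<lambda>n. incr \<delta> y n * \<Lambda> (l n))" for y l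
      by (rule wt_tail_bounded_le(1)[OF \<delta> inb])
    show ?thesis unfolding a_def lac_def of_int_minus of_int_of_nat_eq
      by (simp only: suminf_add[OF summable_mult[OF s] summable_mult[OF s], symmetric] suminf_mult[OF s])
  qed
  ultimately show ?thesis by simp
qed

end

section \<open>Size and asymptotics of the contribution of a single mode\<close>

lemma summable_incr_mult:
  assumes \<delta>: "0 < \<delta>" "\<delta> \<le> 1" and b: "\<And>l. cmod (\<Lambda> l) \<le> 1"
  shows "summable (\<lambda>n. incr \<delta> y n * \<Lambda> (l n))"
proof (rule wt_tail_bounded_le(1)[OF \<delta>])
  show "cmod (incr \<delta> y n * \<Lambda> (l n)) \<le> 2 * wt \<delta> n" for n
    using mult_mono[OF norm_incr_le[of \<delta> y n] b[of "l n"]] by (simp add: norm_mult)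
qed

lemma norm_lac_multiples_le:
  assumes \<delta>: "0 < \<delta>" "\<delta> \<le> 1" and b: "\<And>l. cmod (\<Lambda> l) \<le> 1" and R: "R > 0"
    and supp: "\<And>n. \<Lambda> (k * (int n)\<^sup>2) \<noteq> 0 \<Longrightarrow> R dvd n" and h: "h > 0"
  shows "cmod (lac \<delta> \<Lambda> h k) \<le> (2 * pi + 8 / \<delta>) / real R * (of_int \<bar>k\<bar> powr (\<delta> / 2) * h powr (\<delta> / 2))"
proof -
  let ?y = "of_int k * h"
  have "cmod (lac \<delta> \<Lambda> h k) \<le> (\<Sum>n. if R dvd Suc n then cmod (incr \<delta> ?y n) else 0)"
    unfolding lac_def
  proof (intro norm_suminf_le suminf_multiples_norm_incr_le(1) \<delta> R)
    fix n
    show "cmod (incr \<delta> ?y n * \<Lambda> (k * (int (Suc n))\<^sup>2)) \<le> (if R dvd Suc n then cmod (incr \<delta> ?y n) else 0)"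
    proof (cases "R dvd Suc n")
      case True
      then show ?thesis using mult_left_mono[OF b, of "cmod (incr \<delta> ?y n)" "k * (int (Suc n))\<^sup>2"]
        by (simp add: norm_mult del: of_nat_Suc)
    next
      case False
      then have "\<Lambda> (k * (int (Suc n))\<^sup>2) = 0" using supp[of "Suc n"] by blast
      then show ?thesis by simp
    qed
  qed
  also have "\<dots> \<le> (2 * pi + 8 / \<delta>) / real R * \<bar>?y\<bar> powr (\<delta> / 2)"
    by (rule suminf_multiples_norm_incr_le(2)[OF \<delta> R])
  also have "\<bar>?y\<bar> powr (\<delta> / 2) = of_int \<bar>k\<bar> powr (\<delta> / 2) * h powr (\<delta> / 2)"
    using h by (simp add: abs_mult powr_mult)
  finally show ?thesis .
qed

lemma norm_lac_le:
  assumes "0 < \<delta>" "\<delta> \<le> 1" "\<And>l. cmod (\<Lambda> l) \<le> 1" "h > 0"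
  shows "cmod (lac \<delta> \<Lambda> h k) \<le> (2 * pi + 8 / \<delta>) * (of_int \<bar>k\<bar> powr (\<delta> / 2) * h powr (\<delta> / 2))"
  using norm_lac_multiples_le[of \<delta> \<Lambda> 1 k h] assms by simp

text \<open>Half the difference of the multipliers is bounded by 1 and vanishes at k n^2 unless R
  dvd n, so \<open>norm_lac_multiples_le\<close> applies to it.\<close>

lemma norm_lac_diff_le:
  assumes \<delta>: "0 < \<delta>" "\<delta> \<le> 1" and b: "\<And>l. cmod (\<Lambda> l) \<le> 1" and b': "\<And>l. cmod (\<Lambda>' l) \<le> 1" and R: "R > 0"
    and supp: "\<And>n. \<not> R dvd n \<Longrightarrow> \<Lambda> (k * (int n)\<^sup>2) = \<Lambda>' (k * (int n)\<^sup>2)" and h: "h > 0"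
  shows "cmod (lac \<delta> \<Lambda> h k - lac \<delta> \<Lambda>' h k) \<le> 2 * ((2 * pi + 8 / \<delta>) / real R * (of_int \<bar>k\<bar> powr (\<delta> / 2) * h powr (\<delta> / 2)))"
proof -
  define L where "L l = (\<Lambda> l - \<Lambda>' l) / 2" for l
  have bL: "cmod (L l) \<le> 1" for l
    using norm_triangle_ineq4[of "\<Lambda> l" "\<Lambda>' l"] b[of l] b'[of l] by (simp add: L_def norm_divide)
  have L2: "2 * (x * L l) = x * \<Lambda> l - x * \<Lambda>' l" for x l
    by (simp add: L_def right_diff_distrib diff_divide_distrib)
  have "lac \<delta> \<Lambda> h k - lac \<delta> \<Lambda>' h k = (\<Sum>n. 2 * (incr \<delta> (of_int k * h) n * L (k * (int (Suc n))\<^sup>2)))"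
    unfolding lac_def
    unfolding L2 by (rule suminf_diff[OF summable_incr_mult[OF \<delta> b] summable_incr_mult[OF \<delta> b']])
  also have "\<dots> = 2 * lac \<delta> L h k"
    unfolding lac_def by (rule suminf_mult[OF summable_incr_mult[OF \<delta> bL]])
  finally have "cmod (lac \<delta> \<Lambda> h k - lac \<delta> \<Lambda>' h k) = 2 * cmod (lac \<delta> L h k)" by (simp add: norm_mult)
  moreover have "cmod (lac \<delta> L h k) \<le> (2 * pi + 8 / \<delta>) / real R * (of_int \<bar>k\<bar> powr (\<delta> / 2) * h powr (\<delta> / 2))"
    using supp by (intro norm_lac_multiples_le \<delta> bL R h) (auto simp: L_def)
  ultimately show ?thesis by simp
qed

lemma norm_gauss_mean_le: "q > 0 \<Longrightarrow> cmod (gauss_mean t q) \<le> 1"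
proof -
  assume q: "q > 0"
  have "cmod (\<Sum>n=1..q. e (of_int t * (real n)\<^sup>2 / real q)) \<le> (\<Sum>n=1..q. 1)"
    by (intro sum_norm_le) simp
  then show ?thesis using q by (simp add: gauss_mean_def norm_divide)
qed

text \<open>Since k n^2 = d (m n)^2, the sum runs over the multiples of m with y = d h, and
  \<open>periodic_mean_incr\<close> applies to \<rho>. The factor with \<open>Phi\<close> depends on
  k only through d; being common to the whole square class, it lets the contributions add up to
  \<open>S_sum\<close>.\<close>

lemma lac_square_asymp:
  fixes d m q a :: nat
  assumes \<delta>: "0 < \<delta>" "\<delta> \<le> 1" and d: "d > 0" and m: "m > 0" and q: "q > 0"
  defines "k \<equiv> d * m\<^sup>2"
  obtains C where "C > 0" "\<And>h. 0 < h \<Longrightarrow> real d * h \<le> 1 \<Longrightarrow>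
    cmod (lac \<delta> (\<lambda>l. e (of_int l * (real a / real q))) h (int k)
      - real k powr (\<delta> / 2) * (Phi \<delta> (real d * h) * of_real (real d powr - (\<delta> / 2))) * gauss_mean (int k * int a) q) \<le> C * h powr (5 * \<delta> / 8)"
proof -
  define \<rho> where "\<rho> N = (if m dvd N then e (real d * (real N)\<^sup>2 * (real a / real q)) else 0)" for N
  have per: "\<rho> (N + m * q) = \<rho> N" for N
  proof -
    have "real d * (real (N + m * q))\<^sup>2 * (real a / real q)
      = real d * (real N)\<^sup>2 * (real a / real q) + of_int (int (d * a * (2 * N * m + m * m * q)))"
      using q by (simp add: field_simps power2_eq_square)
    then have "e (real d * (real (N + m * q))\<^sup>2 * (real a / real q)) = e (real d * (real N)\<^sup>2 * (real a / real q))"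
      by (simp only: e_add_int)
    moreover have "m dvd N + m * q \<longleftrightarrow> m dvd N" by (simp add: dvd_add_left_iff)
    ultimately show ?thesis by (simp add: \<rho>_def)
  qed
  have b: "cmod (\<rho> N) \<le> 1" for N by (simp add: \<rho>_def)
  have mq: "m * q > 0" using m q by simp
  obtain C0 where C0: "C0 > 0" "\<And>y. 0 < y \<Longrightarrow> y \<le> 1 \<Longrightarrow>
      cmod ((\<Sum>n. \<rho> (Suc n) * incr \<delta> y n) - (\<Sum>n=1..m * q. \<rho> n) / of_nat (m * q) * Phi \<delta> y) \<le> C0 * y powr (5 * \<delta> / 8)"
    using periodic_mean_incr[where \<rho> = \<rho>, OF \<delta> mq per b] by blast
  \<comment> \<open>Only the multiples of m up to m q count. They give one full period of the Gauss
    sum modulo q, hence the extra 1 / m.\<close>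
  have mean: "(\<Sum>n=1..m * q. \<rho> n) / of_nat (m * q) = gauss_mean (int k * int a) q / of_nat m"
  proof -
    have "(\<Sum>n=1..m * q. \<rho> n) = (\<Sum>n\<in>{n\<in>{1..m * q}. m dvd n}. e (real d * (real n)\<^sup>2 * (real a / real q)))"
      unfolding \<rho>_def by (rule sum.inter_filter[symmetric]) simp
    also have "\<dots> = (\<Sum>n=1..q. e (of_int (int k * int a) * (real n)\<^sup>2 / real q))"
    proof (rule sum.reindex_bij_witness[of _ "\<lambda>n. m * n" "\<lambda>n. n div m"])
      fix n assume "n \<in> {n \<in> {1..m * q}. m dvd n}"
      then obtain j where j: "n = m * j" "1 \<le> n" "n \<le> m * q" by (auto elim!: dvdE)
      then show "m * (n div m) = n" by simp
      have "j \<le> q" using j m by simp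
      moreover have "j \<ge> 1" using j by (cases j) auto
      ultimately show "n div m \<in> {1..q}" using j m by simp
      show "e (of_int (int k * int a) * (real (n div m))\<^sup>2 / real q) = e (real d * (real n)\<^sup>2 * (real a / real q))"
        using j m by (intro arg_cong[of _ _ e]) (simp add: k_def power_mult_distrib mult_ac)
    qed (use m in auto)
    finally show ?thesis using m q by (simp add: gauss_mean_def)
  qed
  define C where "C = real m powr (1 + \<delta>) * C0 * real d powr (5 * \<delta> / 8)"
  show thesis
  proof (rule that[of C])
    show "C > 0" using C0 m d by (simp add: C_def)
    fix h :: real assume h: "0 < h" "real d * h \<le> 1"
    define t where "t i = \<rho> (Suc i) * incr \<delta> (real d * h) i" for i
    define L where "L = lac \<delta> (\<lambda>l. e (of_int l * (real a / real q))) h (int k)"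
    define \<phi> where "\<phi> n = m * Suc n - 1" for n
    have Sp: "Suc (\<phi> n) = m * Suc n" for n using m by (simp add: \<phi>_def)
    have mono: "strict_mono \<phi>"
    proof (rule strict_monoI_Suc)
      show "\<phi> n < \<phi> (Suc n)" for n using Sp[of n] Sp[of "Suc n"] m by simp
    qed
    have tp: "t (\<phi> n) = of_real (real m powr (- (1 + \<delta>))) * (incr \<delta> (of_int (int k) * h) n * e (of_int (int k * (int (Suc n))\<^sup>2) * (real a / real q)))" for n
    proof -
      have R: "real (Suc (\<phi> n)) = real m * real (Suc n)" by (simp only: Sp of_nat_mult)
      have 1: "wt \<delta> (\<phi> n) = real m powr (- (1 + \<delta>)) * wt \<delta> n" unfolding wt_def R by (simp add: powr_mult)
      have 2: "(real (Suc (\<phi> n)))\<^sup>2 * (real d * h) = (real (Suc n))\<^sup>2 * (of_int (int k) * h)"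
        unfolding R by (simp add: k_def power_mult_distrib)
      have 3: "real d * (real (Suc (\<phi> n)))\<^sup>2 * (real a / real q) = of_int (int k * (int (Suc n))\<^sup>2) * (real a / real q)"
        unfolding R by (simp add: k_def power_mult_distrib)
      have "m dvd Suc (\<phi> n)" by (simp only: Sp dvd_triv_left)
      then show ?thesis unfolding t_def \<rho>_def incr_def 1 2 3 by simp
    qed
    have z: "t i = 0" if "i \<notin> range \<phi>" for i
    proof -
      have "\<not> m dvd Suc i"
      proof
        assume "m dvd Suc i"
        then obtain j where j: "Suc i = m * j" by (elim dvdE)
        then obtain n where "j = Suc n" by (cases j) auto
        then have "i = \<phi> n" using j Sp[of n] by simp
        then show False using that by simp
      qed
      then show ?thesis by (simp add: t_def \<rho>_def)
    qed
    have "(\<lambda>n. t (\<phi> n)) sums (of_real (real m powr (- (1 + \<delta>))) * L)"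
      unfolding tp L_def lac_def
      by (intro sums_mult summable_sums summable_incr_mult[OF \<delta>, of "\<lambda>l. e (of_int l * (real a / real q))"]) simp
    then have "t sums (of_real (real m powr (- (1 + \<delta>))) * L)"
      using sums_mono_reindex[OF mono, of t] z by blast
    then have sum_t: "(\<Sum>n. \<rho> (Suc n) * incr \<delta> (real d * h) n) = of_real (real m powr (- (1 + \<delta>))) * L"
      unfolding t_def by (simp add: sums_iff)
    let ?\<Phi> = "Phi \<delta> (real d * h)"
    let ?\<gamma> = "gauss_mean (int k * int a) q"
    have "cmod (of_real (real m powr (- (1 + \<delta>))) * L - ?\<gamma> / of_nat m * ?\<Phi>) \<le> C0 * (real d * h) powr (5 * \<delta> / 8)"
      using C0(2)[of "real d * h"] h d unfolding sum_t mean by simp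
    \<comment> \<open>Reindexing left the factor m powr (-1 - \<delta>) on the sum; clearing it
      turns 1 / m into m powr \<delta> = k powr (\<delta>/2) d powr (-\<delta>/2).\<close>
    then have "real m powr (1 + \<delta>) * cmod (of_real (real m powr (- (1 + \<delta>))) * L - ?\<gamma> / of_nat m * ?\<Phi>)
      \<le> real m powr (1 + \<delta>) * (C0 * (real d * h) powr (5 * \<delta> / 8))"
      by (intro mult_left_mono) auto
    also have "\<dots> = C * h powr (5 * \<delta> / 8)" using h by (simp add: C_def powr_mult)
    also have "real m powr (1 + \<delta>) * cmod (of_real (real m powr (- (1 + \<delta>))) * L - ?\<gamma> / of_nat m * ?\<Phi>)
      = cmod (of_real (real m powr (1 + \<delta>)) * (of_real (real m powr (- (1 + \<delta>))) * L - ?\<gamma> / of_nat m * ?\<Phi>))"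
      by (simp add: norm_mult)
    also have "of_real (real m powr (1 + \<delta>)) * (of_real (real m powr (- (1 + \<delta>))) * L - ?\<gamma> / of_nat m * ?\<Phi>)
      = L - real k powr (\<delta> / 2) * (?\<Phi> * of_real (real d powr - (\<delta> / 2))) * ?\<gamma>"
    proof -
      have 1: "real m powr (1 + \<delta>) * real m powr (- (1 + \<delta>)) = 1"
        unfolding powr_add[symmetric] using m by simp
      have 2: "real m powr (1 + \<delta>) / real m = real m powr \<delta>" using m by (simp add: powr_add)
      have 3: "real k powr (\<delta> / 2) * real d powr - (\<delta> / 2) = real m powr \<delta>"
      proof -
        have "real k = real d * real m powr 2" using m by (simp add: k_def powr_numeral)
        then have "real k powr (\<delta> / 2) = real d powr (\<delta> / 2) * real m powr \<delta>"
          by (simp add: powr_mult powr_powr del: powr_numeral)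
        moreover have "real d powr (\<delta> / 2) * real d powr - (\<delta> / 2) = 1"
          unfolding powr_add[symmetric] using d by simp
        ultimately show ?thesis by (simp add: mult_ac)
      qed
      have "of_real (real m powr (1 + \<delta>)) * (of_real (real m powr (- (1 + \<delta>))) * L - ?\<gamma> / of_nat m * ?\<Phi>)
        = complex_of_real (real m powr (1 + \<delta>) * real m powr (- (1 + \<delta>))) * L
        - complex_of_real (real m powr (1 + \<delta>) / real m) * (?\<gamma> * ?\<Phi>)"
        by (simp add: right_diff_distrib)
      also have "\<dots> = L - complex_of_real (real k powr (\<delta> / 2) * real d powr - (\<delta> / 2)) * (?\<gamma> * ?\<Phi>)"
        unfolding 1 2 3 by simp
      finally show ?thesis by (simp add: mult_ac)
    qed
    finally show "cmod (lac \<delta> (\<lambda>l. e (of_int l * (real a / real q))) h (int k)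
      - real k powr (\<delta> / 2) * (Phi \<delta> (real d * h) * of_real (real d powr - (\<delta> / 2))) * gauss_mean (int k * int a) q) \<le> C * h powr (5 * \<delta> / 8)"
      unfolding L_def .
  qed
qed

text \<open>Every multiple of a separating modulus still separates, so the product of the moduli for
  the individual k serves all of them.\<close>

lemma separating_modulus:
  fixes d R\<^sub>0 :: nat and B :: "int set"
  assumes "finite B" and d: "d > 0" "squarefree d"
    and "\<And>k. k \<in> B \<Longrightarrow> k \<noteq> 0 \<and> (\<nexists>m. k = int d * (int m)\<^sup>2)"
  shows "\<exists>M>0. \<forall>k\<in>B. \<exists>R\<ge>R\<^sub>0. R > 0 \<and> (\<forall>n s. int M dvd k * (int n)\<^sup>2 - int d * s\<^sup>2 \<longrightarrow> R dvd n)"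
  using assms(1,4)
proof (induction B rule: finite_induct)
  case (insert k B)
  then obtain M where M: "M > 0" "\<forall>k\<in>B. \<exists>R\<ge>R\<^sub>0. R > 0 \<and> (\<forall>n s. int M dvd k * (int n)\<^sup>2 - int d * s\<^sup>2 \<longrightarrow> R dvd n)"
    by auto
  have "k \<noteq> 0" "\<nexists>m. k = int d * (int m)\<^sup>2" using insert.prems[of k] by auto
  then obtain M' R' where M': "M' > 0" "R' \<ge> R\<^sub>0" "R' > 0"
    "\<And>n s. int M' dvd k * (int n)\<^sup>2 - int d * s\<^sup>2 \<Longrightarrow> R' dvd n"
    using nonsquare_class_separation[OF _ d] by blast
  have l: "int M dvd t" "int M' dvd t" if "int (M * M') dvd t" for t
    using that by (auto dest: dvd_mult_left dvd_mult_right)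
  show ?case
  proof (rule exI[of _ "M * M'"], intro conjI ballI)
    fix k' assume "k' \<in> insert k B"
    then show "\<exists>R\<ge>R\<^sub>0. R > 0 \<and> (\<forall>n s. int (M * M') dvd k' * (int n)\<^sup>2 - int d * s\<^sup>2 \<longrightarrow> R dvd n)"
    proof
      assume "k' = k"
      then show ?thesis using M' l by (intro exI[of _ R']) blast
    next
      assume "k' \<in> B"
      then obtain R where "R \<ge> R\<^sub>0" "R > 0" "\<forall>n s. int M dvd k' * (int n)\<^sup>2 - int d * s\<^sup>2 \<longrightarrow> R dvd n"
        using M(2) by blast
      then show ?thesis using l by (intro exI[of _ R]) blast
    qed
  qed (use M M' in auto)
qed (auto intro: exI[of _ 1])

section \<open>Lower bound for the increments at rational points\<close>

context lacunary_series
begin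

text \<open>Absolute convergence identifies the unordered sum with a series over all j that is
  padded with zeros off the square class, which matches the indexing of
  \<open>functional_expansion\<close>.\<close>

lemma S_sum_sums:
  assumes q: "q > 0"
  shows "(\<lambda>j. if \<exists>m. Suc j = d * m\<^sup>2 then C j * of_real (real (Suc j) powr (\<delta> / 2)) * gauss_mean (int (Suc j) * int a) q else 0)
    sums S_sum \<delta> g d a q"
proof -
  define F where "F k = fourier_coeff g (int k) * of_real (real k powr (\<delta> / 2)) * gauss_mean (int k * int a) q" for k
  define A where "A = {m\<^sup>2 * d | m. m \<ge> 1}"
  define f where "f j = (if \<exists>m. Suc j = d * m\<^sup>2 then F (Suc j) else 0)" for j
  have nf: "cmod (f j) \<le> cmod (C j) * real (Suc j) powr (\<delta> / 2)" for j
  proof -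
    have "cmod (F (Suc j)) \<le> cmod (C j) * real (Suc j) powr (\<delta> / 2) * 1"
      unfolding F_def C_def norm_mult by (intro mult_mono norm_gauss_mean_le q) auto
    then show ?thesis by (simp add: f_def del: of_nat_Suc)
  qed
  have sn: "summable (\<lambda>j. norm (f j))"
    by (rule summable_comparison_test'[OF summ, of 0]) (use nf in simp)
  then have fs: "f sums suminf f" by (rule summable_sums[OF summable_norm_cancel])
  have "(f has_sum suminf f) UNIV" by (rule norm_summable_imp_has_sum[OF sn fs])
  moreover have "Suc j \<in> A \<longleftrightarrow> (\<exists>m. Suc j = d * m\<^sup>2)" for j
  proof
    assume "\<exists>m. Suc j = d * m\<^sup>2"
    then obtain m where m: "Suc j = m\<^sup>2 * d" by (auto simp: mult.commute)
    then have "m \<ge> 1" by (cases m) auto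
    then show "Suc j \<in> A" unfolding A_def using m by blast
  qed (auto simp: A_def mult.commute)
  then have "f = (\<lambda>k. if k \<in> A then F k else 0) \<circ> Suc" by (auto simp: f_def fun_eq_iff)
  ultimately have "((\<lambda>k. if k \<in> A then F k else 0) has_sum suminf f) (range Suc)"
    by (subst has_sum_reindex) auto
  then have 1: "((\<lambda>k. if k \<in> A then F k else 0) has_sum suminf f) (range Suc)" .
  have "(F has_sum suminf f) (A - {0})"
  proof (rule iffD1[OF has_sum_cong_neutral 1])
    fix x assume "x \<in> A - {0} - range Suc"
    then show "F x = 0" by (cases x) auto
  qed auto
  \<comment> \<open>The index 0, which lies in \<open>A\<close> when d = 0, is restored at no cost,
    because \<open>0 powr (\<delta> / 2)\<close> is 0 and so F 0 = 0.\<close>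
  then have "(F has_sum suminf f) A"
  proof (rule iffD1[OF has_sum_cong_neutral, rotated -1])
    fix x assume "x \<in> A - (A - {0})"
    then show "F x = 0" by (simp add: F_def)
  qed auto
  then have "infsum F A = suminf f" by (rule infsumI)
  then have "S_sum \<delta> g d a q = suminf f" unfolding S_sum_def F_def A_def .
  moreover have feq: "(\<lambda>j. if \<exists>m. Suc j = d * m\<^sup>2 then C j * of_real (real (Suc j) powr (\<delta> / 2)) * gauss_mean (int (Suc j) * int a) q else 0) = f"
    by (intro ext) (simp only: f_def F_def C_def)
  ultimately show ?thesis unfolding feq using fs by simp
qed

text \<open>All constants are fixed before h and p: J cuts off the Fourier tail, \<eta> is the
  relative error allowed for each lower mode, \<open>R\<^sub>0\<close> is the divisibility that
  achieves it, M separates the bad modes up to J, and \<open>h\<^sub>0\<close> and P come last. With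
  H = h powr (\<delta>/2), the main term is at least \<beta> H / 20 and the total error at most half
  of that.\<close>

lemma increments_lower_bound:
  assumes d: "d > 0" "squarefree d" and q: "q > 0" and S: "S_sum \<delta> g d a q \<noteq> 0"
  obtains M P :: nat and c h\<^sub>0 :: real where "M > 0" "c > 0" "h\<^sub>0 > 0"
    "\<And>h p. 0 < h \<Longrightarrow> h < h\<^sub>0 \<Longrightarrow> prime p \<Longrightarrow> P < p \<Longrightarrow>
      c * sqrt (real p) * h powr (\<delta> / 2)
      \<le> (\<Sum>b<M. \<Sum>r=1..<p. \<bar>G (real a / real q + real b / real M + real r / real p + h)
                              - G (real a / real q + real b / real M + real r / real p)\<bar>)"
proof -
  define K where "K = 2 * pi + 8 / \<delta>"
  have K0: "K > 0" using \<delta> by (auto simp: K_def intro!: add_pos_pos)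
  define \<beta> where "\<beta> = cmod (S_sum \<delta> g d a q)"
  have \<beta>0: "\<beta> > 0" using S by (simp add: \<beta>_def)
  define u where "u j = cmod (C j) * real (Suc j) powr (\<delta> / 2)" for j
  have u0: "u j \<ge> 0" for j by (simp add: u_def)
  have su: "summable u" using summ by (simp add: u_def[abs_def])
  define A where "A = suminf u"
  have A0: "A \<ge> 0" unfolding A_def by (intro suminf_nonneg su u0)
  \<comment> \<open>By \<open>err2\<close> below, the tail costs 3 K H u j for each j, so this
    choice keeps it below \<beta> H / 80.\<close>
  obtain J where J: "(\<Sum>j. u (j + J)) \<le> \<beta> / (240 * K)"
  proof -
    have "\<beta> / (240 * K) > 0" using \<beta>0 K0 by simp
    from suminf_exist_split[OF this su] obtain J where "\<forall>n\<ge>J. norm (\<Sum>i. u (i + n)) < \<beta> / (240 * K)" by blast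
    then have "norm (\<Sum>i. u (i + J)) < \<beta> / (240 * K)" by blast
    then show thesis by (intro that[of J]) simp
  qed
  \<comment> \<open>The indices below J cost \<eta> H u j each, and these u j sum to at most A, so
    they too stay below \<beta> H / 80; A + 1 is positive even if A = 0.\<close>
  define \<eta> where "\<eta> = \<beta> / (80 * (A + 1))"
  have \<eta>0: "\<eta> > 0" using \<beta>0 A0 by (simp add: \<eta>_def)
  define R\<^sub>0 where "R\<^sub>0 = nat \<lceil>4 * K / \<eta>\<rceil> + 1"
  have R0: "K / real R \<le> \<eta> / 4" if "R \<ge> R\<^sub>0" for R
  proof -
    have "4 * K / \<eta> \<le> real R\<^sub>0" unfolding R\<^sub>0_def by linarith
    also have "\<dots> \<le> real R" using that by simp
    finally have "4 * K / \<eta> \<le> real R" .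
    moreover have "real R > 0" using that by (simp add: R\<^sub>0_def)
    ultimately show ?thesis using \<eta>0 by (simp add: field_simps)
  qed
  define good where "good j \<longleftrightarrow> (\<exists>m. Suc j = d * m\<^sup>2)" for j
  define B where "B = {k :: int. \<bar>k\<bar> \<le> int J \<and> k \<noteq> 0 \<and> (\<nexists>m. k = int d * (int m)\<^sup>2)}"
  have finB: "finite B" by (rule finite_subset[of _ "{- int J..int J}"]) (auto simp: B_def)
  obtain M where M: "M > 0"
    "\<And>k. k \<in> B \<Longrightarrow> \<exists>R\<ge>R\<^sub>0. R > 0 \<and> (\<forall>n s. int M dvd k * (int n)\<^sup>2 - int d * s\<^sup>2 \<longrightarrow> R dvd n)"
    using separating_modulus[OF finB d, of R\<^sub>0] by (auto simp: B_def)
  define T where "T = {l. \<exists>s. int M dvd l - int d * s\<^sup>2}"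
  have perT: "l \<in> T \<longleftrightarrow> l + int M * j \<in> T" for l j
  proof -
    have "int M dvd l + int M * j - int d * s\<^sup>2 \<longleftrightarrow> int M dvd l - int d * s\<^sup>2" for s
    proof -
      have "l + int M * j - int d * s\<^sup>2 = (l - int d * s\<^sup>2) + int M * j" by simp
      then show ?thesis by (simp only: dvd_add_left_iff[OF dvd_triv_left])
    qed
    then show ?thesis by (simp add: T_def)
  qed
  obtain c where c: "\<And>b. cmod (c b) \<le> 1"
    "\<And>l. (\<Sum>b<M. c b * e (of_int l * (real b / real M))) = (if l \<in> T then 1 else 0)"
    using indicator_fourier[OF M(1), of T] perT by blast
  define x0 where "x0 = real a / real q"
  define \<Lambda>0 where "\<Lambda>0 l = e (of_int l * x0)" for l
  define \<kappa> where "\<kappa> h = Phi \<delta> (real d * h) * of_real (real d powr - (\<delta> / 2))" for h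
  define \<gamma> where "\<gamma> j = gauss_mean (int (Suc j) * int a) q" for j
  have ev: "\<forall>\<^sub>F h in at_right 0. good j \<longrightarrow>
      cmod (lac \<delta> \<Lambda>0 h (int (Suc j)) - real (Suc j) powr (\<delta> / 2) * \<kappa> h * \<gamma> j) \<le> \<eta> / 4 * h powr (\<delta> / 2)" for j
  proof (cases "good j")
    case True
    then obtain m where m: "Suc j = d * m\<^sup>2" by (auto simp: good_def)
    then have m0: "m > 0" by (cases m) auto
    obtain D where D: "D > 0" "\<And>h. 0 < h \<Longrightarrow> real d * h \<le> 1 \<Longrightarrow>
       cmod (lac \<delta> \<Lambda>0 h (int (Suc j)) - real (Suc j) powr (\<delta> / 2) * \<kappa> h * \<gamma> j) \<le> D * h powr (5 * \<delta> / 8)"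
      using lac_square_asymp[OF \<delta> d(1) m0 q, of a] unfolding \<Lambda>0_def x0_def \<kappa>_def \<gamma>_def m by metis
    have "((\<lambda>h. h powr (\<delta> / 8)) \<longlongrightarrow> 0) (at_right 0)"
      using \<delta> by real_asymp
    then have "((\<lambda>h. D * h powr (\<delta> / 8)) \<longlongrightarrow> D * 0) (at_right 0)"
      by (intro tendsto_mult tendsto_const)
    then have "\<forall>\<^sub>F h in at_right 0. D * h powr (\<delta> / 8) < \<eta> / 4"
      using \<eta>0 by (intro order_tendstoD(2)) auto
    moreover have "\<forall>\<^sub>F h in at_right (0::real). 0 < h \<and> h < 1 / real d"
      using d(1) unfolding eventually_at_right_field by (intro exI[of _ "1 / real d"]) auto
    ultimately show ?thesis
    proof eventually_elim
      case (elim h)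
      have "D * h powr (5 * \<delta> / 8) = D * h powr (\<delta> / 8) * h powr (\<delta> / 2)"
        by (simp add: powr_add[symmetric] mult.assoc)
      also have "\<dots> \<le> \<eta> / 4 * h powr (\<delta> / 2)" using elim by (intro mult_right_mono) auto
      finally show ?case using D(2)[of h] elim d(1) by (auto simp: field_simps)
    qed
  qed simp
  have "\<forall>\<^sub>F h in at_right 0. \<forall>j\<in>{..<J}. good j \<longrightarrow>
      cmod (lac \<delta> \<Lambda>0 h (int (Suc j)) - real (Suc j) powr (\<delta> / 2) * \<kappa> h * \<gamma> j) \<le> \<eta> / 4 * h powr (\<delta> / 2)"
    by (intro eventually_ball_finite ballI ev) simp
  then obtain h1 where h1: "h1 > 0" "\<And>h j. 0 < h \<Longrightarrow> h < h1 \<Longrightarrow> j < J \<Longrightarrow> good j \<Longrightarrow>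
      cmod (lac \<delta> \<Lambda>0 h (int (Suc j)) - real (Suc j) powr (\<delta> / 2) * \<kappa> h * \<gamma> j) \<le> \<eta> / 4 * h powr (\<delta> / 2)"
    unfolding eventually_at_right_field by auto
  define h\<^sub>0 where "h\<^sub>0 = min h1 (1 / (16 * real d))"
  \<comment> \<open>Here p > J keeps p from dividing m when d m^2 \<le> J, p > d keeps it from
    dividing d, p > 2 makes the two roots distinct, and p > 2 \<open>R\<^sub>0\<close> makes K / p
    \<le> \<eta> / 4.\<close>
  define P where "P = max (max J d) (max 2 (2 * R\<^sub>0))"
  show thesis
  proof (rule that[of M "\<beta> / 40" h\<^sub>0 P])
    show "h\<^sub>0 > 0" using h1(1) d by (simp add: h\<^sub>0_def)
    fix h :: real and p :: nat
    assume h: "0 < h" "h < h\<^sub>0" and p: "prime p" "P < p"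
    have pJ: "J < p" "d < p" "2 < p" "2 * R\<^sub>0 < p" using p(2) by (auto simp: P_def)
    have p0: "p > 0" using pJ by simp
    have pd: "\<not> p dvd d" using pJ d(1) by (auto dest: dvd_imp_le)
    \<comment> \<open>The indicator of the square class modulo M times a Legendre symbol modulo p,
      so only the values -1, 0 and 1 occur.\<close>
    define \<theta> :: "int \<Rightarrow> complex" where "\<theta> l = (if l \<in> T then 1 else 0) * (of_nat (qcount d p l) - 1)" for l
    have \<theta>1: "cmod (\<theta> l) \<le> 1" for l
    proof -
      have "qcount d p l \<in> {0, 1, 2}" using qcount_le_2[OF p(1) pd, of l] by auto
      then show ?thesis by (auto simp: \<theta>_def)
    qed
    define \<Lambda> where "\<Lambda> l = \<Lambda>0 l * \<theta> l" for l
    have \<Lambda>1: "cmod (\<Lambda> l) \<le> 1" for l using \<theta>1[of l] by (simp add: \<Lambda>_def \<Lambda>0_def norm_mult)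
    define w where "w r = (\<Sum>m<p. e (- (of_int (int r * int d) * (real m)\<^sup>2 / real p)))" for r
    define \<omega> where "\<omega> br = c (fst br) * w (snd br) / of_nat p" for br
    define x where "x br = x0 + real (fst br) / real M + real (snd br) / real p" for br :: "nat \<times> nat"
    define I where "I = {..<M} \<times> {1..<p}"
    have wp: "cmod (w r) = sqrt (real p)" if "r \<in> {1..<p}" for r
    proof -
      have "cmod (\<Sum>m<p. e (of_int (- (int r * int d)) * (real m)\<^sup>2 / real p)) = sqrt (real p)"
      proof (rule gauss_sum_norm_sq[OF p0])
        fix u assume u: "u < p" "int p dvd 2 * - (int r * int d) * int u"
        then have "int p dvd int (2 * (r * d) * u)" by (simp add: mult.assoc)
        then have "p dvd 2 * (r * d) * u" by (simp only: int_dvd_int_iff)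
        then have "p dvd 2 \<or> p dvd r \<or> p dvd d \<or> p dvd u"
          using p(1) by (simp add: prime_dvd_mult_iff)
        then show "u = 0" using pd pJ that u(1) by (auto dest: dvd_imp_le)
      qed
      then show ?thesis by (simp add: w_def)
    qed
    have \<omega>p: "cmod (\<omega> br) \<le> 1 / sqrt (real p)" if "br \<in> I" for br
    proof -
      have "cmod (\<omega> br) = cmod (c (fst br)) * sqrt (real p) / real p"
        using wp[of "snd br"] that by (auto simp: \<omega>_def I_def norm_mult norm_divide)
      also have "\<dots> \<le> 1 * sqrt (real p) / real p"
        by (intro divide_right_mono mult_right_mono c) auto
      also have "\<dots> = 1 / sqrt (real p)" using p0 by (simp add: field_simps)
      finally show ?thesis .
    qed
    \<comment> \<open>The exponential splits over the three summands of the point, so the sum over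
      pairs factors into a b-sum, which is the indicator of \<open>T\<close>, and an r-sum, which
      \<open>qcount_fourier\<close> evaluates.\<close>
    have transform: "(\<Sum>br\<in>I. \<omega> br * e (of_int l * x br)) = \<Lambda> l" for l
    proof -
      have "(\<Sum>br\<in>I. \<omega> br * e (of_int l * x br))
        = (\<Sum>br\<in>I. (\<Lambda>0 l / of_nat p) * ((c (fst br) * e (of_int l * (real (fst br) / real M))) * (w (snd br) * e (of_int l * (real (snd br) / real p)))))"
      proof (rule sum.cong[OF refl])
        fix br
        have "of_int l * x br = of_int l * x0 + of_int l * (real (fst br) / real M) + of_int l * (real (snd br) / real p)"
          by (simp add: x_def distrib_left)
        then show "\<omega> br * e (of_int l * x br)
          = (\<Lambda>0 l / of_nat p) * ((c (fst br) * e (of_int l * (real (fst br) / real M))) * (w (snd br) * e (of_int l * (real (snd br) / real p))))"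
          by (simp only: e_add) (simp add: \<omega>_def \<Lambda>0_def)
      qed
      also have "\<dots> = (\<Lambda>0 l / of_nat p) * ((\<Sum>b<M. c b * e (of_int l * (real b / real M))) * (\<Sum>r=1..<p. w r * e (of_int l * (real r / real p))))"
      proof -
        have "(\<Sum>b<M. f b) * (\<Sum>r=1..<p. f' r) = (\<Sum>br\<in>I. f (fst br) * f' (snd br))" for f f' :: "nat \<Rightarrow> complex"
          by (simp only: sum_product sum.cartesian_product case_prod_unfold I_def)
        then show ?thesis by (simp only: sum_distrib_left[symmetric])
      qed
      also have "(\<Sum>r=1..<p. w r * e (of_int l * (real r / real p))) = of_nat p * (of_nat (qcount d p l) - 1)"
        unfolding w_def by (rule qcount_fourier[OF p(1)])
      finally show ?thesis unfolding c(2) \<Lambda>_def \<theta>_def using p0 by simp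
    qed
    define E where "E = (\<Sum>br\<in>I. \<omega> br * of_real (G (x br + h) - G (x br)))"
    have Es: "(\<lambda>j. C j * lac \<delta> \<Lambda> h (int (Suc j)) + cnj (C j) * lac \<delta> \<Lambda> h (- int (Suc j))) sums E"
      unfolding E_def by (rule functional_expansion[OF _ transform]) (simp add: I_def)
    define H where "H = h powr (\<delta> / 2)"
    have H0: "H > 0" using h by (simp add: H_def)
    have hd: "0 < real d * h" "real d * h \<le> 1 / 16"
      using h d by (auto simp: h\<^sub>0_def field_simps)
    have dd: "(real d * h) powr (\<delta> / 2) * real d powr - (\<delta> / 2) = H"
    proof -
      have "(real d * h) powr (\<delta> / 2) * real d powr - (\<delta> / 2) = (real d powr (\<delta> / 2) * real d powr - (\<delta> / 2)) * H"
        using h by (simp add: powr_mult H_def)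
      also have "real d powr (\<delta> / 2) * real d powr - (\<delta> / 2) = 1" unfolding powr_add[symmetric] using d by simp
      finally show ?thesis by simp
    qed
    have \<kappa>n: "cmod (\<kappa> h) = cmod (Phi \<delta> (real d * h)) * real d powr - (\<delta> / 2)" by (simp add: \<kappa>_def norm_mult)
    have \<kappa>lo: "1 / 20 * H \<le> cmod (\<kappa> h)"
    proof -
      have "1 / 20 * (real d * h) powr (\<delta> / 2) * real d powr - (\<delta> / 2) \<le> cmod (\<kappa> h)"
        unfolding \<kappa>n by (intro mult_right_mono norm_Phi_ge \<delta> hd) auto
      then show ?thesis using dd by (simp only: mult.assoc)
    qed
    have \<kappa>hi: "cmod (\<kappa> h) \<le> K * H"
    proof -
      have "cmod (Phi \<delta> (real d * h)) \<le> K * \<bar>real d * h\<bar> powr (\<delta> / 2)"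
        unfolding Phi_def K_def
        by (rule order_trans[OF summable_norm[OF summable_norm_incr[OF \<delta>]] suminf_norm_incr_le[OF \<delta>]])
      then have "cmod (\<kappa> h) \<le> K * (real d * h) powr (\<delta> / 2) * real d powr - (\<delta> / 2)"
        unfolding \<kappa>n using hd by (intro mult_right_mono) auto
      then show ?thesis using dd by (simp only: mult.assoc)
    qed
    define \<mu> where "\<mu> j = (if good j then C j * of_real (real (Suc j) powr (\<delta> / 2)) * \<gamma> j else 0)" for j
    have \<mu>s: "\<mu> sums S_sum \<delta> g d a q"
      unfolding \<mu>_def good_def \<gamma>_def by (rule S_sum_sums[OF q])
    define err where "err j = C j * lac \<delta> \<Lambda> h (int (Suc j)) + cnj (C j) * lac \<delta> \<Lambda> h (- int (Suc j)) - \<kappa> h * \<mu> j" for j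
    have errs: "err sums (E - \<kappa> h * S_sum \<delta> g d a q)"
      unfolding err_def by (intro sums_diff Es sums_mult \<mu>s)
    \<comment> \<open>If \<Lambda> does not vanish at k n^2, then k n^2 is congruent to some d s^2
      modulo M, and for k in \<open>B\<close> this forces a large R to divide n.\<close>
    have bad: "cmod (lac \<delta> \<Lambda> h k) \<le> \<eta> / 4 * (real (Suc j) powr (\<delta> / 2) * H)" if k: "k \<in> B" "\<bar>k\<bar> = int (Suc j)" for k j
    proof -
      obtain R where R: "R \<ge> R\<^sub>0" "R > 0" "\<forall>n s. int M dvd k * (int n)\<^sup>2 - int d * s\<^sup>2 \<longrightarrow> R dvd n"
        using M(2)[OF k(1)] by blast
      have "cmod (lac \<delta> \<Lambda> h k) \<le> (2 * pi + 8 / \<delta>) / real R * (of_int \<bar>k\<bar> powr (\<delta> / 2) * h powr (\<delta> / 2))"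
      proof (rule norm_lac_multiples_le[OF \<delta> \<Lambda>1 R(2) _ h(1)])
        fix n assume "\<Lambda> (k * (int n)\<^sup>2) \<noteq> 0"
        then have "k * (int n)\<^sup>2 \<in> T" by (auto simp: \<Lambda>_def \<theta>_def split: if_splits)
        then show "R dvd n" using R(3) by (auto simp: T_def)
      qed
      also have "\<dots> = K / real R * (real (Suc j) powr (\<delta> / 2) * H)"
        by (simp only: K_def k(2) H_def of_int_of_nat_eq)
      also have "\<dots> \<le> \<eta> / 4 * (real (Suc j) powr (\<delta> / 2) * H)"
        using R0[OF R(1)] H0 by (intro mult_right_mono) auto
      finally show ?thesis .
    qed
    have one: "real (Suc j) powr (\<delta> / 2) \<ge> 1" for j using \<delta> by (intro ge_one_powr_ge_zero) auto
    \<comment> \<open>Of the 3 \<eta> / 4, a good mode uses \<eta> / 2 for the n divisible by p and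
      \<eta> / 4 for the asymptotic formula. The last \<eta> / 4 is reserved for the negative
      mode.\<close>
    have plus: "cmod (C j * lac \<delta> \<Lambda> h (int (Suc j)) - \<kappa> h * \<mu> j) \<le> 3 * \<eta> / 4 * (u j * H)" if j: "j < J" for j
    proof (cases "good j")
      case False
      have "int (Suc j) \<noteq> int d * (int m)\<^sup>2" for m
      proof
        assume "int (Suc j) = int d * (int m)\<^sup>2"
        then have "int (Suc j) = int (d * m\<^sup>2)" by simp
        then have "Suc j = d * m\<^sup>2" by (simp only: of_nat_eq_iff)
        then show False using False by (auto simp: good_def)
      qed
      then have "int (Suc j) \<in> B" using j by (auto simp: B_def)
      then have "cmod (lac \<delta> \<Lambda> h (int (Suc j))) \<le> \<eta> / 4 * (real (Suc j) powr (\<delta> / 2) * H)"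
        using bad[of "int (Suc j)" j] by simp
      then have "cmod (C j) * cmod (lac \<delta> \<Lambda> h (int (Suc j))) \<le> cmod (C j) * (\<eta> / 4 * (real (Suc j) powr (\<delta> / 2) * H))"
        by (intro mult_left_mono) auto
      also have "\<dots> = \<eta> / 4 * (u j * H)" by (simp add: u_def)
      also have "\<dots> \<le> 3 * \<eta> / 4 * (u j * H)" using \<eta>0 u0 H0 by (intro mult_right_mono) auto
      finally show ?thesis using False by (simp add: \<mu>_def norm_mult)
    next
      case True
      then obtain m where m: "Suc j = d * m\<^sup>2" by (auto simp: good_def)
      have m0: "m > 0" using m by (cases m) auto
      have "m * 1 \<le> m * (m * d)" using m0 d by (intro mult_left_mono) auto
      then have "m \<le> Suc j" using m by (simp add: power2_eq_square mult_ac)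
      then have mp: "m < p" using j pJ by simp
      then have pm: "\<not> p dvd m" using m0 by (auto dest: dvd_imp_le)
      \<comment> \<open>If p divides neither m nor n, then d (m n)^2 gives exactly two roots and
        lies in \<open>T\<close>, so both factors of \<theta> are 1.\<close>
      have near: "\<Lambda> (int (Suc j) * (int n)\<^sup>2) = \<Lambda>0 (int (Suc j) * (int n)\<^sup>2)" if n: "\<not> p dvd n" for n
      proof -
        have eq: "int (Suc j) * (int n)\<^sup>2 = int d * (int (m * n))\<^sup>2"
          unfolding m by (simp add: power_mult_distrib)
        have "\<not> p dvd m * n" using pm n p(1) by (simp add: prime_dvd_mult_iff)
        then have "\<not> int p dvd int (m * n)" by (subst int_dvd_int_iff)
        then have "qcount d p (int d * (int (m * n))\<^sup>2) = 2"
          using qcount_square[OF p(1) pd] pJ by blast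
        moreover have "int d * (int (m * n))\<^sup>2 \<in> T" unfolding T_def by (auto intro: exI[of _ "int (m * n)"])
        ultimately have "\<theta> (int d * (int (m * n))\<^sup>2) = 1" by (simp add: \<theta>_def)
        then show ?thesis unfolding \<Lambda>_def eq by simp
      qed
      have "cmod (lac \<delta> \<Lambda> h (int (Suc j)) - lac \<delta> \<Lambda>0 h (int (Suc j)))
        \<le> 2 * ((2 * pi + 8 / \<delta>) / real p * (of_int \<bar>int (Suc j)\<bar> powr (\<delta> / 2) * h powr (\<delta> / 2)))"
        using near by (intro norm_lac_diff_le \<delta> \<Lambda>1 p0 h) (auto simp: \<Lambda>0_def)
      also have "\<dots> = 2 * (K / real p * (real (Suc j) powr (\<delta> / 2) * H))" by (simp add: K_def H_def)
      also have "\<dots> \<le> 2 * (\<eta> / 4 * (real (Suc j) powr (\<delta> / 2) * H))"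
        using R0[of p] pJ H0 by (intro mult_left_mono mult_right_mono) auto
      finally have 1: "cmod (lac \<delta> \<Lambda> h (int (Suc j)) - lac \<delta> \<Lambda>0 h (int (Suc j))) \<le> \<eta> / 2 * (real (Suc j) powr (\<delta> / 2) * H)"
        by (simp add: mult_ac)
      have "cmod (lac \<delta> \<Lambda>0 h (int (Suc j)) - real (Suc j) powr (\<delta> / 2) * \<kappa> h * \<gamma> j) \<le> \<eta> / 4 * H"
        using h1(2)[of h j] h j True by (simp add: H_def h\<^sub>0_def)
      also have "\<dots> \<le> \<eta> / 4 * (real (Suc j) powr (\<delta> / 2) * H)"
        using one[of j] H0 \<eta>0 by (intro mult_left_mono) auto
      finally have 2: "cmod (lac \<delta> \<Lambda>0 h (int (Suc j)) - real (Suc j) powr (\<delta> / 2) * \<kappa> h * \<gamma> j) \<le> \<eta> / 4 * (real (Suc j) powr (\<delta> / 2) * H)" .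
      have "cmod (lac \<delta> \<Lambda> h (int (Suc j)) - real (Suc j) powr (\<delta> / 2) * \<kappa> h * \<gamma> j) \<le> 3 * \<eta> / 4 * (real (Suc j) powr (\<delta> / 2) * H)"
        using norm_triangle_ineq[of "lac \<delta> \<Lambda> h (int (Suc j)) - lac \<delta> \<Lambda>0 h (int (Suc j))" "lac \<delta> \<Lambda>0 h (int (Suc j)) - real (Suc j) powr (\<delta> / 2) * \<kappa> h * \<gamma> j"] 1 2
        by simp
      then have "cmod (C j) * cmod (lac \<delta> \<Lambda> h (int (Suc j)) - real (Suc j) powr (\<delta> / 2) * \<kappa> h * \<gamma> j) \<le> cmod (C j) * (3 * \<eta> / 4 * (real (Suc j) powr (\<delta> / 2) * H))"
        by (intro mult_left_mono) auto
      moreover have "C j * lac \<delta> \<Lambda> h (int (Suc j)) - \<kappa> h * \<mu> j = C j * (lac \<delta> \<Lambda> h (int (Suc j)) - real (Suc j) powr (\<delta> / 2) * \<kappa> h * \<gamma> j)"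
        using True by (simp add: \<mu>_def algebra_simps)
      ultimately show ?thesis by (simp add: norm_mult u_def mult_ac)
    qed
    \<comment> \<open>A negative k is never d times a square, so all negative modes down to - J are
      bad.\<close>
    have minus: "cmod (cnj (C j) * lac \<delta> \<Lambda> h (- int (Suc j))) \<le> \<eta> / 4 * (u j * H)" if j: "j < J" for j
    proof -
      have "- int (Suc j) \<noteq> int d * (int m)\<^sup>2" for m
      proof -
        have "int d * (int m)\<^sup>2 \<ge> 0" by simp
        then show ?thesis by linarith
      qed
      then have "- int (Suc j) \<in> B" using j unfolding B_def by auto
      then have "cmod (lac \<delta> \<Lambda> h (- int (Suc j))) \<le> \<eta> / 4 * (real (Suc j) powr (\<delta> / 2) * H)"
        using bad[of "- int (Suc j)" j] by simp
      then have "cmod (C j) * cmod (lac \<delta> \<Lambda> h (- int (Suc j))) \<le> cmod (C j) * (\<eta> / 4 * (real (Suc j) powr (\<delta> / 2) * H))"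
        by (intro mult_left_mono) auto
      then show ?thesis by (simp add: norm_mult u_def mult_ac)
    qed
    have err1: "cmod (err j) \<le> \<eta> * H * u j" if "j < J" for j
    proof -
      have "err j = (C j * lac \<delta> \<Lambda> h (int (Suc j)) - \<kappa> h * \<mu> j) + cnj (C j) * lac \<delta> \<Lambda> h (- int (Suc j))"
        by (simp add: err_def)
      then have "cmod (err j) \<le> 3 * \<eta> / 4 * (u j * H) + \<eta> / 4 * (u j * H)"
        using norm_triangle_le[OF add_mono[OF plus[OF that] minus[OF that]]] by simp
      then show ?thesis by (simp add: field_simps)
    qed
    \<comment> \<open>A crude bound for the tail: the modes k and - k and the main term cost K H u j
      each.\<close>
    have err2: "cmod (err j) \<le> 3 * K * H * u j" for j
    proof -
      have l: "cmod (lac \<delta> \<Lambda> h k) \<le> K * (real (Suc j) powr (\<delta> / 2) * H)" if "\<bar>k\<bar> = int (Suc j)" for k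
        using norm_lac_le[OF \<delta> \<Lambda>1 h(1), where k = k] unfolding that K_def H_def of_int_of_nat_eq .
      have "cmod (C j) * cmod (lac \<delta> \<Lambda> h k) \<le> cmod (C j) * (K * (real (Suc j) powr (\<delta> / 2) * H))" if "\<bar>k\<bar> = int (Suc j)" for k
        by (intro mult_left_mono l that) auto
      then have l: "cmod (C j) * cmod (lac \<delta> \<Lambda> h k) \<le> K * H * u j" if "\<bar>k\<bar> = int (Suc j)" for k
        using that by (simp add: u_def mult_ac)
      have "cmod (\<mu> j) \<le> u j"
      proof (cases "good j")
        case True
        have "u j * cmod (\<gamma> j) \<le> u j * 1" unfolding \<gamma>_def by (intro mult_left_mono norm_gauss_mean_le q u0)
        then show ?thesis using True by (simp add: \<mu>_def u_def norm_mult)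
      qed (simp add: \<mu>_def u0)
      then have "cmod (\<kappa> h * \<mu> j) \<le> K * H * u j"
        unfolding norm_mult using \<kappa>hi K0 H0 by (intro mult_mono) auto
      moreover have "cmod (err j) \<le> cmod (C j * lac \<delta> \<Lambda> h (int (Suc j))) + cmod (cnj (C j) * lac \<delta> \<Lambda> h (- int (Suc j))) + cmod (\<kappa> h * \<mu> j)"
        unfolding err_def by (rule order_trans[OF norm_triangle_ineq4]) (simp add: norm_triangle_ineq)
      ultimately show ?thesis
        using l[of "int (Suc j)"] l[of "- int (Suc j)"] by (simp add: norm_mult)
    qed
    have "cmod (E - \<kappa> h * S_sum \<delta> g d a q) = cmod ((\<Sum>j. err (j + J)) + (\<Sum>j<J. err j))"
      using suminf_split_initial_segment[OF sums_summable[OF errs], of J] errs by (simp add: sums_iff)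
    also have "\<dots> \<le> cmod (\<Sum>j. err (j + J)) + cmod (\<Sum>j<J. err j)" by (rule norm_triangle_ineq)
    also have "cmod (\<Sum>j. err (j + J)) \<le> (\<Sum>j. 3 * K * H * u (j + J))"
      by (intro norm_suminf_le err2 summable_mult summable_ignore_initial_segment su)
    also have "(\<Sum>j. 3 * K * H * u (j + J)) = 3 * K * H * (\<Sum>j. u (j + J))"
      by (intro suminf_mult summable_ignore_initial_segment su)
    also have "\<dots> \<le> 3 * K * H * (\<beta> / (240 * K))"
      using K0 H0 J by (intro mult_left_mono) auto
    also have "\<dots> = \<beta> / 80 * H" using K0 by simp
    also have "cmod (\<Sum>j<J. err j) \<le> (\<Sum>j<J. \<eta> * H * u j)" by (intro sum_norm_le err1) simp
    also have "\<dots> = \<eta> * H * (\<Sum>j<J. u j)" by (simp add: sum_distrib_left)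
    also have "\<dots> \<le> \<eta> * H * (A + 1)"
    proof -
      have "(\<Sum>j<J. u j) \<le> A" unfolding A_def by (intro sum_le_suminf su) (auto simp: u0)
      then show ?thesis using \<eta>0 H0 by (intro mult_left_mono) auto
    qed
    also have "\<dots> = \<beta> / 80 * H" using A0 by (simp add: \<eta>_def field_simps)
    finally have near: "cmod (E - \<kappa> h * S_sum \<delta> g d a q) \<le> \<beta> / 40 * H" by (simp add: mult_ac)
    have "\<beta> / 20 * H \<le> cmod (\<kappa> h * S_sum \<delta> g d a q)"
      unfolding norm_mult \<beta>_def[symmetric]
      using mult_right_mono[OF \<kappa>lo, of \<beta>] \<beta>0 by (simp add: mult_ac)
    moreover have "cmod (\<kappa> h * S_sum \<delta> g d a q) \<le> cmod E + cmod (E - \<kappa> h * S_sum \<delta> g d a q)"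
      using norm_triangle_ineq4[of E "E - \<kappa> h * S_sum \<delta> g d a q"] by simp
    ultimately have low: "\<beta> / 40 * H \<le> cmod E" using near by linarith
    \<comment> \<open>The weights \<omega> have modulus at most 1 / sqrt p; this is the gain from
      the Gauss sums.\<close>
    have "cmod E \<le> (\<Sum>br\<in>I. 1 / sqrt (real p) * \<bar>G (x br + h) - G (x br)\<bar>)"
      unfolding E_def by (intro sum_norm_le, unfold norm_mult norm_of_real) (intro mult_right_mono \<omega>p abs_ge_zero)
    also have "\<dots> = 1 / sqrt (real p) * (\<Sum>br\<in>I. \<bar>G (x br + h) - G (x br)\<bar>)"
      by (simp add: sum_distrib_left)
    finally have up: "cmod E * sqrt (real p) \<le> (\<Sum>br\<in>I. \<bar>G (x br + h) - G (x br)\<bar>)"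
      using p0 by (simp add: field_simps)
    have "\<beta> / 40 * H * sqrt (real p) \<le> cmod E * sqrt (real p)"
      using low by (rule mult_right_mono) simp
    also note up
    also have "(\<Sum>br\<in>I. \<bar>G (x br + h) - G (x br)\<bar>) = (\<Sum>b<M. \<Sum>r=1..<p. \<bar>G (real a / real q + real b / real M + real r / real p + h)
                              - G (real a / real q + real b / real M + real r / real p)\<bar>)"
      unfolding I_def sum.cartesian_product x_def x0_def case_prod_unfold ..
    finally show "\<beta> / 40 * sqrt (real p) * h powr (\<delta> / 2)
      \<le> (\<Sum>b<M. \<Sum>r=1..<p. \<bar>G (real a / real q + real b / real M + real r / real p + h)
                              - G (real a / real q + real b / real M + real r / real p)\<bar>)"
      by (simp add: H_def mult_ac)
  qed (use M \<beta>0 in auto)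
qed

end

text \<open>The difference is t / (p p') with an integer t, and t is nonzero because distinct
  fractions r / p with p prime and 0 < r < p remain distinct modulo 1.\<close>

lemma dist_frac_fractions_ge:
  fixes y :: real and p p' r r' Q :: nat
  assumes p: "prime p" "p \<le> Q" and p': "prime p'" "p' \<le> Q"
    and r: "r \<in> {1..<p}" and r': "r' \<in> {1..<p'}" and ne: "(p, r) \<noteq> (p', r')"
  shows "1 / (real Q)\<^sup>2 \<le> \<bar>frac (y + real r / real p) - frac (y + real r' / real p')\<bar>"
proof -
  have pos: "p > 0" "p' > 0" using r r' by auto
  define z where "z = \<lfloor>y + real r / real p\<rfloor> - \<lfloor>y + real r' / real p'\<rfloor>"
  define t where "t = int r * int p' - int r' * int p - z * (int p * int p')"
  have eq: "frac (y + real r / real p) - frac (y + real r' / real p') = of_int t / (real p * real p')"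
    using pos by (simp add: frac_def z_def t_def field_simps)
  have t0: "t \<noteq> 0"
  proof
    assume t: "t = 0"
    then have "int r * int p' = int p * (int r' + z * int p')" by (simp add: t_def algebra_simps)
    then have "int p dvd int r * int p'" by simp
    then have "p dvd r * p'" by (metis int_dvd_int_iff of_nat_mult)
    moreover have "\<not> p dvd r" using r by (auto dest: dvd_imp_le)
    ultimately have "p dvd p'" using p(1) by (simp add: prime_dvd_mult_iff)
    then have pp: "p' = p" using p(1) p'(1) primes_dvd_imp_eq by blast
    have "int p * (int r - int r' - z * int p) = 0" using t by (simp add: t_def pp algebra_simps)
    then have d: "int r - int r' = z * int p" using pos by simp
    have "\<bar>int r - int r'\<bar> < int p" using r r' pp by auto
    then have "\<bar>z * int p\<bar> < 1 * int p" unfolding d by simp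
    then have "z = 0" using mult_right_less_imp_less[of "\<bar>z\<bar>" "int p" 1] by (simp add: abs_mult)
    then show False using d ne pp by simp
  qed
  have "real p * real p' \<le> (real Q)\<^sup>2"
    unfolding power2_eq_square using p p' by (intro mult_mono) auto
  then have "1 / (real Q)\<^sup>2 \<le> 1 / (real p * real p')"
    using pos p(2) by (intro divide_left_mono) (auto simp: zero_less_mult_iff)
  also have "\<dots> \<le> \<bar>of_int t\<bar> / (real p * real p')"
    using t0 by (intro divide_right_mono) auto
  finally show ?thesis unfolding eq by (simp add: abs_mult)
qed

section \<open>Summation over the primes and the dimension bound\<close>

context lacunary_series
begin

text \<open>For a fixed shift b, the points of all primes p \<le> sqrt N are jointly separated by 1
  / N, so a single box count bounds the sum over all p. Separation is not claimed across different
  b; adding the M bounds gives the factor M.\<close>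

lemma box_count_ge_sum_primes:
  assumes M: "M > 0" and N: "N > 0" "1 / real N < h\<^sub>0"
    and inc: "\<And>h p. 0 < h \<Longrightarrow> h < h\<^sub>0 \<Longrightarrow> prime p \<Longrightarrow> P < p \<Longrightarrow>
      c * sqrt (real p) * h powr (\<delta> / 2)
      \<le> (\<Sum>b<M. \<Sum>r=1..<p. \<bar>G (x0 + real b / real M + real r / real p + h) - G (x0 + real b / real M + real r / real p)\<bar>)"
  shows "c * real N powr (1 - \<delta> / 2) * (\<Sum>p | prime p \<and> P < p \<and> p \<le> nat \<lfloor>sqrt (real N)\<rfloor>. sqrt (real p))
    \<le> 6 * real M * real (box_count (graph_on_unit G) N)"
proof -
  define Q where "Q = nat \<lfloor>sqrt (real N)\<rfloor>"
  define \<P> where "\<P> = {p. prime p \<and> P < p \<and> p \<le> Q}"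
  define h where "h = 1 / real N"
  define I where "I = (SIGMA p:\<P>. {1..<p})"
  define A where "A = real (box_count (graph_on_unit G) N)"
  have h: "0 < h" "h < h\<^sub>0" using N by (auto simp: h_def)
  have finP: "finite \<P>" unfolding \<P>_def by (rule finite_subset[of _ "{..Q}"]) auto
  have finI: "finite I" unfolding I_def using finP by auto
  have "(real Q)\<^sup>2 \<le> (sqrt (real N))\<^sup>2" by (intro power_mono) (auto simp: Q_def)
  then have QN: "(real Q)\<^sup>2 \<le> real N" by simp
  have frac: "G (frac u + t) = G (u + t)" for u t
  proof -
    have "u + t = (frac u + t) + of_int \<lfloor>u\<rfloor>" by (simp add: frac_def)
    then show ?thesis by (simp only: periodic_add_of_int[of G, OF periodic_G])
  qed
  have b: "real N * (\<Sum>p\<in>\<P>. \<Sum>r=1..<p. \<bar>G (y + real r / real p + h) - G (y + real r / real p)\<bar>) \<le> 6 * A" for y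
  proof -
    define x where "x pr = frac (y + real (snd pr) / real (fst pr))" for pr :: "nat \<times> nat"
    have "real N * (\<Sum>pr\<in>I. \<bar>G (x pr + 1 / real N) - G (x pr)\<bar>) \<le> 6 * A"
      unfolding A_def
    proof (rule box_count_ge[OF continuous_G periodic_G N(1) finI])
      show "0 \<le> x pr \<and> x pr < 1" for pr by (simp add: x_def frac_lt_1)
      fix i j assume ij: "i \<in> I" "j \<in> I" "i \<noteq> j"
      then have "Q > 0" by (auto simp: I_def \<P>_def dest: prime_gt_0_nat)
      then have "1 / real N \<le> 1 / (real Q)\<^sup>2" using QN N(1) by (intro divide_left_mono) auto
      also have "\<dots> \<le> \<bar>x i - x j\<bar>" unfolding x_def
        using ij by (intro dist_frac_fractions_ge) (auto simp: I_def \<P>_def prod_eq_iff)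
      finally show "1 / real N \<le> \<bar>x i - x j\<bar>" .
    qed
    also have "(\<Sum>pr\<in>I. \<bar>G (x pr + 1 / real N) - G (x pr)\<bar>) = (\<Sum>pr\<in>I. \<bar>G (y + real (snd pr) / real (fst pr) + h) - G (y + real (snd pr) / real (fst pr))\<bar>)"
      using frac[of _ 0] by (simp add: x_def frac h_def)
    also have "\<dots> = (\<Sum>p\<in>\<P>. \<Sum>r=1..<p. \<bar>G (y + real r / real p + h) - G (y + real r / real p)\<bar>)"
      unfolding I_def using finP by (subst sum.Sigma) (auto simp: case_prod_unfold)
    finally show ?thesis .
  qed
  have "c * h powr (\<delta> / 2) * (\<Sum>p\<in>\<P>. sqrt (real p)) = (\<Sum>p\<in>\<P>. c * sqrt (real p) * h powr (\<delta> / 2))"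
    unfolding sum_distrib_left by (intro sum.cong refl) (simp add: mult_ac)
  also have "\<dots> \<le> (\<Sum>p\<in>\<P>. \<Sum>b<M. \<Sum>r=1..<p. \<bar>G (x0 + real b / real M + real r / real p + h) - G (x0 + real b / real M + real r / real p)\<bar>)"
    by (intro sum_mono inc h) (auto simp: \<P>_def)
  also have "\<dots> = (\<Sum>b<M. \<Sum>p\<in>\<P>. \<Sum>r=1..<p. \<bar>G (x0 + real b / real M + real r / real p + h) - G (x0 + real b / real M + real r / real p)\<bar>)"
    by (rule sum.swap)
  finally have "real N * (c * h powr (\<delta> / 2) * (\<Sum>p\<in>\<P>. sqrt (real p)))
    \<le> real N * (\<Sum>b<M. \<Sum>p\<in>\<P>. \<Sum>r=1..<p. \<bar>G (x0 + real b / real M + real r / real p + h) - G (x0 + real b / real M + real r / real p)\<bar>)"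
    by (rule mult_left_mono) simp
  also have "\<dots> \<le> (\<Sum>b<M. 6 * A)"
    unfolding sum_distrib_left[of "real N"] by (intro sum_mono b[unfolded sum_distrib_left[of "real N"]])
  also have "\<dots> = 6 * real M * A" by simp
  also have "real N * (c * h powr (\<delta> / 2) * (\<Sum>p\<in>\<P>. sqrt (real p)))
    = c * (real N powr 1 * real N powr - (\<delta> / 2)) * (\<Sum>p\<in>\<P>. sqrt (real p))"
    using N by (simp add: h_def powr_divide powr_minus_divide)
  also have "real N powr 1 * real N powr - (\<delta> / 2) = real N powr (1 - \<delta> / 2)"
    unfolding powr_add[symmetric] by simp
  finally show ?thesis by (simp add: A_def \<P>_def Q_def)
qed

text \<open>With sqrt N in \<open>sum_sqrt_primes_ge\<close>, the exponent of N becomes 1 -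
  \<delta>/2 + 3 (1 - \<eta>) / 4 = 7/4 - \<delta>/2 - 3 \<eta> / 4. The remaining \<eta> / 4
  absorbs the constant k once ln N is large.\<close>

lemma lower_box_dim_ge:
  assumes d: "d > 0" "squarefree d" and q: "q > 0" and S: "S_sum \<delta> g d a q \<noteq> 0"
  shows "lower_box_dim (graph_on_unit G) \<ge> ereal (7 / 4 - \<delta> / 2)"
proof (rule increments_lower_bound[OF d q S])
  fix M P :: nat and c h\<^sub>0 :: real
  assume M: "M > 0" and c: "c > 0" and h0: "h\<^sub>0 > 0"
    and inc: "\<And>h p. 0 < h \<Longrightarrow> h < h\<^sub>0 \<Longrightarrow> prime p \<Longrightarrow> P < p \<Longrightarrow>
      c * sqrt (real p) * h powr (\<delta> / 2)
      \<le> (\<Sum>b<M. \<Sum>r=1..<p. \<bar>G (real a / real q + real b / real M + real r / real p + h)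
                              - G (real a / real q + real b / real M + real r / real p)\<bar>)"
  define A where "A N = real (box_count (graph_on_unit G) N)" for N
  have main: "ereal (7 / 4 - \<delta> / 2 - \<eta>) \<le> lower_box_dim (graph_on_unit G)" if \<eta>: "0 < \<eta>" "\<eta> < 1" for \<eta>
    unfolding lower_box_dim_def
  proof (rule Liminf_bounded)
    define \<theta> where "\<theta> = (1 - \<eta>) * (3 / 2)"
    have \<theta>0: "\<theta> > 0" using \<eta> by (simp add: \<theta>_def)
    define k where "k = ln (c / (6 * real M)) - \<theta> * ln 2"
    have "filterlim (\<lambda>N. nat \<lfloor>sqrt (real N)\<rfloor>) at_top sequentially"
      by (intro filterlim_compose[OF filterlim_nat_sequentially] filterlim_compose[OF filterlim_floor_sequentially]
          filterlim_compose[OF sqrt_at_top] filterlim_real_sequentially)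
    from eventually_compose_filterlim[OF sum_sqrt_primes_ge[OF \<eta>, of P] this]
    have "\<forall>\<^sub>F N in sequentially. real (nat \<lfloor>sqrt (real N)\<rfloor>) powr \<theta>
        \<le> (\<Sum>p | prime p \<and> P < p \<and> p \<le> nat \<lfloor>sqrt (real N)\<rfloor>. sqrt (real p))"
      by (simp add: \<theta>_def)
    moreover have "\<forall>\<^sub>F N in sequentially. N \<ge> 4" by (rule eventually_ge_at_top)
    moreover have "\<forall>\<^sub>F N in sequentially. 1 / real N < h\<^sub>0"
      using h0 by real_asymp
    moreover have "filterlim (\<lambda>N. ln (real N)) at_top sequentially" by real_asymp
    then have "\<forall>\<^sub>F N in sequentially. \<bar>k\<bar> * 4 / \<eta> \<le> ln (real N)" by (simp add: filterlim_at_top)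
    ultimately show "\<forall>\<^sub>F N in sequentially. ereal (7 / 4 - \<delta> / 2 - \<eta>) \<le> ereal (ln (real (box_count (graph_on_unit G) N)) / ln (real N))"
    proof eventually_elim
      case (elim N)
      define s where "s = sqrt (real N)"
      have "sqrt 4 \<le> s" unfolding s_def using elim by (intro real_sqrt_le_mono) simp
      then have s2: "2 \<le> s" by simp
      then have "s / 2 \<le> real (nat \<lfloor>s\<rfloor>)" by linarith
      then have "(s / 2) powr \<theta> \<le> real (nat \<lfloor>s\<rfloor>) powr \<theta>" using \<theta>0 s2 by (intro powr_mono2) auto
      also have "\<dots> \<le> (\<Sum>p | prime p \<and> P < p \<and> p \<le> nat \<lfloor>s\<rfloor>. sqrt (real p))" using elim by (simp add: s_def)
      finally have "c * real N powr (1 - \<delta> / 2) * (s / 2) powr \<theta>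
        \<le> c * real N powr (1 - \<delta> / 2) * (\<Sum>p | prime p \<and> P < p \<and> p \<le> nat \<lfloor>s\<rfloor>. sqrt (real p))"
        using c by (intro mult_left_mono) auto
      also have "\<dots> \<le> 6 * real M * A N"
        unfolding A_def s_def using elim by (intro box_count_ge_sum_primes[OF M _ _ inc]) auto
      finally have le: "c / (6 * real M) * real N powr (1 - \<delta> / 2) * (s / 2) powr \<theta> \<le> A N"
        using M by (simp add: field_simps)
      have pos: "c / (6 * real M) * real N powr (1 - \<delta> / 2) * (s / 2) powr \<theta> > 0"
        using c M elim s2 by simp
      have "ln (c / (6 * real M) * real N powr (1 - \<delta> / 2) * (s / 2) powr \<theta>) \<le> ln (A N)"
        using le pos by (intro ln_mono) auto
      also have "ln (c / (6 * real M) * real N powr (1 - \<delta> / 2) * (s / 2) powr \<theta>)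
         = ln (c / (6 * real M)) + (1 - \<delta> / 2) * ln (real N) + \<theta> * (ln (real N) / 2 - ln 2)"
      proof -
        have s: "ln (s / 2) = ln (real N) / 2 - ln 2" using elim by (simp add: s_def ln_div ln_sqrt)
        have l: "ln (c1 * real N powr (1 - \<delta> / 2) * (s / 2) powr \<theta>) = ln c1 + (1 - \<delta> / 2) * ln (real N) + \<theta> * ln (s / 2)"
          if "c1 > 0" for c1
          using that elim(2) s2 by (simp add: ln_mult ln_powr del: half_gt_zero_iff)
        have "c / (6 * real M) > 0" using c M by simp
        from l[OF this] show ?thesis unfolding s .
      qed
      also have "\<dots> = k + (1 - \<delta> / 2 + \<theta> / 2) * ln (real N)" by (simp add: k_def algebra_simps)
      finally have low: "k + (1 - \<delta> / 2 + \<theta> / 2) * ln (real N) \<le> ln (A N)" .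
      have lnN: "ln (real N) > 0" using elim by simp
      have "\<bar>k\<bar> \<le> \<eta> / 4 * ln (real N)" using elim \<eta> by (simp add: field_simps)
      then have "0 \<le> k + \<eta> / 4 * ln (real N)" by linarith
      moreover have "k + (1 - \<delta> / 2 + \<theta> / 2) * ln (real N) = (7 / 4 - \<delta> / 2 - \<eta>) * ln (real N) + (k + \<eta> / 4 * ln (real N))"
        by (simp add: \<theta>_def field_simps)
      ultimately have "(7 / 4 - \<delta> / 2 - \<eta>) * ln (real N) \<le> ln (A N)" using low by linarith
      then show ?case using lnN by (simp add: A_def field_simps)
    qed
  qed
  show ?thesis
  proof (rule ereal_le_epsilon2)
    fix \<eta> :: real assume \<eta>: "0 < \<eta>"
    \<comment> \<open>The bound \<open>main\<close> needs a parameter below 1.\<close>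
    define \<eta>' where "\<eta>' = min \<eta> (1 / 2)"
    have "ereal (7 / 4 - \<delta> / 2 - \<eta>') \<le> lower_box_dim (graph_on_unit G)"
      using \<eta> by (intro main) (auto simp: \<eta>'_def)
    then have "ereal (7 / 4 - \<delta> / 2 - \<eta>') + ereal \<eta> \<le> lower_box_dim (graph_on_unit G) + ereal \<eta>"
      by (rule add_right_mono)
    moreover have "ereal (7 / 4 - \<delta> / 2) \<le> ereal (7 / 4 - \<delta> / 2 - \<eta>') + ereal \<eta>"
      by (simp add: \<eta>'_def)
    ultimately show "ereal (7 / 4 - \<delta> / 2) \<le> lower_box_dim (graph_on_unit G) + ereal \<eta>"
      by (rule order_trans[rotated])
  qed
qed

end

theorem theorem1p2:
  fixes \<delta> \<epsilon> :: real and g :: "real \<Rightarrow> real" and a\<^sub>0 q\<^sub>0 d\<^sub>0 :: nat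
  assumes "0 < \<delta>" and "\<delta> \<le> 1"
    and "continuous_on UNIV g" and "\<And>x. g (x + 1) = g x"
    and "fourier_coeff g 0 = 0"
    and "0 < \<epsilon>"
    and "summable (\<lambda>n. cmod (fourier_coeff g (int (Suc n))) * real (Suc n) powr ((\<epsilon> + \<delta>) / 2))"
    and "0 < a\<^sub>0" and "0 < q\<^sub>0" and "coprime a\<^sub>0 q\<^sub>0"
    and "0 < d\<^sub>0" and "squarefree d\<^sub>0"
    and "S_sum \<delta> g d\<^sub>0 a\<^sub>0 q\<^sub>0 \<noteq> 0"
  shows "lower_box_dim (graph_on_unit (G_delta \<delta> g)) \<ge> ereal (7 / 4 - \<delta> / 2)"
proof -
  have "summable (\<lambda>n. cmod (fourier_coeff g (int (Suc n))) * real (Suc n) powr (\<delta> / 2))"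
  proof (rule summable_comparison_test'[OF assms(7), of 0])
    fix n
    have "real (Suc n) powr (\<delta> / 2) \<le> real (Suc n) powr ((\<epsilon> + \<delta>) / 2)"
      using assms(6) by (intro powr_mono) auto
    then show "norm (cmod (fourier_coeff g (int (Suc n))) * real (Suc n) powr (\<delta> / 2))
      \<le> cmod (fourier_coeff g (int (Suc n))) * real (Suc n) powr ((\<epsilon> + \<delta>) / 2)"
      by (simp add: mult_left_mono)
  qed
  then interpret lacunary_series \<delta> g "\<lambda>j. fourier_coeff g (int (Suc j))"
    using assms(1-5) by unfold_locales auto
  show ?thesis using lower_box_dim_ge assms(9,11-13) by blast
qed

end
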